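(* Let $k\geq 4$ be an even integer and fix $b\in\{1,3\}$. Let $f\in S_k$ be a cusp form, not necessarily a Hecke eigenform, and let $s$ be a complex number with $\mathrm{Re}(s)>\frac{k+1}{2}$. If $L(f,\chi_p,s)=0$ for all primes $p\equiv b\pmod 4$, then $f=0$.
   Context: $S_k$ is the space of cusp forms of weight $k$ for $\mathrm{SL}_2(\mathbb{Z})$. For an odd prime $p$, $\chi_p=\left(\frac{\cdot}{p}\right)$ is the Legendre symbol. For $f(z)=\sum_{n\geq1}a_f(n)q^n\in S_k$ ($q=e^{2\pi i z}$) and a primitive Dirichlet character $\chi$, the twisted $L$-function is $L(f,\chi,s)=\sum_{n=1}^\infty a_f(n)\chi(n)n^{-s}$, which converges absolutely for $\mathrm{Re}(s)>\frac{k+1}{2}$ (by Deligne's bound). *)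

theory Defs
  imports "HOL-Complex_Analysis.Complex_Analysis" "HOL-Number_Theory.Number_Theory"
begin

text \<open>
  Modular forms are represented by total functions on the complex numbers; only their values
  on the open upper half-plane are meaningful. In particular a form is zero iff it
  vanishes on \<open>upper_half_plane\<close>.
\<close>

definition upper_half_plane :: "complex set" where
  "upper_half_plane = {z. Im z > 0}"

definition has_q_expansion :: "(complex \<Rightarrow> complex) \<Rightarrow> (nat \<Rightarrow> complex) \<Rightarrow> bool" where
  "has_q_expansion f a \<longleftrightarrow>
     (\<forall>z\<in>upper_half_plane. (\<lambda>n. a n * exp (2 * of_real pi * \<i> * z) ^ n) sums f z)"

definition cusp_forms :: "nat \<Rightarrow> (complex \<Rightarrow> complex) set" where
  "cusp_forms k = {f.
     f holomorphic_on upper_half_plane \<and>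
     (\<forall>a b c d :: int. \<forall>z\<in>upper_half_plane. a * d - b * c = 1 \<longrightarrow>
        f ((of_int a * z + of_int b) / (of_int c * z + of_int d)) =
          (of_int c * z + of_int d) ^ k * f z) \<and>
     (\<exists>a. has_q_expansion f a \<and> a 0 = 0)}"

text \<open>
  The coefficient sequence is unique whenever it exists
  (lemma \<open>has_q_expansion_unique\<close> below), so the definite description is meaningful
  for every cusp form.
\<close>

definition q_coeff :: "(complex \<Rightarrow> complex) \<Rightarrow> nat \<Rightarrow> complex" where
  "q_coeff f = (THE a. has_q_expansion f a)"

definition twisted_L :: "(complex \<Rightarrow> complex) \<Rightarrow> (int \<Rightarrow> complex) \<Rightarrow> complex \<Rightarrow> complex" where
  "twisted_L f chi s =
     (\<Sum>n. q_coeff f (Suc n) * chi (int (Suc n)) * of_nat (Suc n) powr (- s))"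

definition legendre_char :: "nat \<Rightarrow> int \<Rightarrow> complex" where
  "legendre_char p m = of_int (Legendre m (int p))"

lemma has_q_expansion_unique:
  assumes "has_q_expansion f a" and "has_q_expansion f b"
  shows "a = b"
proof -
  define c where "c = (\<lambda>n. a n - b n)"
  have c0: "(\<lambda>n. c n * q ^ n) sums 0" if "q \<noteq> 0" "norm q < 1" for q
  proof -
    define z where "z = Ln q / (2 * of_real pi * \<i>)"
    have q: "exp (2 * of_real pi * \<i> * z) = q"
      using that by (simp add: z_def)
    have "norm (exp (2 * of_real pi * \<i> * z)) < 1"
      using that q by simp
    hence "0 < 2 * pi * Im z"
      by (simp add: norm_exp_eq_Re)
    hence "z \<in> upper_half_plane"
      using pi_gt_zero unfolding upper_half_plane_def by (simp add: zero_less_mult_iff)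
    hence "(\<lambda>n. a n * q ^ n) sums f z" "(\<lambda>n. b n * q ^ n) sums f z"
      using assms q unfolding has_q_expansion_def by force+
    from sums_diff[OF this] show ?thesis
      by (simp add: c_def algebra_simps)
  qed
  define g where "g = (\<lambda>q::complex. if q = 0 then c 0 else 0)"
  have sums_g: "(\<lambda>n. c n * q ^ n) sums g q" if "norm q < 1" for q
  proof (cases "q = 0")
    case True
    thus ?thesis using powser_sums_zero[of c] by (simp add: g_def)
  next
    case False
    thus ?thesis using c0 that by (simp add: g_def)
  qed
  have "(g \<longlongrightarrow> c 0) (at 0)"
    using powser_limit_0[of 1 c g] sums_g by simp
  moreover have "(g \<longlongrightarrow> 0) (at 0)"
    by (rule tendsto_eventually) (auto simp: g_def eventually_at_filter)
  ultimately have c_0: "c 0 = 0"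
    by (rule tendsto_unique[OF at_neq_bot])
  have "c m = 0" for m
  proof (rule ccontr)
    assume m: "c m \<noteq> 0"
    with c_0 have "m > 0" by (cases m) auto
    obtain s where s: "0 < s" "\<And>z. z \<in> cball 0 s - {0} \<Longrightarrow> g z \<noteq> 0"
      using powser_0_nonzero[of 1 0 c g m] sums_g c_0 m \<open>m > 0\<close> by (auto simp: g_def)
    from s(2)[of "of_real s"] s(1) show False
      by (simp add: g_def)
  qed
  thus ?thesis by (auto simp: c_def)
qed

lemma q_coeff_eqI: "has_q_expansion f a \<Longrightarrow> q_coeff f = a"
  unfolding q_coeff_def using has_q_expansion_unique by blast

end

theory Submission
  imports Defs
    "HOL-Computational_Algebra.Squarefree"
    "HOL-Computational_Algebra.Fundamental_Theorem_Algebra"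
begin

text \<open>
  By quadratic reciprocity and the nonvanishing of \<open>L(1, \<psi>)\<close> for real characters \<open>\<psi>\<close>, the average of
  \<open>\<chi>\<^sub>p(n)\<close> over the primes \<open>p \<equiv> b (mod 4)\<close> is \<open>1\<close> if \<open>n\<close> is a square and \<open>0\<close> otherwise. Averaging
  \<open>\<chi>\<^sub>p(m) L(f, \<chi>\<^sub>p, s) = 0\<close> therefore gives \<open>\<Sum>\<^sub>j a(m j\<^sup>2) j\<^bsup>-2s\<^esup> = 0\<close> for every squarefree \<open>m\<close>.
  Let \<open>V\<^sub>Q\<close> be the space of all cusp forms satisfying these relations for the \<open>m\<close> coprime to a finite
  set \<open>Q\<close> of primes. It grows with \<open>Q\<close>, hence is constant from some \<open>Q\<close> on, and is then stable under
  the Hecke operators \<open>T\<^sub>p\<close> with \<open>p \<notin> Q\<close>. If it were nonzero it would contain an eigenform of these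
  operators. A form of level one whose coefficients prime to \<open>Q\<close> vanish is zero, so the eigenform has
  \<open>a(1) \<noteq> 0\<close> and is an eigenform of all Hecke operators; but then \<open>\<Sum>\<^sub>j a(j\<^sup>2) j\<^bsup>-2s\<^esup>\<close> is a convergent
  Euler product with nonzero factors, a contradiction. Absolute convergence needs only that
  \<open>\<Sum>\<^sub>n\<^sub><\<^sub>N \<bar>a(n)\<bar>\<^sup>2 = O(N\<^sup>k)\<close>, which follows from Parseval's identity.
\<close>


section \<open>Prime sums of real characters\<close>

text \<open>Primes are averaged with weights p^(-sigma) as sigma tends to 1 from the right. For such
  a Dirichlet density it is enough that sum psi(p) p^(-sigma) stays bounded, so L(1,psi) != 0 is the
  one deep input on primes. Since f need not be an eigenform, its relations have to be carried over
  to one. T_p a satisfies the relation at m as soon as a satisfies it at m p, provided p does not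
  divide m, for then p | m j^2 exactly when p | j. This proviso is why T_p maps V_Q only into the
  space for Q and p together, and why one has to wait until V_Q stops growing. No inner product is
  used to diagonalise: a minimal stable subspace yields the common eigenvector, and the finite set
  of positions of leading nonzero coefficients serves as dimension, bounded because k vanishing
  initial coefficients annihilate a form. The condition on Re s enters twice: for absolute
  convergence, and for |p^(k-1-2s)| < 1, which makes the factors 1 + p^(k-1-2s) of the square sum
  nonzero.\<close>

text \<open>As \<open>p\<close> is not in \<open>Q\<close>, replacing \<open>n\<close> by
  \<open>p * n\<close> leaves the sieving condition unchanged and multiplies \<open>h\<close> by
  \<open>h p\<close>; so the multiples of \<open>p\<close> carry exactly the share
  \<open>h p\<close> of the sum sieved by \<open>Q\<close>.\<close>

lemma euler_factor_sieve:
  fixes h :: "nat \<Rightarrow> real"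
  assumes mult: "\<And>m n. h (m * n) = h m * h n" and summ: "summable (\<lambda>n. \<bar>h n\<bar>)"
    and p: "prime p" and Q: "\<And>q. q \<in> Q \<Longrightarrow> prime q" "p \<notin> Q"
  shows "(\<Sum>n. if \<forall>q\<in>insert p Q. \<not> q dvd n then h n else 0) = (1 - h p) * (\<Sum>n. if \<forall>q\<in>Q. \<not> q dvd n then h n else 0)"
proof -
  let ?g = "\<lambda>n. if \<forall>q\<in>Q. \<not> q dvd n then h n else 0"
  let ?g' = "\<lambda>n. if p dvd n then ?g n else 0"
  have g: "summable ?g" by (rule summable_comparison_test'[OF summ, of 0]) auto
  have mono: "strict_mono (\<lambda>n. p * n)" using p prime_gt_0_nat by (simp add: strict_mono_def)
  have "?g (p * n) = h p * ?g n" for n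
  proof -
    have "(\<forall>q\<in>Q. \<not> q dvd p * n) \<longleftrightarrow> (\<forall>q\<in>Q. \<not> q dvd n)"
      using Q p by (metis prime_dvd_mult_iff primes_dvd_imp_eq)
    then show ?thesis by (simp add: mult)
  qed
  then have "(\<lambda>n. ?g (p * n)) sums (h p * suminf ?g)"
    using sums_mult[OF summable_sums[OF g], of "h p"] by (simp only:)
  then have "(\<lambda>n. ?g' (p * n)) sums (h p * suminf ?g)" by simp
  then have g': "?g' sums (h p * suminf ?g)"
    by (subst (asm) sums_mono_reindex[OF mono]) (auto simp: dvd_def)
  have "(\<lambda>n. ?g n - ?g' n) sums (suminf ?g - h p * suminf ?g)"
    by (rule sums_diff[OF summable_sums[OF g] g'])
  moreover have "?g n - ?g' n = (if \<forall>q\<in>insert p Q. \<not> q dvd n then h n else 0)" for n by auto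
  ultimately have "(\<lambda>n. if \<forall>q\<in>insert p Q. \<not> q dvd n then h n else 0) sums (suminf ?g - h p * suminf ?g)"
    by (simp only:)
  then show ?thesis by (simp add: sums_iff algebra_simps)
qed

text \<open>Only finite products occur: each prime below \<open>N\<close> sieves its multiples out
  of the sum, and what is left is \<open>h 1 = 1\<close> plus terms of index at least
  \<open>N\<close>, a tail of an absolutely convergent series.\<close>

lemma euler_product_limit:
  fixes h :: "nat \<Rightarrow> real"
  assumes mult: "\<And>m n. h (m * n) = h m * h n" and summ: "summable (\<lambda>n. \<bar>h n\<bar>)" and h: "h 0 = 0" "h 1 = 1"
  shows "(\<lambda>N. (\<Prod>p\<in>{p. prime p \<and> p < N}. 1 - h p) * (\<Sum>n. h n)) \<longlonglongrightarrow> 1"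
proof -
  let ?\<Lambda> = "\<lambda>Q n. if \<forall>q\<in>Q. \<not> q dvd n then h n else 0"
  have prod: "suminf (?\<Lambda> Q) = (\<Prod>p\<in>Q. 1 - h p) * (\<Sum>n. h n)" if "finite Q" "\<forall>q\<in>Q. prime q" for Q
    using that
  proof (induction Q rule: finite_induct)
    case (insert p Q)
    then have "suminf (?\<Lambda> (insert p Q)) = (1 - h p) * suminf (?\<Lambda> Q)"
      by (intro euler_factor_sieve[OF mult summ]) auto
    with insert show ?case by simp
  qed simp
  define P where "P = (\<lambda>N. {p. prime p \<and> p < (N :: nat)})"
  have P: "finite (P N)" "\<forall>q\<in>P N. prime q" for N by (auto simp: P_def)
  define T where "T = (\<lambda>N. \<Sum>n. \<bar>h (n + N)\<bar>)"
  have T0: "T \<longlonglongrightarrow> 0" unfolding T_def by (rule suminf_exist_split2) (use summ in simp)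
  have close: "norm (suminf (?\<Lambda> (P N)) - 1) \<le> T N" if N: "N \<ge> 2" for N
  proof -
    have s: "summable (?\<Lambda> (P N))" by (rule summable_comparison_test'[OF summ, of 0]) auto
    have small: "?\<Lambda> (P N) n = (if n = 1 then 1 else 0)" if "n < N" for n
    proof (cases "n \<le> 1")
      case True
      then have "n = 0 \<or> n = 1" by auto
      then show ?thesis using h by (auto simp: P_def)
    next
      case False
      then obtain p where p: "prime p" "p dvd n" using prime_factor_nat[of n] by auto
      moreover have "p < N" using dvd_imp_le[of p n] p False that by simp
      ultimately show ?thesis using False by (auto simp: P_def)
    qed
    have "(\<Sum>n<N. ?\<Lambda> (P N) n) = (\<Sum>n<N. if n = 1 then 1 else 0)"
      by (rule sum.cong) (use small in auto)
    also have "\<dots> = 1" using N by simp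
    finally have "suminf (?\<Lambda> (P N)) - 1 = (\<Sum>n. ?\<Lambda> (P N) (n + N))"
      using suminf_split_initial_segment[OF s, of N] by simp
    also have "norm \<dots> \<le> T N" unfolding T_def
      by (rule norm_suminf_le) (use summable_ignore_initial_segment[OF summ, of N] in auto)
    finally show ?thesis .
  qed
  have "(\<lambda>N. suminf (?\<Lambda> (P N)) - 1) \<longlonglongrightarrow> 0"
    by (rule Lim_null_comparison[OF _ T0]) (use close in \<open>auto simp: eventually_at_top_linorder\<close>)
  then have "(\<lambda>N. suminf (?\<Lambda> (P N))) \<longlonglongrightarrow> 1" by (simp add: LIM_zero_iff)
  then show ?thesis unfolding prod[OF P] unfolding P_def .
qed

text \<open>The limit 1 of \<open>E N * L\<close> with \<open>E N > 0\<close> forces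
  \<open>L > 0\<close>. Taking logarithms and using ln(1 - x) = -x + O(x^2) leaves an error
  controlled by the sum of 1/p^2. The bound does not depend on \<open>h\<close>, which permits the
  later passage to the edge of convergence.\<close>

lemma sum_over_primes_ln:
  fixes h :: "nat \<Rightarrow> real"
  assumes mult: "\<And>m n. h (m * n) = h m * h n" and summ: "summable (\<lambda>n. \<bar>h n\<bar>)" and h: "h 0 = 0" "h 1 = 1"
    and le: "\<And>n. n > 0 \<Longrightarrow> \<bar>h n\<bar> \<le> 1 / real n"
  shows "(\<Sum>n. h n) > 0" "\<bar>(\<Sum>n. if prime n then h n else 0) - ln (\<Sum>n. h n)\<bar> \<le> 2 * (\<Sum>n. 1 / (real n)\<^sup>2)"
proof -
  define P where "P = (\<lambda>N. {p. prime p \<and> p < (N :: nat)})"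
  define L where "L = (\<Sum>n. h n)"
  define E where "E = (\<lambda>N. \<Prod>p\<in>P N. 1 - h p)"
  have P: "finite (P N)" for N by (auto simp: P_def)
  have half: "\<bar>h p\<bar> \<le> 1 / 2" if "prime p" for p
  proof -
    have "p \<ge> 2" using prime_ge_2_nat[OF that] .
    then have "1 / real p \<le> 1 / 2" by (intro divide_left_mono) auto
    then show ?thesis using order.trans[OF le[of p], of "1 / 2"] \<open>p \<ge> 2\<close> by simp
  qed
  have pos: "1 - h p > 0" if "p \<in> P N" for p N
    using half[of p] that by (simp add: P_def abs_le_iff)
  have E_pos: "E N > 0" for N unfolding E_def by (rule prod_pos) (use pos in auto)
  have lim: "(\<lambda>N. E N * L) \<longlonglongrightarrow> 1"
    using euler_product_limit[OF mult summ h] by (simp add: E_def L_def P_def)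
  have "L > 0"
  proof (rule ccontr)
    assume "\<not> L > 0"
    then have "E N * L \<le> 0" for N using E_pos[of N] by (simp add: mult_le_0_iff)
    then have "1 \<le> (0 :: real)" using lim by (intro LIMSEQ_le_const2) auto
    then show False by simp
  qed
  then show "(\<Sum>n. h n) > 0" by (simp add: L_def)
  have "(\<lambda>N. ln (E N * L)) \<longlonglongrightarrow> ln 1" by (rule tendsto_ln[OF lim]) simp
  then have ln_lim: "(\<lambda>N. (\<Sum>p\<in>P N. ln (1 - h p)) + ln L) \<longlonglongrightarrow> 0"
  proof -
    have "ln (E N) = (\<Sum>p\<in>P N. ln (1 - h p))" for N
      unfolding E_def by (rule ln_prod[OF P]) (use pos in force)
    moreover have "ln (E N * L) = ln (E N) + ln L" for N by (rule ln_mult_pos[OF E_pos \<open>L > 0\<close>])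
    ultimately show ?thesis using \<open>(\<lambda>N. ln (E N * L)) \<longlonglongrightarrow> ln 1\<close> by simp
  qed
  have sp: "summable (\<lambda>n. if prime n then h n else 0)"
    by (rule summable_comparison_test'[OF summ, of 0]) auto
  have sum_P: "(\<Sum>p\<in>P N. h p) = (\<Sum>n<N. if prime n then h n else 0)" for N
    by (rule sum.mono_neutral_cong_left) (auto simp: P_def)
  have "(\<lambda>N. \<Sum>p\<in>P N. h p) \<longlonglongrightarrow> (\<Sum>n. if prime n then h n else 0)"
    unfolding sum_P by (rule summable_LIMSEQ[OF sp])
  from tendsto_diff[OF tendsto_add[OF this ln_lim] tendsto_const[of "ln L"]]
  have "(\<lambda>N. \<Sum>p\<in>P N. h p + ln (1 - h p)) \<longlonglongrightarrow> (\<Sum>n. if prime n then h n else 0) - ln L"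
    by (simp add: sum.distrib add.assoc)
  then have lim2: "(\<lambda>N. \<bar>\<Sum>p\<in>P N. h p + ln (1 - h p)\<bar>) \<longlonglongrightarrow> \<bar>(\<Sum>n. if prime n then h n else 0) - ln L\<bar>"
    by (rule tendsto_rabs)
  have s2: "summable (\<lambda>n. 1 / (real n)\<^sup>2)" using inverse_power_summable[of 2] by (simp add: inverse_eq_divide)
  have "\<bar>\<Sum>p\<in>P N. h p + ln (1 - h p)\<bar> \<le> 2 * (\<Sum>n. 1 / (real n)\<^sup>2)" for N
  proof -
    have "\<bar>\<Sum>p\<in>P N. h p + ln (1 - h p)\<bar> \<le> (\<Sum>p\<in>P N. \<bar>h p + ln (1 - h p)\<bar>)" by (rule sum_abs)
    also have "\<dots> \<le> (\<Sum>p\<in>P N. 2 * (1 / (real p)\<^sup>2))"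
    proof (rule sum_mono)
      fix p assume p: "p \<in> P N"
      then have "prime p" by (simp add: P_def)
      have "\<bar>h p + ln (1 - h p)\<bar> \<le> 2 * (h p)\<^sup>2"
        using abs_ln_one_plus_x_minus_x_bound[of "- h p"] half[OF \<open>prime p\<close>] by (simp add: add.commute)
      also have "(h p)\<^sup>2 = \<bar>h p\<bar>\<^sup>2" by simp
      also have "\<bar>h p\<bar>\<^sup>2 \<le> (1 / real p)\<^sup>2"
        using le[of p] prime_gt_0_nat[OF \<open>prime p\<close>] by (intro power_mono) auto
      finally show "\<bar>h p + ln (1 - h p)\<bar> \<le> 2 * (1 / (real p)\<^sup>2)" by (simp add: power_divide)
    qed
    also have "\<dots> = 2 * (\<Sum>p\<in>P N. 1 / (real p)\<^sup>2)" by (simp only: sum_distrib_left)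
    also have "\<dots> \<le> 2 * (\<Sum>n. 1 / (real n)\<^sup>2)"
      by (intro mult_left_mono sum_le_suminf s2 P) auto
    finally show ?thesis .
  qed
  then show "\<bar>(\<Sum>n. if prime n then h n else 0) - ln (\<Sum>n. h n)\<bar> \<le> 2 * (\<Sum>n. 1 / (real n)\<^sup>2)"
    unfolding L_def[symmetric] by (intro LIMSEQ_le_const2[OF lim2]) auto
qed

section \<open>Summation by parts with bounded partial sums and decreasing weights\<close>

lemma abel_sum_bound:
  fixes b c :: "nat \<Rightarrow> real"
  assumes c: "\<And>N. \<bar>\<Sum>n<N. c n\<bar> \<le> D" and b: "\<And>n. b (Suc n) \<le> b n" "\<And>n. b n \<ge> 0"
  shows "\<bar>\<Sum>n<N. c n * b n\<bar> \<le> D * b 0"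
proof -
  let ?S = "\<lambda>N. \<Sum>n<N. c n"
  have D: "D \<ge> 0" using c[of 0] by simp
  have "(\<Sum>n<N. c n * b n) = ?S N * b N + (\<Sum>n<N. ?S (Suc n) * (b n - b (Suc n)))"
    by (induction N) (simp_all add: algebra_simps)
  also have "\<bar>\<dots>\<bar> \<le> D * b N + (\<Sum>n<N. D * (b n - b (Suc n)))"
  proof -
    have "\<bar>?S N * b N\<bar> \<le> D * b N"
      unfolding abs_mult using b(2)[of N] mult_right_mono[OF c[of N] b(2)[of N]] by simp
    moreover have "\<bar>\<Sum>n<N. ?S (Suc n) * (b n - b (Suc n))\<bar> \<le> (\<Sum>n<N. D * (b n - b (Suc n)))"
    proof (rule order.trans[OF sum_abs], rule sum_mono)
      fix n
      show "\<bar>?S (Suc n) * (b n - b (Suc n))\<bar> \<le> D * (b n - b (Suc n))"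
        unfolding abs_mult using b(1)[of n] mult_right_mono[OF c[of "Suc n"], of "b n - b (Suc n)"] by simp
    qed
    ultimately show ?thesis by linarith
  qed
  also have "(\<Sum>n<N. D * (b n - b (Suc n))) = D * (b 0 - b N)"
    by (simp only: sum_distrib_left[symmetric] sum_lessThan_telescope')
  finally show ?thesis by (simp add: algebra_simps)
qed

text \<open>The factor 2 arises because a block of terms starting at \<open>M\<close> is a
  difference of two initial sums. Convergence is only conditional, which is what reaches
  \<open>\<sigma> = 1\<close>.\<close>

lemma abel_tail_bound:
  fixes b c :: "nat \<Rightarrow> real"
  assumes c: "\<And>N. \<bar>\<Sum>n<N. c n\<bar> \<le> D" and b: "\<And>n. b (Suc n) \<le> b n" "b \<longlonglongrightarrow> 0"
  shows "summable (\<lambda>n. c n * b n)" "\<bar>(\<Sum>n. c n * b n) - (\<Sum>n<M. c n * b n)\<bar> \<le> 2 * D * b M"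
proof -
  have b0: "b n \<ge> 0" for n
    using decseq_ge[OF decseq_SucI[of b] b(2)] b(1) by blast
  have c': "\<bar>\<Sum>n<N. c (n + M)\<bar> \<le> 2 * D" for N M
  proof -
    have "(\<Sum>n<M + N. c n) = (\<Sum>n<M. c n) + (\<Sum>n<N. c (n + M))"
      by (induction N) (simp_all add: add.commute)
    then show ?thesis using c[of "M + N"] c[of M] by linarith
  qed
  have tail: "\<bar>(\<Sum>n<M + N. c n * b n) - (\<Sum>n<M. c n * b n)\<bar> \<le> 2 * D * b M" for M N
  proof -
    have "(\<Sum>n<M + N. c n * b n) = (\<Sum>n<M. c n * b n) + (\<Sum>n<N. c (n + M) * b (n + M))"
      by (induction N) (simp_all add: add.commute)
    then show ?thesis
      using abel_sum_bound[of "\<lambda>n. c (n + M)" "2 * D" "\<lambda>n. b (n + M)" N] c' b(1) b0 by simp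
  qed
  have D: "D \<ge> 0" using c[of 0] by simp
  show s: "summable (\<lambda>n. c n * b n)"
    unfolding summable_iff_convergent Cauchy_convergent_iff[symmetric]
  proof (rule CauchyI')
    fix e :: real assume e: "e > 0"
    have "(\<lambda>n. 2 * D * b n) \<longlonglongrightarrow> 2 * D * 0" by (intro tendsto_intros b(2))
    then have "eventually (\<lambda>n. 2 * D * b n < e) sequentially" using e by (intro order_tendstoD) auto
    then obtain M where M: "\<And>n. n \<ge> M \<Longrightarrow> 2 * D * b n < e" by (auto simp: eventually_at_top_linorder)
    have "dist (\<Sum>i<m. c i * b i) (\<Sum>i<n. c i * b i) < e" if "m \<ge> M" "n > m" for m n
      using tail[of m "n - m"] M[of m] that by (simp add: dist_real_def abs_minus_commute)
    then show "\<exists>M. \<forall>m\<ge>M. \<forall>n>m. dist (\<Sum>i<m. c i * b i) (\<Sum>i<n. c i * b i) < e" by blast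
  qed
  have "(\<lambda>N. \<Sum>n<N + M. c n * b n) \<longlonglongrightarrow> (\<Sum>n. c n * b n)"
    by (rule LIMSEQ_ignore_initial_segment[OF summable_LIMSEQ[OF s]])
  then have "(\<lambda>N. \<bar>(\<Sum>n<N + M. c n * b n) - (\<Sum>n<M. c n * b n)\<bar>) \<longlonglongrightarrow> \<bar>(\<Sum>n. c n * b n) - (\<Sum>n<M. c n * b n)\<bar>"
    by (intro tendsto_intros)
  then show "\<bar>(\<Sum>n. c n * b n) - (\<Sum>n<M. c n * b n)\<bar> \<le> 2 * D * b M"
    by (rule LIMSEQ_le_const2) (use tail[of M] in \<open>auto simp: add.commute\<close>)
qed

lemma split_prime_power:
  assumes "n > (1 :: nat)"
  obtains p e m where "prime p" "n = p ^ e * m" "\<not> p dvd m" "m > 0" "m < n"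
proof -
  obtain p where p: "prime p" "p dvd n" using prime_factor_nat[of n] assms by auto
  have "\<not> is_unit p" using p(1) by (metis not_prime_unit)
  then obtain m where m: "n = p ^ multiplicity p n * m" "\<not> p dvd m"
    using multiplicity_decompose'[of n p] assms by auto
  have "m > 0" using m(2) by (cases m) auto
  have "multiplicity p n > 0" using p assms by (simp add: prime_multiplicity_gt_zero_iff)
  then have "1 < p ^ multiplicity p n" using one_less_power[OF prime_gt_1_nat[OF p(1)]] by blast
  from mult_strict_right_mono[OF this \<open>m > 0\<close>] have "m < n" using m(1) by linarith
  show ?thesis by (rule that[OF p(1) m \<open>m > 0\<close> \<open>m < n\<close>])
qed

section \<open>Real Dirichlet characters and the nonvanishing of L(1)\<close>

text \<open>\<open>D\<close> is any modulus, not the conductor: multiplying two characters then just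
  multiplies their moduli.\<close>

definition real_char :: "nat \<Rightarrow> (nat \<Rightarrow> real) \<Rightarrow> bool" where
  "real_char D \<psi> \<longleftrightarrow> D > 0 \<and> (\<forall>m n. \<psi> (m * n) = \<psi> m * \<psi> n) \<and> (\<forall>n. \<psi> (n + D) = \<psi> n) \<and>
     (\<forall>n. \<psi> n \<in> {- 1, 0, 1}) \<and> (\<forall>n. \<psi> n = 0 \<longleftrightarrow> \<not> coprime n D)"

locale nontrivial_real_char =
  fixes D :: nat and \<psi> :: "nat \<Rightarrow> real" and c :: nat
  assumes char: "real_char D \<psi>" and c: "\<psi> c = - 1"
begin

lemma D_pos: "D > 0" and mult: "\<psi> (m * n) = \<psi> m * \<psi> n" and vals: "\<psi> n \<in> {- 1, 0, 1}"
  and zero_iff: "\<psi> n = 0 \<longleftrightarrow> \<not> coprime n D" and shift: "\<psi> (n + D) = \<psi> n"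
  using char by (auto simp: real_char_def)

lemma abs_le_1: "\<bar>\<psi> n\<bar> \<le> 1"
  using vals[of n] by auto

lemma periodic: "\<psi> (n + j * D) = \<psi> n"
  by (induction j) (use shift in \<open>simp_all add: add_ac, metis add.assoc add.commute\<close>)

lemma mod_D: "\<psi> (n mod D) = \<psi> n"
  using periodic[of "n mod D" "n div D"] by (simp add: mod_div_mult_eq)

lemma one: "\<psi> 1 = 1"
proof -
  have "\<psi> c = \<psi> 1 * \<psi> c" using mult[of 1 c] by simp
  then show ?thesis using c by simp
qed

lemma D_gt_1: "D > 1"
proof (rule ccontr)
  assume "\<not> D > 1"
  then have "D = 1" using D_pos by simp
  then have "\<psi> c = \<psi> 1" using mod_D[of c] mod_D[of 1] by simp
  then show False using c one by simp
qed

lemma zero: "\<psi> 0 = 0"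
  using zero_iff[of 0] D_gt_1 by simp

text \<open>Multiplication by \<open>c\<close> permutes the residues modulo \<open>D\<close> and
  changes the sign of every \<open>\<psi> n\<close>, so the sum is its own negative.\<close>

lemma sum_period: "(\<Sum>n<D. \<psi> n) = 0"
proof -
  have "coprime c D" using zero_iff[of c] c by auto
  have inj: "inj_on (\<lambda>n. c * n mod D) {..<D}"
  proof (rule inj_onI)
    fix m n assume mn: "m \<in> {..<D}" "n \<in> {..<D}" "c * m mod D = c * n mod D"
    then have "[c * m = c * n] (mod D)" by (simp add: cong_def)
    then have "[m = n] (mod D)" using \<open>coprime c D\<close> by (simp add: cong_mult_lcancel_nat)
    then show "m = n" using mn by (simp add: cong_def)
  qed
  have "(\<lambda>n. c * n mod D) ` {..<D} = {..<D}"
    by (rule endo_inj_surj) (use D_pos inj in auto)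
  then have "(\<Sum>n<D. \<psi> n) = (\<Sum>n<D. \<psi> (c * n mod D))"
    using sum.reindex[OF inj, of \<psi>] by simp
  also have "\<dots> = - (\<Sum>n<D. \<psi> n)" by (simp add: mod_D mult c sum_negf)
  finally show ?thesis by simp
qed

lemma partial_sum_bound: "\<bar>\<Sum>n<N. \<psi> (Suc n)\<bar> \<le> D"
proof -
  have per: "(\<Sum>n<N + j * D. \<psi> n) = (\<Sum>n<N. \<psi> n)" for N j
  proof (induction j)
    case (Suc j)
    have "(\<Sum>n<N' + D. \<psi> n) = (\<Sum>n<N'. \<psi> n)" for N'
    proof (induction N')
      case (Suc N')
      then show ?case using shift[of N'] by (simp add: add.commute)
    qed (simp add: sum_period)
    from this[of "N + j * D"] Suc show ?case by (simp add: algebra_simps)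
  qed simp
  have "(\<Sum>n<N. \<psi> (Suc n)) = (\<Sum>n<Suc N. \<psi> n)"
    by (simp only: sum.lessThan_Suc_shift zero add_0)
  also have "\<dots> = (\<Sum>n<Suc N mod D + (Suc N div D) * D. \<psi> n)" by (simp only: mod_div_mult_eq)
  also have "\<dots> = (\<Sum>n<Suc N mod D. \<psi> n)" by (rule per)
  also have "\<bar>\<dots>\<bar> \<le> (\<Sum>n<Suc N mod D. 1)"
    by (rule order.trans[OF sum_abs sum_mono]) (rule abs_le_1)
  also have "\<dots> \<le> D" using D_pos by (simp add: less_imp_le)
  finally show ?thesis .
qed

definition L :: "real \<Rightarrow> real" where
  "L \<sigma> = (\<Sum>n. \<psi> (Suc n) * real (Suc n) powr (- \<sigma>))"

lemma powr_decreasing: "\<sigma> \<ge> 0 \<Longrightarrow> real (Suc (Suc n)) powr (- \<sigma>) \<le> real (Suc n) powr (- \<sigma>)"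
  by (intro powr_mono2') auto

lemma powr_limit: "\<sigma> > 0 \<Longrightarrow> (\<lambda>n. real (Suc n) powr (- \<sigma>)) \<longlonglongrightarrow> 0"
  by (intro tendsto_neg_powr filterlim_compose[OF filterlim_real_sequentially filterlim_Suc]) auto

lemma L_summable: "\<sigma> > 0 \<Longrightarrow> summable (\<lambda>n. \<psi> (Suc n) * real (Suc n) powr (- \<sigma>))"
  by (rule abel_tail_bound(1)[OF partial_sum_bound]) (use powr_decreasing powr_limit in auto)

lemma L_approx:
  assumes "\<sigma> \<ge> 1"
  shows "\<bar>L \<sigma> - (\<Sum>n<M. \<psi> (Suc n) * real (Suc n) powr (- \<sigma>))\<bar> \<le> 2 * real D / real (Suc M)"
proof -
  have "\<bar>L \<sigma> - (\<Sum>n<M. \<psi> (Suc n) * real (Suc n) powr (- \<sigma>))\<bar> \<le> 2 * real D * real (Suc M) powr (- \<sigma>)"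
    unfolding L_def
    by (rule abel_tail_bound(2)[OF partial_sum_bound]) (use powr_decreasing[of \<sigma>] powr_limit[of \<sigma>] assms in auto)
  also have "\<dots> \<le> 2 * real D * real (Suc M) powr (- 1)"
    using assms by (intro mult_left_mono powr_mono) auto
  finally show ?thesis by (simp add: powr_minus divide_inverse)
qed

lemma L_continuous: "continuous_on {1..} L"
proof (rule uniform_limit_theorem)
  show "\<forall>\<^sub>F M in sequentially. continuous_on {1..} (\<lambda>\<sigma>. \<Sum>n<M. \<psi> (Suc n) * real (Suc n) powr (- \<sigma>))"
    by (intro always_eventually allI continuous_intros) auto
  show "uniform_limit {1..} (\<lambda>M \<sigma>. \<Sum>n<M. \<psi> (Suc n) * real (Suc n) powr (- \<sigma>)) L sequentially"
  proof (rule uniform_limitI)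
    fix e :: real assume e: "e > 0"
    have "(\<lambda>M. 2 * real D / real (Suc M)) \<longlonglongrightarrow> 0"
      by (intro tendsto_divide_0[OF tendsto_const] filterlim_at_top_imp_at_infinity
          filterlim_compose[OF filterlim_real_sequentially filterlim_Suc])
    then have "eventually (\<lambda>M. 2 * real D / real (Suc M) < e) sequentially" using e by (rule order_tendstoD)
    then show "\<forall>\<^sub>F M in sequentially. \<forall>\<sigma>\<in>{1..}. dist (\<Sum>n<M. \<psi> (Suc n) * real (Suc n) powr (- \<sigma>)) (L \<sigma>) < e"
    proof eventually_elim
      case (elim M)
      show ?case
      proof
        fix \<sigma> :: real assume "\<sigma> \<in> {1..}"
        then show "dist (\<Sum>n<M. \<psi> (Suc n) * real (Suc n) powr (- \<sigma>)) (L \<sigma>) < e"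
          using L_approx[of \<sigma> M] elim by (simp add: dist_real_def abs_minus_commute)
      qed
    qed
  qed
qed simp

lemma L_tendsto: "(L \<longlongrightarrow> L 1) (at_right 1)"
proof -
  have "(L \<longlongrightarrow> L 1) (at 1 within {1..})" using L_continuous by (simp add: continuous_on_def)
  then show ?thesis by (rule tendsto_within_subset) auto
qed

text \<open>The convolution of the constant function 1 with \<open>\<psi>\<close>, that is, the
  coefficients of zeta(s) L(s,psi); that they are nonnegative, and at least 1 at squares, drives the
  proof that \<open>L 1\<close> is not zero.\<close>

definition divisor_sum :: "nat \<Rightarrow> real" where
  "divisor_sum n = (\<Sum>d | d dvd n. \<psi> d)"

text \<open>The divisors of \<open>p ^ e * m\<close> are uniquely of the form
  \<open>p ^ i * d\<close>, which factors the sum; positivity then follows by removing one prime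
  power at a time.\<close>

lemma divisor_sum_prime_power:
  assumes p: "prime p" and m: "\<not> p dvd m" "m > 0"
  shows "divisor_sum (p ^ e * m) = (\<Sum>i\<le>e. \<psi> p ^ i) * divisor_sum m"
proof -
  have p0: "p > 0" using p prime_gt_0_nat by auto
  have pow: "\<psi> (p ^ i) = \<psi> p ^ i" for i by (induction i) (simp_all add: one[simplified] mult)
  let ?A = "{..e} \<times> {d. d dvd m}"
  have inj: "inj_on (\<lambda>(i, d). p ^ i * d) ?A"
  proof (rule inj_onI, clarify)
    fix i j d d'
    assume *: "d dvd m" "d' dvd m" "p ^ i * d = p ^ j * d'"
    have nd: "\<not> p dvd d" "\<not> p dvd d'" using * m by (metis dvd_trans)+
    have "multiplicity p (p ^ i * d) = i" "multiplicity p (p ^ j * d') = j"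
      by (rule multiplicity_eqI; use nd p p0 in \<open>auto simp: mult.commute\<close>)+
    then have "i = j" using *(3) by simp
    then show "i = j \<and> d = d'" using *(3) p0 by simp
  qed
  have img: "(\<lambda>(i, d). p ^ i * d) ` ?A = {d. d dvd p ^ e * m}"
  proof (intro subset_antisym subsetI)
    fix x assume "x \<in> {d. d dvd p ^ e * m}"
    then obtain b c where "x = b * c" "b dvd p ^ e" "c dvd m"
      using division_decomp[of x "p ^ e" m] by auto
    then show "x \<in> (\<lambda>(i, d). p ^ i * d) ` ?A"
      using p by (auto simp: divides_primepow_nat)
  qed (auto intro: mult_dvd_mono le_imp_power_dvd)
  have "divisor_sum (p ^ e * m) = (\<Sum>(i, d)\<in>?A. \<psi> (p ^ i * d))"
    unfolding divisor_sum_def img[symmetric] by (subst sum.reindex[OF inj]) (simp add: o_def case_prod_unfold)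
  also have "\<dots> = (\<Sum>i\<le>e. \<Sum>d | d dvd m. \<psi> p ^ i * \<psi> d)"
    using m(2) by (subst sum.cartesian_product[symmetric]) (simp add: mult pow)
  also have "\<dots> = (\<Sum>i\<le>e. \<psi> p ^ i) * divisor_sum m"
    by (simp add: divisor_sum_def sum_product)
  finally show ?thesis .
qed

text \<open>For \<open>\<psi> p = - 1\<close> the sum alternates between 1 and 0, so even exponents,
  hence squares, are where a positive lower bound is available.\<close>

lemma sum_powers_nonneg: "(\<Sum>i\<le>e. \<psi> p ^ i) \<ge> 0" "even e \<Longrightarrow> (\<Sum>i\<le>e. \<psi> p ^ i) \<ge> 1"
proof -
  consider "\<psi> p = 0" | "\<psi> p = 1" | "\<psi> p = - 1" using vals[of p] by auto
  then have "(\<Sum>i\<le>e. \<psi> p ^ i) \<ge> 0 \<and> (even e \<longrightarrow> (\<Sum>i\<le>e. \<psi> p ^ i) \<ge> 1)"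
  proof cases
    case 1
    have "(\<Sum>i\<le>e. (0 :: real) ^ i) = 1" by (induction e) auto
    then show ?thesis by (simp add: 1)
  next
    case 3
    have "(\<Sum>i\<le>e. (- 1 :: real) ^ i) = (if even e then 1 else 0)" by (induction e) auto
    then show ?thesis by (simp add: 3)
  qed simp
  then show "(\<Sum>i\<le>e. \<psi> p ^ i) \<ge> 0" "even e \<Longrightarrow> (\<Sum>i\<le>e. \<psi> p ^ i) \<ge> 1" by auto
qed

lemma divisor_sum_1: "divisor_sum 1 = 1"
  using one by (simp add: divisor_sum_def)

lemma divisor_sum_nonneg: "n > 0 \<Longrightarrow> divisor_sum n \<ge> 0"
proof (induction n rule: less_induct)
  case (less n)
  show ?case
  proof (cases "n = 1")
    case False
    then obtain p e m where m: "prime p" "n = p ^ e * m" "\<not> p dvd m" "m > 0" "m < n"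
      using split_prime_power[of n] less.prems by auto
    show ?thesis
      unfolding m(2) divisor_sum_prime_power[OF m(1,3,4)]
      by (intro mult_nonneg_nonneg sum_powers_nonneg(1) less.IH m)
  qed (use divisor_sum_1 in simp)
qed

lemma divisor_sum_square: "n > 0 \<Longrightarrow> divisor_sum (n\<^sup>2) \<ge> 1"
proof (induction n rule: less_induct)
  case (less n)
  show ?case
  proof (cases "n = 1")
    case False
    then obtain p e m where m: "prime p" "n = p ^ e * m" "\<not> p dvd m" "m > 0" "m < n"
      using split_prime_power[of n] less.prems by auto
    have n2: "n\<^sup>2 = p ^ (2 * e) * m\<^sup>2"
      unfolding m(2) by (simp add: power_mult_distrib power_mult mult.commute[of 2])
    have "\<not> p dvd m\<^sup>2" "m\<^sup>2 > 0" using m prime_dvd_power by auto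
    note eq = divisor_sum_prime_power[OF m(1) this, of "2 * e"]
    have "1 * 1 \<le> (\<Sum>i\<le>2 * e. \<psi> p ^ i) * divisor_sum (m\<^sup>2)"
      using sum_powers_nonneg(2)[of "2 * e" p] less.IH[OF m(5,4)] by (intro mult_mono) auto
    then show ?thesis unfolding n2 eq by simp
  qed (use divisor_sum_1 in simp)
qed

text \<open>Expanding the Lambert series \<open>\<Sum> \<psi> n x\<^sup>n / (1 - x\<^sup>n)\<close> gives \<open>\<Sum> divisor_sum n x\<^sup>n\<close>.\<close>
lemma lambert_lower_bound:
  assumes x: "0 < x" "x < 1"
  shows "(\<Sum>m\<in>{1..K}. x ^ m\<^sup>2) \<le> (\<Sum>n. \<psi> (Suc n) * (x ^ Suc n / (1 - x ^ Suc n)))"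
    "summable (\<lambda>n. \<psi> (Suc n) * (x ^ Suc n / (1 - x ^ Suc n)))"
proof -
  let ?P = "{1::nat..} \<times> {1::nat..}"
  define g where "g = (\<lambda>(n, k). \<psi> n * x ^ (n * k))"
  have xn: "0 < x ^ n" "n \<ge> 1 \<Longrightarrow> x ^ n < 1" for n
    using x by (auto simp: power_less_one_iff)
  have geo: "((\<lambda>k. x ^ (n * k)) has_sum (x ^ n / (1 - x ^ n))) {1..}" if "n \<ge> 1" for n
    using has_sum_geometric_from_1[of "x ^ n"] xn[of n] that by (simp add: power_mult)
  have summ1: "(\<lambda>n. x ^ n / (1 - x ^ n)) summable_on {1..}"
  proof (rule summable_on_comparison_test)
    have "(\<lambda>n. x ^ n) summable_on {1..}"
      using has_sum_geometric_from_1[of x] x by (auto simp: has_sum_imp_summable)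
    then show "(\<lambda>n. (1 / (1 - x)) * x ^ n) summable_on {1..}" by (rule summable_on_cmult_right)
    fix n :: nat assume "n \<in> {1..}"
    then have "x ^ n \<le> x ^ 1" using x by (intro power_decreasing) auto
    then have "x ^ n / (1 - x ^ n) \<le> x ^ n / (1 - x)" using x xn[of n] \<open>n \<in> {1..}\<close>
      by (intro divide_left_mono) auto
    then show "x ^ n / (1 - x ^ n) \<le> (1 / (1 - x)) * x ^ n" by simp
    show "0 \<le> x ^ n / (1 - x ^ n)" using xn[of n] \<open>n \<in> {1..}\<close> by simp
  qed
  have "(\<lambda>(n, k). x ^ (n * k)) summable_on ?P"
    by (rule summable_on_SigmaI[where g = "\<lambda>n. x ^ n / (1 - x ^ n)"]) (use geo summ1 x in auto)
  then have g_norm: "(\<lambda>z. norm (g z)) summable_on ?P"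
  proof (rule summable_on_comparison_test)
    fix z :: "nat \<times> nat"
    show "norm (g z) \<le> (case z of (n, k) \<Rightarrow> x ^ (n * k))"
    proof (cases z)
      case (Pair n k)
      then show ?thesis
        using mult_right_mono[OF abs_le_1[of n], of "x ^ (n * k)"] x by (simp add: g_def abs_mult)
    qed
  qed simp
  have g_summ: "g summable_on ?P" by (rule abs_summable_summable[OF g_norm])
  have inner: "((\<lambda>k. g (n, k)) has_sum (\<psi> n * (x ^ n / (1 - x ^ n)))) {1..}" if "n \<in> {1..}" for n
    using has_sum_cmult_right[OF geo[of n], of "\<psi> n"] that by (simp add: g_def)
  have outer: "((\<lambda>n. \<psi> n * (x ^ n / (1 - x ^ n))) has_sum (infsum g ?P)) {1..}"
    by (rule has_sum_SigmaD[OF has_sum_infsum[OF g_summ] inner]) simp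
  have bij: "bij_betw Suc UNIV {1..}"
    by (rule bij_betw_byWitness[where f' = "\<lambda>n. n - 1"]) auto
  have "((\<lambda>n. \<psi> (Suc n) * (x ^ Suc n / (1 - x ^ Suc n))) has_sum (infsum g ?P)) UNIV"
    using outer has_sum_reindex_bij_betw[OF bij, of "\<lambda>n. \<psi> n * (x ^ n / (1 - x ^ n))"] by simp
  then have F: "(\<lambda>n. \<psi> (Suc n) * (x ^ Suc n / (1 - x ^ Suc n))) sums (infsum g ?P)"
    by (rule has_sum_imp_sums)
  then show "summable (\<lambda>n. \<psi> (Suc n) * (x ^ Suc n / (1 - x ^ Suc n)))" by (rule sums_summable)
  let ?S = "SIGMA N:{1::nat..}. {d. d dvd N}"
  have "((\<lambda>(N, d). \<psi> d * x ^ N) has_sum (infsum g ?P)) ?S"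
    using has_sum_infsum[OF g_summ]
    by (rule has_sum_reindex_bij_witness[of ?P "\<lambda>(N, d). (d, N div d)" "\<lambda>(n, k). (n * k, n)" ?S, THEN iffD1, rotated -1])
      (auto simp: g_def Suc_le_eq elim!: dvdE)
  then have "((\<lambda>N. divisor_sum N * x ^ N) has_sum (infsum g ?P)) {1..}"
  proof (rule has_sum_SigmaD)
    fix N :: nat assume "N \<in> {1..}"
    then have "finite {d. d dvd N}" by simp
    then show "((\<lambda>d. (\<lambda>(N, d). \<psi> d * x ^ N) (N, d)) has_sum (divisor_sum N * x ^ N)) {d. d dvd N}"
      by (intro has_sum_finiteI) (simp_all add: divisor_sum_def sum_distrib_right)
  qed
  then have hs: "((\<lambda>N. divisor_sum N * x ^ N) has_sum (infsum g ?P)) {1..}" .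
  \<comment> \<open>Only finitely many square indices are kept: their coefficients are at least 1,
    and the discarded ones are nonnegative.\<close>
  have "(\<Sum>m\<in>{1..K}. x ^ m\<^sup>2) \<le> (\<Sum>m\<in>{1..K}. divisor_sum (m\<^sup>2) * x ^ m\<^sup>2)"
  proof (rule sum_mono)
    fix m assume "m \<in> {1..K}"
    then have "1 * x ^ m\<^sup>2 \<le> divisor_sum (m\<^sup>2) * x ^ m\<^sup>2"
      using x by (intro mult_right_mono divisor_sum_square) auto
    then show "x ^ m\<^sup>2 \<le> divisor_sum (m\<^sup>2) * x ^ m\<^sup>2" by simp
  qed
  also have "\<dots> = (\<Sum>N\<in>(\<lambda>m. m\<^sup>2) ` {1..K}. divisor_sum N * x ^ N)"
    by (subst sum.reindex) (auto intro!: inj_onI simp: power2_eq_iff_nonneg)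
  also have "\<dots> \<le> infsum g ?P"
  proof (rule finite_sum_le_has_sum[OF hs])
    show "0 \<le> divisor_sum N * x ^ N" if "N \<in> {1..} - (\<lambda>m. m\<^sup>2) ` {1..K}" for N
      using that divisor_sum_nonneg[of N] x by simp
  qed auto
  finally show "(\<Sum>m\<in>{1..K}. x ^ m\<^sup>2) \<le> (\<Sum>n. \<psi> (Suc n) * (x ^ Suc n / (1 - x ^ Suc n)))"
    using F by (simp add: sums_iff)
qed

text \<open>AM-GM for the pairs of exponents \<open>i\<close> and \<open>n - 1 - i\<close>, whose
  terms have geometric mean \<open>y ^ (n - 1)\<close>. The base is a square so that this mean is an
  integral power of \<open>y\<close> for every \<open>n\<close>.\<close>

lemma geometric_sum_ge:
  fixes y :: real
  assumes "y > 0"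
  shows "real n * y ^ (n - 1) \<le> (\<Sum>i<n. (y\<^sup>2) ^ i)"
proof -
  have "(\<Sum>i<n. (y\<^sup>2) ^ (n - Suc i)) = (\<Sum>i<n. (y\<^sup>2) ^ i)" by (rule sum.nat_diff_reindex)
  then have "2 * (\<Sum>i<n. (y\<^sup>2) ^ i) = (\<Sum>i<n. (y\<^sup>2) ^ i + (y\<^sup>2) ^ (n - Suc i))"
    by (simp add: sum.distrib)
  also have "\<dots> \<ge> (\<Sum>i<n. 2 * y ^ (n - 1))"
  proof (rule sum_mono)
    fix i assume "i \<in> {..<n}"
    then have "y ^ (n - 1) = y ^ i * y ^ (n - Suc i)" by (simp flip: power_add)
    moreover have "0 \<le> (y ^ i - y ^ (n - Suc i))\<^sup>2" by simp
    ultimately show "2 * y ^ (n - 1) \<le> (y\<^sup>2) ^ i + (y\<^sup>2) ^ (n - Suc i)"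
      by (simp add: power2_diff power_mult[symmetric] mult.commute[of 2])
  qed
  finally show ?thesis by simp
qed

text \<open>Monsky's argument: if \<open>L 1 = 0\<close>, then the Lambert series equals
  \<open>- \<Sum> \<psi> n b n\<close> with \<open>b n = 1 / (n (1 - x)) - x\<^sup>n / (1 - x\<^sup>n)\<close> decreasing in \<open>n\<close> and \<open>b 1 = 1\<close>,
  so it stays bounded as \<open>x \<rightarrow> 1\<close>.\<close>
lemma L_1_nonzero: "L 1 \<noteq> 0"
proof
  assume L1: "L 1 = 0"
  have le_D: "(\<Sum>m\<in>{1..K}. x ^ m\<^sup>2) \<le> D" if x: "0 < x" "x < 1" for x :: real and K
  proof -
    define S where "S = (\<lambda>n. \<Sum>i<n. x ^ i)"
    define b where "b = (\<lambda>n. 1 / (real (Suc n) * (1 - x)) - x ^ Suc n / (1 - x ^ Suc n))"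
    have S_pos: "S (Suc n) > 0" for n
      unfolding S_def by (rule sum_pos) (use x in auto)
    have xS: "1 - x ^ n = (1 - x) * S n" for n
      using x by (simp add: S_def sum_gp_strict)
    have b_eq: "(1 - x) * b n = 1 / real (Suc n) - x ^ Suc n / S (Suc n)" for n
    proof -
      have "v * (1 / (N * v) - u / (v * s)) = 1 / N - u / s" if "v \<noteq> 0" for v N u s :: real
        using that by (simp add: right_diff_distrib)
      then show ?thesis unfolding b_def xS using x by simp
    qed
    \<comment> \<open>With \<open>N = Suc n\<close> the claim reduces to
      \<open>N * (N + 1) * x ^ N \<le> S N * S (N + 1)\<close>. The AM-GM bounds in
      \<open>y = sqrt x\<close> give this even with \<open>y ^ (2 * N - 1)\<close> in place of
      \<open>x ^ N\<close>.\<close>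
    have b_dec: "b (Suc n) \<le> b n" for n
    proof -
      define y where "y = sqrt x"
      have y: "y > 0" "y < 1" "y\<^sup>2 = x" using x by (simp_all add: y_def)
      have p1: "real (Suc n) * y ^ n * (real (Suc (Suc n)) * y ^ Suc n) \<le> S (Suc n) * S (Suc (Suc n))"
      proof (intro mult_mono)
        show "real (Suc n) * y ^ n \<le> S (Suc n)"
          using geometric_sum_ge[OF y(1), of "Suc n"] unfolding S_def y(3) diff_Suc_1 .
        show "real (Suc (Suc n)) * y ^ Suc n \<le> S (Suc (Suc n))"
          using geometric_sum_ge[OF y(1), of "Suc (Suc n)"] unfolding S_def y(3) diff_Suc_1 .
      qed (use S_pos[of n] y in auto)
      have "x ^ Suc n \<le> y ^ n * y ^ Suc n"
      proof -
        have "x ^ Suc n = y ^ (2 * Suc n)" by (simp only: y(3)[symmetric] power_mult)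
        also have "\<dots> \<le> y ^ (n + Suc n)" using y by (intro power_decreasing) auto
        finally show ?thesis by (simp only: power_add)
      qed
      then have p2: "real (Suc n) * real (Suc (Suc n)) * x ^ Suc n \<le> real (Suc n) * real (Suc (Suc n)) * (y ^ n * y ^ Suc n)"
        by (intro mult_left_mono) auto
      have "real (Suc n) * real (Suc (Suc n)) * (y ^ n * y ^ Suc n) = real (Suc n) * y ^ n * (real (Suc (Suc n)) * y ^ Suc n)"
        by (simp only: mult_ac)
      with p1 p2 have key: "real (Suc n) * real (Suc (Suc n)) * x ^ Suc n \<le> S (Suc n) * S (Suc (Suc n))"
        by linarith
      have S_Suc: "S (Suc (Suc n)) = 1 + x * S (Suc n)"
        unfolding S_def sum_distrib_left by (subst sum.lessThan_Suc_shift) (simp only: power_0 power_Suc)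
      have "x ^ Suc n / S (Suc n) - x ^ Suc (Suc n) / S (Suc (Suc n)) = x ^ Suc n / (S (Suc n) * S (Suc (Suc n)))"
      proof -
        have gen: "u / s - x * u / s' = u / (s * s')" if "s' = 1 + x * s" "s > 0" "s' > 0" for u s s' :: real
          using that by (simp add: diff_frac_eq) (simp add: algebra_simps)
        have "x ^ Suc (Suc n) = x * x ^ Suc n" by simp
        then show ?thesis using gen[OF S_Suc S_pos S_pos] by metis
      qed
      also have "\<dots> \<le> 1 / (real (Suc n) * real (Suc (Suc n)))"
      proof -
        have gen: "u / w \<le> 1 / v" if "v * u \<le> w" "w > 0" "v > 0" for u v w :: real
          using that by (simp add: field_simps)
        show ?thesis by (rule gen[OF key]) (use S_pos in auto)
      qed
      also have "\<dots> = 1 / real (Suc n) - 1 / real (Suc (Suc n))" by (simp add: field_simps)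
      finally have "(1 - x) * b (Suc n) \<le> (1 - x) * b n" unfolding b_eq by simp
      then show ?thesis using x by simp
    qed
    have b_0: "b 0 = 1"
    proof -
      have "b 0 = 1 / (1 - x) - x / (1 - x)" by (simp add: b_def)
      also have "\<dots> = 1" using x by (simp flip: diff_divide_distrib)
      finally show ?thesis .
    qed
    have b_lim: "b \<longlonglongrightarrow> 0"
    proof -
      have "(\<lambda>n. 1 / (real (Suc n) * (1 - x))) \<longlonglongrightarrow> 0"
        using tendsto_mult[OF LIMSEQ_inverse_real_of_nat tendsto_const[of "1 / (1 - x)"]]
        by (simp add: divide_inverse)
      moreover have "(\<lambda>n. x ^ Suc n / (1 - x ^ Suc n)) \<longlonglongrightarrow> 0 / (1 - 0)"
        using x by (intro tendsto_intros LIMSEQ_Suc[OF LIMSEQ_power_zero]) auto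
      ultimately have "b \<longlonglongrightarrow> 0 - 0 / (1 - 0)" unfolding b_def by (rule tendsto_diff)
      then show ?thesis by simp
    qed
    have s: "(\<lambda>n. \<psi> (Suc n) * b n) sums (\<Sum>n. \<psi> (Suc n) * b n)"
      by (rule summable_sums[OF abel_tail_bound(1)[of "\<lambda>n. \<psi> (Suc n)" D b, OF partial_sum_bound b_dec b_lim]])
    have bound: "\<bar>\<Sum>n. \<psi> (Suc n) * b n\<bar> \<le> D"
    proof -
      have b_nonneg: "b n \<ge> 0" for n using decseq_ge[OF decseq_SucI[of b] b_lim] b_dec by blast
      have "(\<lambda>N. \<bar>\<Sum>n<N. \<psi> (Suc n) * b n\<bar>) \<longlonglongrightarrow> \<bar>\<Sum>n. \<psi> (Suc n) * b n\<bar>"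
        using s unfolding sums_def by (rule tendsto_rabs)
      then show ?thesis
        by (rule LIMSEQ_le_const2)
          (use abel_sum_bound[of "\<lambda>n. \<psi> (Suc n)" D b, OF partial_sum_bound b_dec b_nonneg] b_0 in auto)
    qed
    have "(\<lambda>n. \<psi> (Suc n) * real (Suc n) powr (- 1)) sums 0"
      using summable_sums[OF L_summable[of 1]] L1 by (simp add: L_def)
    from sums_mult[OF this, of "1 / (1 - x)"]
    have "(\<lambda>n. \<psi> (Suc n) * (1 / (real (Suc n) * (1 - x)))) sums 0"
      by (simp add: powr_minus divide_inverse mult_ac)
    from sums_diff[OF this s]
    have "(\<lambda>n. \<psi> (Suc n) * (x ^ Suc n / (1 - x ^ Suc n))) sums (- (\<Sum>n. \<psi> (Suc n) * b n))"
      by (simp add: b_def right_diff_distrib)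
    then have "(\<Sum>n. \<psi> (Suc n) * (x ^ Suc n / (1 - x ^ Suc n))) \<le> D"
      using bound by (simp add: sums_iff abs_le_iff)
    then show ?thesis using lambert_lower_bound(1)[OF x, of K] by linarith
  qed
  \<comment> \<open>As \<open>x\<close> tends to 1 the sum tends to its number of terms,
    \<open>D + 1\<close>, which the uniform bound \<open>D\<close> does not allow.\<close>
  have "((\<lambda>x. \<Sum>m\<in>{1..Suc D}. x ^ m\<^sup>2) \<longlongrightarrow> (\<Sum>m\<in>{1..Suc D}. 1 ^ m\<^sup>2)) (at_left (1 :: real))"
    by (intro tendsto_intros)
  moreover have "eventually (\<lambda>x :: real. (\<Sum>m\<in>{1..Suc D}. x ^ m\<^sup>2) \<le> D) (at_left 1)"
    by (rule eventually_mono[OF eventually_at_left_real[OF zero_less_one]]) (use le_D[of _ "Suc D"] in auto)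
  ultimately have "(\<Sum>m\<in>{1..Suc D}. 1 ^ m\<^sup>2) \<le> (D :: real)" by (rule tendsto_upperbound) simp
  then show False by simp
qed

text \<open>The prime sum differs from \<open>ln (L \<sigma>)\<close> by a bounded amount, and this
  logarithm has a finite limit because \<open>L 1\<close> is not zero.\<close>

lemma prime_sum_bounded:
  "\<exists>C. eventually (\<lambda>\<sigma>. \<bar>\<Sum>p. if prime p then \<psi> p * real p powr (- \<sigma>) else 0\<bar> \<le> C) (at_right 1)"
proof -
  have gt1: "eventually (\<lambda>\<sigma>::real. \<sigma> > 1) (at_right 1)" by (simp add: eventually_at_right_less)
  have key: "\<bar>(\<Sum>p. if prime p then \<psi> p * real p powr (- \<sigma>) else 0) - ln (L \<sigma>)\<bar> \<le> 2 * (\<Sum>n. 1 / (real n)\<^sup>2)"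
    if \<sigma>: "\<sigma> > 1" for \<sigma>
  proof -
    define h where "h = (\<lambda>n. \<psi> n * real n powr (- \<sigma>))"
    have summ: "summable (\<lambda>n. \<bar>h n\<bar>)"
    proof (rule summable_comparison_test')
      show "summable (\<lambda>n. real n powr (- \<sigma>))" using \<sigma> by (simp add: summable_real_powr_iff)
      show "norm \<bar>h n\<bar> \<le> real n powr (- \<sigma>)" if "n \<ge> 0" for n
        using mult_right_mono[OF abs_le_1[of n], of "real n powr (- \<sigma>)"] by (simp add: h_def abs_mult)
    qed
    have mlt: "h (m * n) = h m * h n" for m n by (simp add: h_def mult powr_mult)
    have h0: "h 0 = 0" "h 1 = 1" using one by (simp_all add: h_def)
    have le: "\<bar>h n\<bar> \<le> 1 / real n" if n: "n > 0" for n
    proof -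
      have "\<bar>h n\<bar> \<le> 1 * real n powr (- \<sigma>)"
        unfolding h_def abs_mult by (intro mult_mono abs_le_1) auto
      also have "\<dots> \<le> 1 * real n powr (- 1)" using \<sigma> n by (intro mult_left_mono powr_mono) auto
      finally show ?thesis using n by (simp add: powr_minus divide_inverse)
    qed
    have "(\<Sum>n. h n) = L \<sigma>"
      using suminf_split_head[OF summable_rabs_cancel[OF summ]] h0 by (simp add: L_def h_def)
    then show ?thesis using sum_over_primes_ln(2)[OF mlt summ h0 le] unfolding h_def by simp
  qed
  have "((\<lambda>\<sigma>. ln (L \<sigma>)) \<longlongrightarrow> ln (L 1)) (at_right 1)" by (rule tendsto_ln[OF L_tendsto L_1_nonzero])
  then have "eventually (\<lambda>\<sigma>. dist (ln (L \<sigma>)) (ln (L 1)) < 1) (at_right 1)" by (rule tendstoD) simp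
  with gt1 have "eventually (\<lambda>\<sigma>. \<bar>\<Sum>p. if prime p then \<psi> p * real p powr (- \<sigma>) else 0\<bar> \<le>
      2 * (\<Sum>n. 1 / (real n)\<^sup>2) + \<bar>ln (L 1)\<bar> + 1) (at_right 1)"
  proof eventually_elim
    case (elim \<sigma>)
    then show ?case using key[OF elim(1)] unfolding dist_real_def by linarith
  qed
  then show ?thesis by blast
qed

end

text \<open>The same comparison with \<open>h n = n powr (- \<sigma>)\<close>: the full sum is then
  zeta, which near 1 exceeds any given partial sum of the harmonic series.\<close>

lemma prime_sum_at_top:
  "filterlim (\<lambda>\<sigma>. \<Sum>p. if prime p then real p powr (- \<sigma>) else 0) at_top (at_right (1 :: real))"
proof -
  have gt1: "eventually (\<lambda>\<sigma>::real. \<sigma> > 1) (at_right 1)" by (simp add: eventually_at_right_less)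
  define Z where "Z = (\<lambda>\<sigma>. \<Sum>n. real n powr (- \<sigma>))"
  define C where "C = 2 * (\<Sum>n. 1 / (real n)\<^sup>2)"
  have key: "ln (Z \<sigma>) - C \<le> (\<Sum>p. if prime p then real p powr (- \<sigma>) else 0)" if \<sigma>: "\<sigma> > 1" for \<sigma>
  proof -
    have summ: "summable (\<lambda>n. \<bar>real n powr (- \<sigma>)\<bar>)" using \<sigma> by (simp add: summable_real_powr_iff)
    have le: "\<bar>real n powr (- \<sigma>)\<bar> \<le> 1 / real n" if n: "n > 0" for n
    proof -
      have "real n powr (- \<sigma>) \<le> real n powr (- 1)" using \<sigma> n by (intro powr_mono) auto
      then show ?thesis using n by (simp add: powr_minus divide_inverse)
    qed
    have "\<bar>(\<Sum>p. if prime p then real p powr (- \<sigma>) else 0) - ln (Z \<sigma>)\<bar> \<le> C"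
      unfolding C_def Z_def by (rule sum_over_primes_ln(2)[OF _ summ _ _ le]) (simp_all add: powr_mult)
    then show ?thesis by simp
  qed
  have "filterlim Z at_top (at_right 1)"
    unfolding filterlim_at_top
  proof
    fix B :: real
    have "\<not> summable (\<lambda>n. real n powr (- 1))" unfolding summable_real_powr_iff by simp
    then have "\<exists>N. (\<Sum>n<N. real n powr (- 1)) > B"
      using summableI_nonneg_bounded[of "\<lambda>n. real n powr (- 1)" B] by (metis not_le powr_ge_zero)
    then obtain N where N: "(\<Sum>n<N. real n powr (- 1)) > B" ..
    have "((\<lambda>\<sigma>. \<Sum>n<N. real n powr (- \<sigma>)) \<longlongrightarrow> (\<Sum>n<N. real n powr (- 1))) (at_right 1)"
    proof (intro tendsto_sum)
      fix n
      show "((\<lambda>\<sigma>. real n powr (- \<sigma>)) \<longlongrightarrow> real n powr (- 1)) (at_right 1)"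
      proof (cases "n = 0")
        case False
        then show ?thesis by (intro tendsto_powr tendsto_minus tendsto_const tendsto_ident_at) simp
      qed simp
    qed
    then have "eventually (\<lambda>\<sigma>. (\<Sum>n<N. real n powr (- \<sigma>)) > B) (at_right 1)" using N by (rule order_tendstoD)
    with gt1 show "eventually (\<lambda>\<sigma>. Z \<sigma> \<ge> B) (at_right 1)"
    proof eventually_elim
      case (elim \<sigma>)
      have "(\<Sum>n<N. real n powr (- \<sigma>)) \<le> Z \<sigma>"
        unfolding Z_def by (rule sum_le_suminf) (use elim in \<open>auto simp: summable_real_powr_iff\<close>)
      then show ?case using elim by simp
    qed
  qed
  then have "filterlim (\<lambda>\<sigma>. ln (Z \<sigma>)) at_top (at_right 1)" by (rule filterlim_compose[OF ln_at_top])
  then have "filterlim (\<lambda>\<sigma>. - C + ln (Z \<sigma>)) at_top (at_right 1)"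
    by (rule filterlim_tendsto_add_at_top[OF tendsto_const])
  then show ?thesis
    by (rule filterlim_at_top_mono) (use gt1 in \<open>auto elim!: eventually_mono dest: key\<close>)
qed

section \<open>Averages of Legendre symbols\<close>

lemma squarefree_nat_pos: "squarefree (m :: nat) \<Longrightarrow> m > 0"
  by (rule ccontr) simp

lemma Legendre_eq_0_iff: "Legendre a p = 0 \<longleftrightarrow> p dvd a"
  by (simp add: Legendre_def cong_0_iff)

lemma Legendre_values: "Legendre a p \<in> {- 1, 0, 1}"
  by (simp add: Legendre_def)

lemma abs_Legendre_le: "\<bar>real_of_int (Legendre a p)\<bar> \<le> 1"
  using Legendre_values[of a p] by auto

lemma Legendre_cong:
  assumes "[a = b] (mod p)"
  shows "Legendre a p = Legendre b p"
proof -
  have "[x = a] (mod p) \<longleftrightarrow> [x = b] (mod p)" for x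
    using assms cong_trans cong_sym by blast
  moreover have "p dvd a \<longleftrightarrow> p dvd b" by (rule cong_dvd_iff[OF assms])
  ultimately show ?thesis by (simp add: Legendre_def QuadRes_def cong_0_iff)
qed

text \<open>Euler's criterion makes both sides congruent modulo \<open>p\<close>; they differ by at
  most 2, and \<open>p > 2\<close>.\<close>

lemma Legendre_mult:
  fixes p :: nat
  assumes p: "prime p" "2 < p"
  shows "Legendre (a * b) p = Legendre a p * Legendre b p"
proof -
  let ?e = "(p - 1) div 2"
  have "[Legendre (a * b) p = (a * b) ^ ?e] (mod p)" by (rule euler_criterion[OF p])
  moreover have "[Legendre a p * Legendre b p = a ^ ?e * b ^ ?e] (mod p)"
    by (intro cong_mult euler_criterion p)
  ultimately have "[Legendre (a * b) p = Legendre a p * Legendre b p] (mod p)"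
    unfolding power_mult_distrib using cong_trans cong_sym by blast
  then have "int p dvd Legendre (a * b) p - Legendre a p * Legendre b p" by (simp add: cong_iff_dvd_diff)
  moreover have "\<bar>Legendre (a * b) p - Legendre a p * Legendre b p\<bar> \<le> 2"
    using Legendre_values[of "a * b" p] Legendre_values[of a p] Legendre_values[of b p] by auto
  ultimately have "Legendre (a * b) p - Legendre a p * Legendre b p = 0"
    using p(2) dvd_imp_le_int[of "Legendre (a * b) p - Legendre a p * Legendre b p" "int p"] by linarith
  then show ?thesis by simp
qed

lemma Legendre_1:
  assumes "prime (p :: nat)"
  shows "Legendre 1 p = 1"
proof -
  have "\<not> int p dvd 1" using prime_gt_1_nat[OF assms] by simp
  moreover have "QuadRes p 1" unfolding QuadRes_def by (rule exI[of _ 1]) simp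
  ultimately show ?thesis by (simp add: Legendre_def cong_0_iff)
qed

lemma Legendre_square:
  assumes "prime (p :: nat)" "2 < p" "\<not> p dvd r"
  shows "Legendre (int (r\<^sup>2)) p = 1"
proof -
  have "Legendre (int r) p \<noteq> 0" using assms(3) by (simp add: Legendre_eq_0_iff)
  then show ?thesis using Legendre_values[of "int r" p]
    by (auto simp: power2_eq_square Legendre_mult[OF assms(1,2)])
qed

lemma Legendre_prod:
  assumes "prime (p :: nat)" "2 < p"
  shows "Legendre (int (\<Prod>i\<in>I. f i)) p = (\<Prod>i\<in>I. Legendre (int (f i)) p)"
  by (induction I rule: infinite_finite_induct) (simp_all add: Legendre_1[OF assms(1), simplified] Legendre_mult[OF assms])

text \<open>Reciprocity relates two odd primes, so the prime 2 is treated apart by Gauss's lemma: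
  the sign is the parity of the number of \<open>x \<le> h\<close> with \<open>2 * x > h\<close>,
  where \<open>h = (p - 1) / 2\<close>.\<close>

lemma Legendre_2:
  assumes p: "prime (p :: nat)" "2 < p"
  shows "Legendre 2 p = (if p mod 8 \<in> {1, 7} then 1 else - 1)"
proof -
  have odd: "odd p" using p prime_odd_nat by blast
  interpret GAUSS p 2
  proof
    show "[2 \<noteq> 0] (mod int p)" using p(2) by (auto simp: cong_0_iff dest: zdvd_imp_le)
  qed (use p in auto)
  define h where "h = (int p - 1) div 2"
  have p_h: "int p = 2 * h + 1" using odd by (auto simp: h_def elim!: oddE)
  \<comment> \<open>As \<open>2 * x \<le> 2 * h < p\<close>, reduction modulo \<open>p\<close>
    changes nothing.\<close>
  have C: "C = (\<lambda>x. x * 2) ` A"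
    unfolding C_def B_def image_image
    by (rule image_cong) (use p_h in \<open>auto simp: A_def h_def[symmetric]\<close>)
  have "E = (\<lambda>x. x * 2) ` {h div 2<..h}"
    unfolding E_def C A_def h_def[symmetric]
  proof (intro subset_antisym subsetI)
    fix y assume "y \<in> (\<lambda>x. x * 2) ` {h div 2<..h}"
    then obtain x where "y = x * 2" "h div 2 < x" "x \<le> h" by auto
    moreover have "h \<ge> 0" using p_h p(2) by linarith
    ultimately show "y \<in> (\<lambda>x. x * 2) ` {0<..h} \<inter> {h<..}" by auto
  qed auto
  then have "card E = card {h div 2<..h}" by (simp add: card_image inj_on_def)
  also have "\<dots> = nat (h - h div 2)" by simp
  finally have card: "card E = nat (h - h div 2)" .
  have "p mod 8 \<in> {1, 7} \<longleftrightarrow> even (card E)"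
  proof -
    define j where "j = p div 8"
    have p8: "p = 8 * j + p mod 8" by (simp add: j_def)
    have "p mod 8 = 1 \<or> p mod 8 = 3 \<or> p mod 8 = 5 \<or> p mod 8 = 7" using odd by presburger
    then show ?thesis
    proof (elim disjE)
      assume r: "p mod 8 = 1"
      then have "h = 4 * int j" using p8 p_h by linarith
      then have "card E = 2 * j" by (simp add: card nat_mult_distrib)
      then show ?thesis using r by simp
    next
      assume r: "p mod 8 = 3"
      then have "h = 4 * int j + 1" using p8 p_h by linarith
      then have "h - h div 2 = int (2 * j + 1)" by simp
      then have "card E = 2 * j + 1" unfolding card by (simp only: nat_int)
      then show ?thesis using r by simp
    next
      assume r: "p mod 8 = 5"
      then have "h = 4 * int j + 2" using p8 p_h by linarith
      then have "h - h div 2 = int (2 * j + 1)" by simp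
      then have "card E = 2 * j + 1" unfolding card by (simp only: nat_int)
      then show ?thesis using r by simp
    next
      assume r: "p mod 8 = 7"
      then have "h = 4 * int j + 3" using p8 p_h by linarith
      then have "h - h div 2 = int (2 * j + 2)" by simp
      then have "card E = 2 * j + 2" unfolding card by (simp only: nat_int)
      then show ?thesis using r by simp
    qed
  qed
  then show ?thesis unfolding gauss_lemma by simp
qed

section \<open>Characters that compute the Legendre symbol at primes\<close>

definition chi4 :: "nat \<Rightarrow> real" where
  "chi4 n = (if n mod 4 = 1 then 1 else if n mod 4 = 3 then - 1 else 0)"

definition chi8 :: "nat \<Rightarrow> real" where
  "chi8 n = (if n mod 8 \<in> {1, 7} then 1 else if n mod 8 \<in> {3, 5} then - 1 else 0)"

lemma real_char_1: "real_char 1 (\<lambda>_. 1)"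
  by (simp add: real_char_def)

lemma real_char_chi4: "real_char 4 chi4"
proof -
  have cases4: "n mod 4 = 0 \<or> n mod 4 = 1 \<or> n mod 4 = 2 \<or> n mod 4 = 3" for n :: nat by presburger
  have mult: "chi4 (m * n) = chi4 m * chi4 n" for m n
  proof -
    have q: "(m * n) mod 4 = ((m mod 4) * (n mod 4)) mod 4" by (simp only: mod_mult_eq)
    show ?thesis using cases4[of m] cases4[of n] by (elim disjE) (simp_all add: chi4_def q)
  qed
  have cop: "coprime n 4 \<longleftrightarrow> odd n" for n :: nat
    using coprime_power_right_iff[of n 2 2] by (simp add: coprime_commute)
  have zero: "chi4 n = 0 \<longleftrightarrow> even n" for n
    unfolding chi4_def by (simp, presburger)
  have "chi4 (n + 4) = chi4 n" "chi4 n \<in> {- 1, 0, 1}" for n by (simp_all add: chi4_def)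
  then show ?thesis using mult cop zero by (simp add: real_char_def)
qed

lemma real_char_chi8: "real_char 8 chi8"
proof -
  have cases8: "n mod 8 = 0 \<or> n mod 8 = 1 \<or> n mod 8 = 2 \<or> n mod 8 = 3 \<or> n mod 8 = 4 \<or> n mod 8 = 5 \<or> n mod 8 = 6 \<or> n mod 8 = 7"
    for n :: nat by presburger
  have mult: "chi8 (m * n) = chi8 m * chi8 n" for m n
  proof -
    have q: "(m * n) mod 8 = ((m mod 8) * (n mod 8)) mod 8" by (simp only: mod_mult_eq)
    show ?thesis using cases8[of m] cases8[of n] by (elim disjE) (simp_all add: chi8_def q)
  qed
  have cop: "coprime n 8 \<longleftrightarrow> odd n" for n :: nat
    using coprime_power_right_iff[of n 2 3] by (simp add: coprime_commute)
  have zero: "chi8 n = 0 \<longleftrightarrow> even n" for n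
    unfolding chi8_def by (simp, presburger)
  have "chi8 (n + 8) = chi8 n" "chi8 n \<in> {- 1, 0, 1}" for n by (simp_all add: chi8_def)
  then show ?thesis using mult cop zero by (simp add: real_char_def)
qed

lemma real_char_Legendre:
  assumes l: "prime (l :: nat)" "2 < l"
  shows "real_char l (\<lambda>n. of_int (Legendre (int n) l))"
  unfolding real_char_def
proof (intro conjI allI)
  fix n
  have "l dvd n \<longleftrightarrow> \<not> coprime n l" using l(1) by (metis coprime_commute coprime_absorb_left not_prime_unit prime_imp_coprime)
  then show "(real_of_int (Legendre (int n) l) = 0) = (\<not> coprime n l)" by (simp add: Legendre_eq_0_iff)
  show "real_of_int (Legendre (int (n + l)) l) = real_of_int (Legendre (int n) l)"
    by (simp add: Legendre_cong[of "int n + int l" "int n"] cong_def)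
  show "real_of_int (Legendre (int n) l) \<in> {- 1, 0, 1}" using Legendre_values[of "int n" l] by auto
  show "real_of_int (Legendre (int (m * n)) l) = real_of_int (Legendre (int m) l) * real_of_int (Legendre (int n) l)" for m
    by (simp add: Legendre_mult[OF l])
qed (use l in simp)

lemma real_char_mult:
  assumes "real_char D \<psi>" "real_char E \<phi>"
  shows "real_char (D * E) (\<lambda>n. \<psi> n * \<phi> n)"
proof -
  have per: "\<psi> (n + j * D) = \<psi> n" if "\<And>n. \<psi> (n + D) = \<psi> n" for \<psi> :: "nat \<Rightarrow> real" and n j D
  proof (induction j)
    case (Suc j)
    then show ?case using that[of "n + j * D"] by (simp add: add_ac)
  qed simp
  have "\<psi> (n + D * E) = \<psi> n" "\<phi> (n + D * E) = \<phi> n" for n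
    using per[of \<psi> D n E] per[of \<phi> E n D] assms by (simp_all add: real_char_def mult.commute)
  moreover have "\<psi> n * \<phi> n \<in> {- 1, 0, 1}" for n
  proof -
    have "\<psi> n \<in> {- 1, 0, 1}" "\<phi> n \<in> {- 1, 0, 1}" using assms by (auto simp: real_char_def)
    then show ?thesis by auto
  qed
  ultimately show ?thesis
    using assms unfolding real_char_def by (simp add: coprime_mult_right_iff)
qed

text \<open>Reciprocity turned into a definition: as a function of the prime \<open>p\<close>, the
  symbol (l/p) is (p/l) when \<open>l\<close> is 1 modulo 4, (p/l) times \<open>chi4 p\<close> when
  \<open>l\<close> is 3 modulo 4, and \<open>chi8 p\<close> when \<open>l = 2\<close>.\<close>

definition prime_char :: "nat \<Rightarrow> nat \<Rightarrow> real" where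
  "prime_char l n = (if l = 2 then chi8 n else of_int (Legendre (int n) l) * (if l mod 4 = 3 then chi4 n else 1))"

lemma real_char_prime_char:
  assumes "prime l"
  shows "\<exists>D. real_char D (prime_char l)"
proof (cases "l = 2")
  case True
  then have "prime_char l = chi8" by (simp add: prime_char_def fun_eq_iff)
  then show ?thesis using real_char_chi8 by auto
next
  case False
  then have l2: "2 < l" using prime_ge_2_nat[OF assms] by simp
  show ?thesis
  proof (cases "l mod 4 = 3")
    case True
    with False have "prime_char l = (\<lambda>n. of_int (Legendre (int n) l) * chi4 n)" by (simp add: prime_char_def fun_eq_iff)
    then show ?thesis using real_char_mult[OF real_char_Legendre[OF assms l2] real_char_chi4] by auto
  next
    case n3: False
    with False have "prime_char l = (\<lambda>n. of_int (Legendre (int n) l))" by (simp add: prime_char_def fun_eq_iff)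
    then show ?thesis using real_char_Legendre[OF assms l2] by auto
  qed
qed

lemma prime_char_prime:
  assumes l: "prime l" and p: "prime p" "2 < p" "p \<noteq> l"
  shows "prime_char l p = of_int (Legendre (int l) p)"
proof (cases "l = 2")
  case True
  have "odd p" using p prime_odd_nat by blast
  then have "p mod 8 \<in> {1, 7} \<or> p mod 8 \<in> {3, 5}" by (simp, presburger)
  then show ?thesis using True by (auto simp: prime_char_def chi8_def Legendre_2[OF p(1,2)])
next
  case False
  then have l2: "2 < l" using prime_ge_2_nat[OF l] by simp
  have odd: "odd p" "odd l" using p l l2 prime_odd_nat by blast+
  have QR: "Legendre p l * Legendre l p = (- 1) ^ ((p - 1) div 2 * ((l - 1) div 2))"
    by (rule Quadratic_Reciprocity) (use p l l2 in auto)
  have "\<not> p dvd l" using p(1,3) l primes_dvd_imp_eq by blast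
  then have "Legendre (int l) p \<noteq> 0" by (simp add: Legendre_eq_0_iff)
  then have sq: "Legendre (int l) p * Legendre (int l) p = 1" using Legendre_values[of "int l" "int p"] by auto
  have "Legendre p l = Legendre p l * (Legendre l p * Legendre l p)" by (simp add: sq)
  also have "\<dots> = (- 1) ^ ((p - 1) div 2 * ((l - 1) div 2)) * Legendre l p" by (simp only: QR[symmetric] mult.assoc)
  finally have rec: "Legendre p l = (- 1) ^ ((p - 1) div 2 * ((l - 1) div 2)) * Legendre l p" .
  have odd_half: "odd ((n - 1) div 2) \<longleftrightarrow> n mod 4 = 3" if "odd n" for n :: nat using that by presburger
  have p4: "p mod 4 = 1 \<or> p mod 4 = 3" using odd(1) by presburger
  show ?thesis
  proof (cases "l mod 4 = 3")
    case True
    then have "odd ((l - 1) div 2)" using odd_half odd by blast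
    then have "((- 1) ^ ((p - 1) div 2 * ((l - 1) div 2)) :: int) = (if p mod 4 = 3 then - 1 else 1)"
      using odd_half[OF odd(1)] by (auto simp: uminus_power_if)
    with True False p4 show ?thesis unfolding prime_char_def rec by (auto simp: chi4_def)
  next
    case n3: False
    then have "even ((l - 1) div 2)" using odd_half odd by blast
    then have "((- 1) ^ ((p - 1) div 2 * ((l - 1) div 2)) :: int) = 1" by (simp add: uminus_power_if)
    with n3 False show ?thesis unfolding prime_char_def rec by simp
  qed
qed

text \<open>\<open>P\<close> will be the set of primes dividing the squarefree part of some
  \<open>n\<close>, so that the product yields (n/p). The flag is there because the condition on
  \<open>p\<close> modulo 4 is \<open>(1 + chi4 p) / 2\<close> or \<open>(1 - chi4 p) / 2\<close>,
  which brings in the twist by \<open>chi4\<close>.\<close>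

definition quad_char :: "bool \<Rightarrow> nat set \<Rightarrow> nat \<Rightarrow> real" where
  "quad_char e P n = (if e then chi4 n else 1) * (\<Prod>l\<in>P. prime_char l n)"

lemma real_char_quad_char:
  assumes "finite P" "\<And>l. l \<in> P \<Longrightarrow> prime l"
  shows "\<exists>D. real_char D (quad_char e P)"
  using assms
proof (induction P rule: finite_induct)
  case empty
  have "quad_char e {} = (if e then chi4 else (\<lambda>_. 1))" by (auto simp: quad_char_def fun_eq_iff)
  then show ?case using real_char_1 real_char_chi4 by (cases e) auto
next
  case (insert l P)
  then obtain D E where "real_char D (quad_char e P)" "real_char E (prime_char l)"
    using real_char_prime_char[of l] by auto
  then have "real_char (D * E) (\<lambda>n. quad_char e P n * prime_char l n)" by (rule real_char_mult)
  moreover have "(\<lambda>n. quad_char e P n * prime_char l n) = quad_char e (insert l P)"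
    using insert.hyps by (auto simp: quad_char_def fun_eq_iff)
  ultimately show ?case by auto
qed

text \<open>Counting: \<open>y\<close> and \<open>l - y\<close> have the same square, so all squares
  modulo \<open>l\<close> come from \<open>0..l div 2\<close>, and
  \<open>l div 2 + 1 < l\<close>.\<close>

lemma Legendre_nonresidue_exists:
  assumes l: "prime (l :: nat)" "2 < l"
  shows "\<exists>r :: nat. Legendre (int r) l = - 1"
proof (rule ccontr)
  assume neg: "\<not> ?thesis"
  let ?f = "\<lambda>y. y\<^sup>2 mod l"
  have "{..<l} \<subseteq> ?f ` {..l div 2}"
  proof
    fix r assume r: "r \<in> {..<l}"
    have "\<exists>y :: int. [y\<^sup>2 = int r] (mod l)"
    proof (cases "l dvd r")
      case True
      then show ?thesis by (intro exI[of _ 0]) (auto simp: cong_0_iff cong_sym_eq[of 0])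
    next
      case False
      then have "QuadRes l (int r)" using neg by (auto simp: Legendre_def cong_0_iff split: if_splits)
      then show ?thesis by (simp add: QuadRes_def)
    qed
    then obtain y :: int where y: "[y\<^sup>2 = int r] (mod l)" ..
    define z where "z = y mod int l"
    have z: "0 \<le> z" "z < int l" using l(2) by (auto simp: z_def)
    have zy: "[z\<^sup>2 = int r] (mod l)"
      using y cong_pow[of z y "int l" 2] by (auto simp: z_def cong_def)
    define w where "w = (if z \<le> int l div 2 then z else int l - z)"
    have "[(int l - z)\<^sup>2 = (0 - z)\<^sup>2] (mod l)" by (intro cong_pow cong_diff) (auto simp: cong_def)
    then have "[w\<^sup>2 = int r] (mod l)" using zy by (auto simp: w_def intro: cong_trans)
    moreover have w: "0 \<le> w" "w \<le> int l div 2" using z by (auto simp: w_def)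
    moreover have "int ((nat w)\<^sup>2) = w\<^sup>2" using w by simp
    ultimately have "[int ((nat w)\<^sup>2) = int r] (mod l)" by (simp only:)
    then have "[(nat w)\<^sup>2 = r] (mod l)" by (simp only: cong_int_iff)
    then have "?f (nat w) = r" using r by (simp add: cong_def)
    moreover have "nat w \<in> {..l div 2}" using w by (simp add: nat_le_iff zdiv_int)
    ultimately show "r \<in> ?f ` {..l div 2}" by blast
  qed
  then have "card {..<l} \<le> card (?f ` {..l div 2})" by (intro card_mono) auto
  also have "\<dots> \<le> card {..l div 2}" by (intro card_image_le) auto
  finally have "l \<le> Suc (l div 2)" by simp
  then show False using l(2) by linarith
qed

text \<open>One odd \<open>l\<close> in \<open>P\<close> suffices: by the Chinese remainder theorem
  some \<open>c\<close> is a nonresidue modulo \<open>l\<close> but 1 modulo 8 and modulo every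
  other odd prime of \<open>P\<close>, so all factors except the one at \<open>l\<close> equal
  1.\<close>

lemma quad_char_nontrivial:
  assumes P: "finite P" "\<And>l. l \<in> P \<Longrightarrow> prime l" and nt: "e \<or> P \<noteq> {}"
  shows "\<exists>c. quad_char e P c = - 1"
proof (cases "P \<subseteq> {2}")
  case True
  show ?thesis
  proof (cases "P = {}")
    case True
    then have "quad_char e P 3 = - 1" using nt by (simp add: quad_char_def chi4_def)
    then show ?thesis ..
  next
    case False
    then have "P = {2}" using True by auto
    \<comment> \<open>5 is 1 modulo 4, so the value of the flag does not matter, and
      \<open>chi8 5 = - 1\<close>.\<close>
    then have "quad_char e P 5 = - 1" by (simp add: quad_char_def chi4_def prime_char_def chi8_def)
    then show ?thesis ..
  qed
next
  case False
  then obtain l where l: "l \<in> P" "l \<noteq> 2" by auto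
  have lp: "prime l" "2 < l" using P(2)[OF l(1)] l(2) prime_ge_2_nat[of l] by auto
  obtain r where r: "Legendre (int r) l = - 1" using Legendre_nonresidue_exists[OF lp] ..
  define M where "M = 8 * \<Prod>(P - {2, l})"
  have "coprime l q" if "q \<in> P - {2, l}" for q using lp(1) P(2) that by (intro primes_coprime) auto
  moreover have "coprime l 8"
    using coprime_power_right_iff[of l 2 3] lp primes_coprime[of l 2] l(2) by auto
  ultimately have "coprime l M" unfolding M_def by (auto intro!: prod_coprime_right)
  then obtain c where c: "[c = r] (mod l)" "[c = 1] (mod M)"
    using binary_chinese_remainder_nat by blast
  have c8: "[c = 1] (mod 8)" using c(2) unfolding M_def by (rule cong_dvd_modulus_nat) simp
  have chi4: "chi4 c = 1"
  proof -
    have "[c = 1] (mod 4)" using c8 by (rule cong_dvd_modulus_nat) simp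
    then show ?thesis by (simp add: chi4_def cong_def)
  qed
  have pc: "prime_char q c = 1" if q: "q \<in> P - {l}" for q
  proof (cases "q = 2")
    case True
    then show ?thesis using c8 by (simp add: prime_char_def chi8_def cong_def)
  next
    case False
    then have "q dvd M" using q P(1) by (auto simp: M_def intro!: dvd_mult dvd_prodI[of _ _ id, simplified])
    then have "[c = 1] (mod q)" using c(2) cong_dvd_modulus_nat by blast
    then have "[int c = int 1] (mod int q)" by (simp only: cong_int_iff)
    then have "Legendre (int c) q = 1" using Legendre_cong Legendre_1 P(2) q by (metis DiffD1 of_nat_1)
    with False show ?thesis by (simp add: prime_char_def chi4)
  qed
  have "[int c = int r] (mod int l)" using c(1) by (simp only: cong_int_iff)
  then have "prime_char l c = - 1" using l(2) r Legendre_cong by (simp add: prime_char_def chi4)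
  moreover have "(\<Prod>q\<in>P. prime_char q c) = prime_char l c * (\<Prod>q\<in>P - {l}. prime_char q c)"
    using P(1) l(1) by (rule prod.remove)
  moreover have "(\<Prod>q\<in>P - {l}. prime_char q c) = 1" using pc by (intro prod.neutral) auto
  ultimately have "quad_char e P c = - 1" by (simp add: quad_char_def chi4)
  then show ?thesis ..
qed

section \<open>Weighted averages over primes as the exponent tends to 1\<close>

definition prime_sum :: "(nat \<Rightarrow> real) \<Rightarrow> real \<Rightarrow> real" where
  "prime_sum g \<sigma> = (\<Sum>p. if prime p then g p * real p powr (- \<sigma>) else 0)"

lemma prime_sum_summable:
  assumes "\<And>p. \<bar>g p\<bar> \<le> C" "\<sigma> > 1"
  shows "summable (\<lambda>p. if prime p then g p * real p powr (- \<sigma>) else 0)"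
proof (rule summable_comparison_test')
  show "summable (\<lambda>n. C * real n powr (- \<sigma>))" using assms(2) by (intro summable_mult) (simp add: summable_real_powr_iff)
  have C: "C \<ge> 0" using order.trans[OF abs_ge_zero assms(1)] .
  show "norm (if prime n then g n * real n powr (- \<sigma>) else 0) \<le> C * real n powr (- \<sigma>)" if "n \<ge> 0" for n
    using mult_right_mono[OF assms(1)[of n], of "real n powr (- \<sigma>)"] C by (simp add: abs_mult)
qed

lemma prime_sum_lincomb:
  assumes "\<And>p. \<bar>g p\<bar> \<le> 1" "\<And>p. \<bar>h p\<bar> \<le> 1" "\<sigma> > 1"
  shows "prime_sum (\<lambda>p. (g p + c * h p) / 2) \<sigma> = (prime_sum g \<sigma> + c * prime_sum h \<sigma>) / 2"
proof -
  have "(\<lambda>p. ((if prime p then g p * real p powr (- \<sigma>) else 0) + c * (if prime p then h p * real p powr (- \<sigma>) else 0)) / 2)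
      sums ((prime_sum g \<sigma> + c * prime_sum h \<sigma>) / 2)"
    unfolding prime_sum_def using assms
    by (intro sums_divide sums_add sums_mult summable_sums prime_sum_summable[of _ 1]) auto
  also have "(\<lambda>p. ((if prime p then g p * real p powr (- \<sigma>) else 0) + c * (if prime p then h p * real p powr (- \<sigma>) else 0)) / 2) =
      (\<lambda>p. if prime p then (g p + c * h p) / 2 * real p powr (- \<sigma>) else 0)"
    by (auto simp: algebra_simps)
  finally show ?thesis by (simp add: prime_sum_def sums_iff)
qed

text \<open>Finitely many primes contribute a bounded amount, which the divergent normalisation
  absorbs later. This disposes of 2 and of the primes dividing \<open>n\<close>, where character and
  Legendre symbol may disagree.\<close>

lemma prime_sum_finite_change:
  assumes g: "\<And>p. \<bar>g p\<bar> \<le> 1" and h: "\<And>p. \<bar>h p\<bar> \<le> 1" and \<sigma>: "\<sigma> > 1" and F: "finite F"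
    and eq: "\<And>p. prime p \<Longrightarrow> p \<notin> F \<Longrightarrow> g p = h p"
  shows "\<bar>prime_sum g \<sigma> - prime_sum h \<sigma>\<bar> \<le> 2 * card F"
proof -
  let ?g = "\<lambda>p. if prime p then g p * real p powr (- \<sigma>) else 0" and ?h = "\<lambda>p. if prime p then h p * real p powr (- \<sigma>) else 0"
  have "(\<lambda>p. ?g p - ?h p) sums (prime_sum g \<sigma> - prime_sum h \<sigma>)"
    unfolding prime_sum_def
    by (intro sums_diff summable_sums prime_sum_summable[of _ 1] \<sigma>) (use g h in auto)
  moreover have "(\<lambda>p. ?g p - ?h p) sums (\<Sum>p\<in>F. ?g p - ?h p)"
    by (rule sums_finite[OF F]) (use eq in auto)
  ultimately have "prime_sum g \<sigma> - prime_sum h \<sigma> = (\<Sum>p\<in>F. ?g p - ?h p)" by (rule sums_unique2)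
  also have "\<bar>\<dots>\<bar> \<le> (\<Sum>p\<in>F. 2)"
  proof (rule order.trans[OF sum_abs], rule sum_mono)
    fix p
    have w: "real p powr (- \<sigma>) \<le> 1" if "prime p"
      using powr_mono[of "- \<sigma>" 0 "real p"] \<sigma> prime_gt_0_nat[OF that] by simp
    have "\<bar>f p * real p powr (- \<sigma>)\<bar> \<le> 1" if "prime p" "\<bar>f p\<bar> \<le> 1" for f :: "nat \<Rightarrow> real"
      using mult_mono[OF that(2) w[OF that(1)]] by (simp add: abs_mult)
    from this[of g] this[of h] show "\<bar>?g p - ?h p\<bar> \<le> 2" using g[of p] h[of p] by (auto simp: abs_le_iff)
  qed
  finally show ?thesis by simp
qed

lemma abs_real_char_le: "real_char D \<psi> \<Longrightarrow> \<bar>\<psi> n\<bar> \<le> 1"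
  unfolding real_char_def by (metis abs_1 abs_minus_cancel abs_zero empty_iff insert_iff order_refl zero_le_one)

lemma eventually_gt_1: "eventually (\<lambda>\<sigma>::real. \<sigma> > 1) (at_right 1)"
  by (simp add: eventually_at_right_less)

lemma prime_sum_quad_char_bounded:
  assumes "finite P" "\<And>l. l \<in> P \<Longrightarrow> prime l" "e \<or> P \<noteq> {}"
  shows "\<exists>C. eventually (\<lambda>\<sigma>. \<bar>prime_sum (quad_char e P) \<sigma>\<bar> \<le> C) (at_right 1)"
proof -
  obtain D c where "real_char D (quad_char e P)" "quad_char e P c = - 1"
    using real_char_quad_char[OF assms(1,2), of e] quad_char_nontrivial[OF assms] by auto
  then interpret nontrivial_real_char D "quad_char e P" c by unfold_locales
  show ?thesis unfolding prime_sum_def by (rule prime_sum_bounded)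
qed

definition residue_indicator :: "nat \<Rightarrow> nat \<Rightarrow> real" where
  "residue_indicator b p = (if [p = b] (mod 4) then 1 else 0)"

lemma residue_indicator_eq:
  assumes "b \<in> {1, 3}" "odd p"
  shows "residue_indicator b p = (1 + (if b = 1 then 1 else - 1) * chi4 p) / 2"
proof -
  have "p mod 4 = 1 \<or> p mod 4 = 3" using assms(2) by presburger
  then show ?thesis using assms(1) by (auto simp: residue_indicator_def chi4_def cong_def)
qed

lemma abs_chi4_le: "\<bar>chi4 n\<bar> \<le> 1"
  by (simp add: chi4_def)

text \<open>Dirichlet's theorem modulo 4 in analytic form: half the sum over all primes, which
  diverges, plus or minus half the bounded sum with \<open>chi4\<close>.\<close>

lemma prime_sum_residue_at_top:
  assumes b: "b \<in> {1, 3}"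
  shows "filterlim (prime_sum (residue_indicator b)) at_top (at_right 1)"
proof -
  let ?\<epsilon> = "if b = 1 then 1 else - 1 :: real"
  have "quad_char True {} = chi4" by (simp add: quad_char_def fun_eq_iff)
  then obtain C where C: "eventually (\<lambda>\<sigma>. \<bar>prime_sum chi4 \<sigma>\<bar> \<le> C) (at_right 1)"
    using prime_sum_quad_char_bounded[of "{}" True] by auto
  have "filterlim (prime_sum (\<lambda>_. 1)) at_top (at_right 1)"
    using prime_sum_at_top by (simp add: prime_sum_def[abs_def] cong: if_cong)
  then have "filterlim (\<lambda>\<sigma>. (1 / 2) * prime_sum (\<lambda>_. 1) \<sigma>) at_top (at_right 1)"
    by (intro filterlim_tendsto_pos_mult_at_top[OF tendsto_const]) auto
  \<comment> \<open>\<open>C / 2\<close> pays for the \<open>chi4\<close> term and 2 for the prime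
    2, where the formula gives 1/2 instead of 0.\<close>
  then have "filterlim (\<lambda>\<sigma>. - (C / 2 + 2) + (1 / 2) * prime_sum (\<lambda>_. 1) \<sigma>) at_top (at_right 1)"
    by (rule filterlim_tendsto_add_at_top[OF tendsto_const])
  then show ?thesis
  proof (rule filterlim_at_top_mono)
    show "eventually (\<lambda>\<sigma>. - (C / 2 + 2) + (1 / 2) * prime_sum (\<lambda>_. 1) \<sigma> \<le> prime_sum (residue_indicator b) \<sigma>) (at_right 1)"
      using C eventually_gt_1
    proof eventually_elim
      case (elim \<sigma>)
      have "\<bar>prime_sum (residue_indicator b) \<sigma> - prime_sum (\<lambda>p. (1 + ?\<epsilon> * chi4 p) / 2) \<sigma>\<bar> \<le> 2 * card {2 :: nat}"
      proof (rule prime_sum_finite_change[OF _ _ elim(2)])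
        show "residue_indicator b p = (1 + ?\<epsilon> * chi4 p) / 2" if "prime p" "p \<notin> {2}" for p
          using that prime_odd_nat[of p] prime_ge_2_nat[of p] by (intro residue_indicator_eq b) auto
        show "\<bar>(1 + ?\<epsilon> * chi4 p) / 2\<bar> \<le> 1" for p using abs_chi4_le[of p] by (auto simp: abs_le_iff)
      qed (auto simp: residue_indicator_def)
      moreover have "prime_sum (\<lambda>p. (1 + ?\<epsilon> * chi4 p) / 2) \<sigma> = (prime_sum (\<lambda>_. 1) \<sigma> + ?\<epsilon> * prime_sum chi4 \<sigma>) / 2"
        by (rule prime_sum_lincomb[OF _ abs_chi4_le elim(2)]) simp
      moreover have "\<bar>?\<epsilon> * prime_sum chi4 \<sigma>\<bar> \<le> C" using elim(1) by (simp add: abs_mult)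
      ultimately show ?case by (simp add: abs_le_iff)
    qed
  qed
qed

definition legendre_residue :: "nat \<Rightarrow> nat \<Rightarrow> nat \<Rightarrow> real" where
  "legendre_residue b n p = residue_indicator b p * of_int (Legendre (int n) p)"

lemma abs_legendre_residue_le: "\<bar>legendre_residue b n p\<bar> \<le> 1"
  using abs_Legendre_le[of "int n" p] by (simp add: legendre_residue_def residue_indicator_def)

lemma prime_sum_legendre_square:
  assumes n: "n = r\<^sup>2" "n > 0" and \<sigma>: "\<sigma> > 1"
  shows "\<bar>prime_sum (legendre_residue b n) \<sigma> - prime_sum (residue_indicator b) \<sigma>\<bar> \<le> 2 * card (insert 2 (prime_factors n))"
proof (rule prime_sum_finite_change[OF abs_legendre_residue_le _ \<sigma>])
  show "legendre_residue b n p = residue_indicator b p" if "prime p" "p \<notin> insert 2 (prime_factors n)" for p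
  proof -
    have "\<not> p dvd n" using that n(2) by (auto simp: in_prime_factors_iff)
    then have "\<not> p dvd r" using n(1) by (auto simp: power2_eq_square)
    moreover have "2 < p" using that prime_ge_2_nat[of p] by auto
    ultimately show ?thesis
      unfolding legendre_residue_def n(1) using Legendre_square[OF that(1)] by simp
  qed
qed (auto simp: residue_indicator_def)

text \<open>Write \<open>n = s * r\<^sup>2\<close> with \<open>s\<close> squarefree. As
  \<open>n\<close> is not a square, the set \<open>P\<close> of primes of \<open>s\<close> is
  nonempty, so \<open>quad_char False P\<close> and \<open>quad_char True P\<close> are both
  nontrivial. Off the primes dividing 2n the summand is half their sum or difference.\<close>

lemma prime_sum_legendre_nonsquare:
  assumes b: "b \<in> {1, 3}" and n: "\<nexists>r. n = r\<^sup>2" "n > 0"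
  shows "\<exists>C. eventually (\<lambda>\<sigma>. \<bar>prime_sum (legendre_residue b n) \<sigma>\<bar> \<le> C) (at_right 1)"
proof -
  let ?\<epsilon> = "if b = 1 then 1 else - 1 :: real"
  define s where "s = squarefree_part n"
  define r where "r = square_part n"
  define P where "P = prime_factors s"
  have dec: "n = s * r\<^sup>2" unfolding s_def r_def by (rule squarefree_decompose)
  have s0: "s \<noteq> 0" by (simp add: s_def)
  have "squarefree s" by (simp add: s_def)
  have "s = (\<Prod>l\<in>P. l ^ multiplicity l s)"
    unfolding P_def using s0 prime_factorization_nat[of s] by simp
  also have "\<dots> = \<Prod>P"
  proof (rule prod.cong[OF refl])
    fix l assume "l \<in> P"
    then have l: "prime l" "l dvd s" by (auto simp: P_def in_prime_factors_iff)
    have "multiplicity l s = 1"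
      using squarefree_factorial_semiring'[OF s0] \<open>squarefree s\<close> l s0 by (auto simp: in_prime_factors_iff)
    then show "l ^ multiplicity l s = l" by simp
  qed
  finally have s_prod: "s = \<Prod>P" .
  have P: "finite P" "\<And>l. l \<in> P \<Longrightarrow> prime l" by (auto simp: P_def)
  have "P \<noteq> {}"
  proof
    assume "P = {}"
    then have "n = r\<^sup>2" using dec s_prod by simp
    then show False using n(1) by blast
  qed
  have val: "quad_char e P p = (if e then chi4 p else 1) * of_int (Legendre (int n) p)" if p: "prime p" "p \<notin> insert 2 (prime_factors n)" for e p
  proof -
    have p2: "2 < p" using p prime_ge_2_nat[of p] by auto
    have pn: "\<not> p dvd n" using p n(2) by (auto simp: in_prime_factors_iff)
    then have pr: "\<not> p dvd r" and ps: "\<not> p dvd s" unfolding dec by (auto simp: power2_eq_square)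
    have "(\<Prod>l\<in>P. prime_char l p) = (\<Prod>l\<in>P. of_int (Legendre (int l) p))"
    proof (rule prod.cong[OF refl])
      fix l assume l: "l \<in> P"
      then have "l dvd s" by (auto simp: P_def in_prime_factors_iff)
      then have "p \<noteq> l" using ps by auto
      then show "prime_char l p = of_int (Legendre (int l) p)" using prime_char_prime[OF P(2)[OF l] p(1) p2] by simp
    qed
    also have "\<dots> = of_int (Legendre (int s) p)"
      unfolding s_prod using Legendre_prod[OF p(1) p2, of "\<lambda>l. l" P] by simp
    also have "Legendre (int s) p = Legendre (int n) p"
      unfolding dec using Legendre_mult[OF p(1) p2, of "int s" "int (r\<^sup>2)"] Legendre_square[OF p(1) p2 pr] by simp
    finally show ?thesis by (simp add: quad_char_def)
  qed
  have char_le: "\<bar>quad_char e P p\<bar> \<le> 1" for e p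
    using real_char_quad_char[OF P, of e] abs_real_char_le by blast
  obtain C0 C1 where C: "eventually (\<lambda>\<sigma>. \<bar>prime_sum (quad_char False P) \<sigma>\<bar> \<le> C0) (at_right 1)"
      "eventually (\<lambda>\<sigma>. \<bar>prime_sum (quad_char True P) \<sigma>\<bar> \<le> C1) (at_right 1)"
    using prime_sum_quad_char_bounded[OF P] \<open>P \<noteq> {}\<close> by metis
  from C eventually_gt_1
  have "eventually (\<lambda>\<sigma>. \<bar>prime_sum (legendre_residue b n) \<sigma>\<bar> \<le> (C0 + C1) / 2 + 2 * card (insert 2 (prime_factors n))) (at_right 1)"
  proof eventually_elim
    case (elim \<sigma>)
    let ?h = "\<lambda>p. (quad_char False P p + ?\<epsilon> * quad_char True P p) / 2"
    have "\<bar>prime_sum (legendre_residue b n) \<sigma> - prime_sum ?h \<sigma>\<bar> \<le> 2 * card (insert 2 (prime_factors n))"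
    proof (rule prime_sum_finite_change[OF abs_legendre_residue_le _ elim(3)])
      show "\<bar>?h p\<bar> \<le> 1" for p using char_le[of False p] char_le[of True p] by (auto simp: abs_le_iff)
      show "legendre_residue b n p = ?h p" if "prime p" "p \<notin> insert 2 (prime_factors n)" for p
      proof -
        have "odd p" using that prime_odd_nat[of p] prime_ge_2_nat[of p] by auto
        then show ?thesis unfolding legendre_residue_def val[OF that] residue_indicator_eq[OF b \<open>odd p\<close>]
          by (simp add: algebra_simps add_divide_distrib)
      qed
    qed auto
    moreover have "prime_sum ?h \<sigma> = (prime_sum (quad_char False P) \<sigma> + ?\<epsilon> * prime_sum (quad_char True P) \<sigma>) / 2"
      by (rule prime_sum_lincomb[OF char_le char_le elim(3)])
    moreover have "\<bar>?\<epsilon> * prime_sum (quad_char True P) \<sigma>\<bar> \<le> C1" using elim(2) by (simp add: abs_mult)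
    ultimately show ?case using elim(1) by (simp add: abs_le_iff field_simps) linarith
  qed
  then show ?thesis by blast
qed

text \<open>The denominator diverges, while the numerator stays within bounded distance of it for a
  square \<open>n\<close> and is bounded otherwise.\<close>

lemma legendre_average:
  assumes b: "b \<in> {1, 3}" and n: "n > 0"
  shows "((\<lambda>\<sigma>. prime_sum (legendre_residue b n) \<sigma> / prime_sum (residue_indicator b) \<sigma>) \<longlongrightarrow>
      (if \<exists>r. n = r\<^sup>2 then 1 else 0)) (at_right 1)"
proof -
  let ?W = "prime_sum (residue_indicator b)" and ?A = "prime_sum (legendre_residue b n)"
  have W: "filterlim ?W at_top (at_right 1)" by (rule prime_sum_residue_at_top[OF b])
  have bounded_quot: "((\<lambda>\<sigma>. g \<sigma> / ?W \<sigma>) \<longlongrightarrow> 0) (at_right 1)" if g: "eventually (\<lambda>\<sigma>. \<bar>g \<sigma>\<bar> \<le> C) (at_right 1)" for g C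
  proof (rule Lim_null_comparison)
    show "((\<lambda>\<sigma>. C / ?W \<sigma>) \<longlongrightarrow> 0) (at_right 1)"
      by (rule tendsto_divide_0[OF tendsto_const filterlim_at_top_imp_at_infinity[OF W]])
    have "eventually (\<lambda>\<sigma>. ?W \<sigma> > 0) (at_right 1)" using W by (simp add: filterlim_at_top_dense)
    with g show "eventually (\<lambda>\<sigma>. norm (g \<sigma> / ?W \<sigma>) \<le> C / ?W \<sigma>) (at_right 1)"
      by eventually_elim (simp add: divide_right_mono)
  qed
  show ?thesis
  proof (cases "\<exists>r. n = r\<^sup>2")
    case False
    then obtain C where "eventually (\<lambda>\<sigma>. \<bar>?A \<sigma>\<bar> \<le> C) (at_right 1)" using prime_sum_legendre_nonsquare[OF b] n by blast
    then show ?thesis using bounded_quot False by auto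
  next
    case True
    then obtain r where r: "n = r\<^sup>2" ..
    have "eventually (\<lambda>\<sigma>. \<bar>?A \<sigma> - ?W \<sigma>\<bar> \<le> 2 * card (insert 2 (prime_factors n))) (at_right 1)"
      using eventually_gt_1 by eventually_elim (rule prime_sum_legendre_square[OF r n])
    from bounded_quot[OF this] have "((\<lambda>\<sigma>. (?A \<sigma> - ?W \<sigma>) / ?W \<sigma> + 1) \<longlongrightarrow> 0 + 1) (at_right 1)"
      by (intro tendsto_intros)
    moreover have "eventually (\<lambda>\<sigma>. ?W \<sigma> > 0) (at_right 1)" using W by (simp add: filterlim_at_top_dense)
    then have "eventually (\<lambda>\<sigma>. (?A \<sigma> - ?W \<sigma>) / ?W \<sigma> + 1 = ?A \<sigma> / ?W \<sigma>) (at_right 1)"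
      by eventually_elim (simp add: diff_divide_distrib)
    ultimately have "((\<lambda>\<sigma>. ?A \<sigma> / ?W \<sigma>) \<longlongrightarrow> 0 + 1) (at_right 1)" by (rule Lim_transform_eventually)
    then show ?thesis using True by simp
  qed
qed

lemma abs_prime_sum_le:
  assumes "\<And>p. \<bar>g p\<bar> \<le> h p" "\<And>p. \<bar>h p\<bar> \<le> 1" "\<sigma> > 1"
  shows "\<bar>prime_sum g \<sigma>\<bar> \<le> prime_sum h \<sigma>"
proof -
  have "norm (prime_sum g \<sigma>) \<le> prime_sum h \<sigma>"
    unfolding prime_sum_def
  proof (rule norm_suminf_le)
    show "norm (if prime n then g n * real n powr (- \<sigma>) else 0) \<le> (if prime n then h n * real n powr (- \<sigma>) else 0)" for n
      using mult_right_mono[OF assms(1)[of n], of "real n powr (- \<sigma>)"] by (simp add: abs_mult)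
  qed (rule prime_sum_summable[OF assms(2,3)])
  then show ?thesis by simp
qed

lemma suminf_eq_infsum_norm:
  fixes f :: "nat \<Rightarrow> complex"
  assumes "summable (\<lambda>n. norm (f n))"
  shows "suminf f = infsum f UNIV"
  using norm_summable_imp_has_sum[OF assms summable_sums[OF summable_norm_cancel[OF assms]]]
  by (simp add: infsumI)

text \<open>Multiplying the vanishing sum for \<open>p\<close> by (m/p) turns (n/p) into (nm/p).
  Summing over \<open>p\<close> with weights \<open>p powr (- \<sigma>)\<close>, the two sums may be
  exchanged since the double series converges absolutely for \<open>\<sigma> > 1\<close>.\<close>

lemma twisted_sums_average:
  fixes h :: "nat \<Rightarrow> complex" and b m :: nat
  assumes h: "summable (\<lambda>n. norm (h n))" and b: "b \<in> {1, 3}" and \<sigma>: "\<sigma> > 1"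
    and zero: "\<And>p :: nat. prime p \<Longrightarrow> [p = b] (mod 4) \<Longrightarrow> (\<Sum>n. h n * of_int (Legendre (int n) p)) = 0"
  shows "(\<Sum>n. h n * of_real (prime_sum (legendre_residue b (n * m)) \<sigma>)) = 0"
proof -
  define w where "w = (\<lambda>p. real p powr (- \<sigma>))"
  define c where "c = (\<lambda>n p. if prime p then legendre_residue b (n * m) p * w p else 0)"
  have w: "summable w" "\<And>p. w p \<ge> 0" using \<sigma> by (simp_all add: w_def[abs_def] summable_real_powr_iff)
  have ps: "prime_sum (legendre_residue b (n * m)) \<sigma> = suminf (c n)" for n
    unfolding prime_sum_def c_def w_def ..
  have c_le: "\<bar>c n p\<bar> \<le> w p" for n p
    using mult_right_mono[OF abs_legendre_residue_le[of b "n * m" p] w(2)[of p]] w(2)[of p]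
    by (auto simp: c_def abs_mult)
  have w_sum: "w summable_on UNIV" using w by (simp add: summable_on_UNIV_nonneg_real_iff)
  have h_sum: "(\<lambda>n. norm (h n)) summable_on UNIV" using h by (simp add: summable_on_UNIV_nonneg_real_iff)
  have c_sum: "summable (\<lambda>p. norm (complex_of_real (c n p)))" for n
    by (rule summable_comparison_test'[OF w(1), of 0]) (use c_le in auto)
  have "(\<lambda>(n, p). norm (h n) * w p) summable_on UNIV \<times> UNIV"
  proof (rule summable_on_SigmaI)
    show "((\<lambda>p. (case (n, p) of (n, p) \<Rightarrow> norm (h n) * w p)) has_sum (norm (h n) * infsum w UNIV)) UNIV" for n
      using has_sum_cmult_right[OF has_sum_infsum[OF w_sum]] by simp
    show "(\<lambda>n. norm (h n) * infsum w UNIV) summable_on UNIV"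
      by (rule summable_on_cmult_left[OF h_sum])
  qed (use w in auto)
  then have "(\<lambda>z. norm ((\<lambda>(n, p). h n * of_real (c n p)) z)) summable_on UNIV \<times> UNIV"
  proof (rule summable_on_comparison_test)
    show "norm ((\<lambda>(n, p). h n * of_real (c n p)) z) \<le> (case z of (n, p) \<Rightarrow> norm (h n) * w p)" for z
      using c_le by (cases z) (simp add: norm_mult mult_left_mono)
  qed simp
  then have summ: "(\<lambda>(n, p). h n * of_real (c n p)) summable_on UNIV \<times> UNIV"
    by (rule abs_summable_summable)
  have "(\<Sum>\<^sub>\<infinity>n. \<Sum>\<^sub>\<infinity>p. h n * complex_of_real (c n p)) = (\<Sum>\<^sub>\<infinity>p. \<Sum>\<^sub>\<infinity>n. h n * of_real (c n p))"
    by (rule infsum_swap_banach[OF summ])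
  also have "\<dots> = (\<Sum>\<^sub>\<infinity>p::nat. 0)"
  proof (rule infsum_cong)
    fix p :: nat
    show "(\<Sum>\<^sub>\<infinity>n. h n * complex_of_real (c n p)) = 0"
    proof (cases "prime p \<and> [p = b] (mod 4)")
      case False
      then have "c n p = 0" for n by (auto simp: c_def legendre_residue_def residue_indicator_def)
      then show ?thesis by simp
    next
      case True
      have p2: "2 < p"
      proof -
        have "p \<noteq> 2" using True b by (auto simp: cong_def)
        then show ?thesis using True prime_ge_2_nat[of p] by simp
      qed
      define d :: complex where "d = of_real (w p) * of_int (Legendre (int m) p)"
      have "h n * complex_of_real (c n p) = d * (h n * of_int (Legendre (int n) p))" for n
        using True Legendre_mult[of p "int n" "int m"] p2
        by (simp add: c_def d_def legendre_residue_def residue_indicator_def)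
      then have "(\<Sum>\<^sub>\<infinity>n. h n * complex_of_real (c n p)) = d * (\<Sum>\<^sub>\<infinity>n. h n * of_int (Legendre (int n) p))"
        by (simp only: infsum_cmult_right')
      also have "(\<Sum>\<^sub>\<infinity>n. h n * of_int (Legendre (int n) p)) = (\<Sum>n. h n * of_int (Legendre (int n) p))"
      proof (rule suminf_eq_infsum_norm[symmetric], rule summable_comparison_test'[OF h, of 0])
        show "norm (norm (h n * of_int (Legendre (int n) p))) \<le> norm (h n)" for n
          using mult_left_mono[OF abs_Legendre_le[of "int n" "int p"], of "norm (h n)"] by (simp add: norm_mult)
      qed
      finally show ?thesis using zero True by simp
    qed
  qed
  finally have inf0: "(\<Sum>\<^sub>\<infinity>n. \<Sum>\<^sub>\<infinity>p. h n * complex_of_real (c n p)) = 0" by simp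
  have inner: "(\<Sum>\<^sub>\<infinity>p. h n * complex_of_real (c n p)) = h n * of_real (prime_sum (legendre_residue b (n * m)) \<sigma>)" for n
  proof -
    have "summable (c n)"
      by (rule summable_comparison_test'[OF w(1), of 0]) (use c_le in auto)
    then have "(\<Sum>p. complex_of_real (c n p)) = of_real (suminf (c n))"
      by (rule suminf_of_real[symmetric])
    also have "suminf (c n) = prime_sum (legendre_residue b (n * m)) \<sigma>" by (rule ps[symmetric])
    finally have "(\<Sum>\<^sub>\<infinity>p. complex_of_real (c n p)) = of_real (prime_sum (legendre_residue b (n * m)) \<sigma>)"
      by (simp only: suminf_eq_infsum_norm[OF c_sum])
    then show ?thesis by (simp only: infsum_cmult_right')
  qed
  have "summable (\<lambda>n. norm (h n * of_real (prime_sum (legendre_residue b (n * m)) \<sigma>)))"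
  proof (rule summable_comparison_test'[OF summable_mult2[OF h, of "suminf w"], of 0])
    fix n
    have "\<bar>prime_sum (legendre_residue b (n * m)) \<sigma>\<bar> \<le> suminf w"
      unfolding ps using norm_suminf_le[OF _ w(1), of "c n"] c_le by simp
    then show "norm (norm (h n * complex_of_real (prime_sum (legendre_residue b (n * m)) \<sigma>))) \<le> norm (h n) * suminf w"
      by (simp add: norm_mult mult_left_mono)
  qed
  from suminf_eq_infsum_norm[OF this] show ?thesis using inf0 unfolding inner by simp
qed

text \<open>The normalised averages have absolute value at most 1, so \<open>norm (h n)\<close>
  dominates the series and the limit at 1 may be taken term by term.\<close>

lemma square_class_sum_zero:
  fixes h :: "nat \<Rightarrow> complex" and b m :: nat
  assumes h: "summable (\<lambda>n. norm (h n))" "h 0 = 0" and b: "b \<in> {1, 3}" and m: "m > 0"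
    and zero: "\<And>p :: nat. prime p \<Longrightarrow> [p = b] (mod 4) \<Longrightarrow> (\<Sum>n. h n * of_int (Legendre (int n) p)) = 0"
  shows "(\<Sum>n. if \<exists>r. n * m = r\<^sup>2 then h n else 0) = 0"
proof -
  let ?W = "prime_sum (residue_indicator b)"
  define R where "R = (\<lambda>n \<sigma>. prime_sum (legendre_residue b (n * m)) \<sigma> / ?W \<sigma>)"
  have W: "eventually (\<lambda>\<sigma>. ?W \<sigma> > 0) (at_right 1)"
    using prime_sum_residue_at_top[OF b] by (simp add: filterlim_at_top_dense)
  have lim: "((\<lambda>\<sigma>. h n * of_real (R n \<sigma>)) \<longlongrightarrow> (if \<exists>r. n * m = r\<^sup>2 then h n else 0)) (at_right 1)" for n
  proof (cases "n = 0")
    case False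
    then have "((\<lambda>\<sigma>. h n * of_real (R n \<sigma>)) \<longlongrightarrow> h n * of_real (if \<exists>r. n * m = r\<^sup>2 then 1 else 0)) (at_right 1)"
      unfolding R_def by (intro tendsto_mult tendsto_const tendsto_of_real legendre_average b) (use m in simp)
    then show ?thesis by (simp add: if_distrib cong: if_cong)
  qed (simp add: h(2))
  have A_le: "\<bar>prime_sum (legendre_residue b (n * m)) \<sigma>\<bar> \<le> ?W \<sigma>" if \<sigma>: "\<sigma> > 1" for n \<sigma>
  proof (rule abs_prime_sum_le[OF _ _ \<sigma>])
    show "\<bar>legendre_residue b (n * m) p\<bar> \<le> residue_indicator b p" for p
      using abs_Legendre_le[of "int (n * m)" p] by (simp add: legendre_residue_def residue_indicator_def)
  qed (simp add: residue_indicator_def)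
  have R_le: "eventually (\<lambda>\<sigma>. \<forall>n. norm (h n * of_real (R n \<sigma>)) \<le> norm (h n)) (at_right 1)"
    using W eventually_gt_1
  proof eventually_elim
    case (elim \<sigma>)
    show ?case
    proof
      fix n
      have "\<bar>R n \<sigma>\<bar> \<le> 1" using elim(1) A_le[OF elim(2), of n] by (simp add: R_def)
      then show "norm (h n * of_real (R n \<sigma>)) \<le> norm (h n)"
        using mult_left_mono[of "\<bar>R n \<sigma>\<bar>" 1 "norm (h n)"] by (simp add: norm_mult)
    qed
  qed
  have "((\<lambda>\<sigma>. \<Sum>n. h n * of_real (R n \<sigma>)) \<longlongrightarrow> (\<Sum>n. if \<exists>r. n * m = r\<^sup>2 then h n else 0)) (at_right 1)"
  proof (rule tannerys_theorem[THEN conjunct2, THEN conjunct2, OF lim _ h(1)])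
    have "eventually (\<lambda>(n :: nat, \<sigma>). \<forall>n. norm (h n * of_real (R n \<sigma>)) \<le> norm (h n)) (at_top \<times>\<^sub>F at_right 1)"
      by (subst eventually_prod2) (use R_le in auto)
    then show "eventually (\<lambda>(n, \<sigma>). norm (h n * of_real (R n \<sigma>)) \<le> norm (h n)) (at_top \<times>\<^sub>F at_right 1)"
      by (rule eventually_mono) auto
  qed simp
  moreover have "eventually (\<lambda>\<sigma>. (\<Sum>n. h n * of_real (R n \<sigma>)) = 0) (at_right 1)"
    using eventually_gt_1
  proof eventually_elim
    case (elim \<sigma>)
    have s: "summable (\<lambda>n. h n * complex_of_real (prime_sum (legendre_residue b (n * m)) \<sigma>))"
    proof (rule summable_norm_cancel, rule summable_comparison_test'[OF summable_mult2[OF h(1), of "?W \<sigma>"], of 0])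
      fix n
      show "norm (norm (h n * complex_of_real (prime_sum (legendre_residue b (n * m)) \<sigma>))) \<le> norm (h n) * ?W \<sigma>"
        using A_le[OF elim, of n] by (simp add: norm_mult mult_left_mono)
    qed
    have "(\<Sum>n. h n * of_real (R n \<sigma>)) = (\<Sum>n. h n * of_real (prime_sum (legendre_residue b (n * m)) \<sigma>) / of_real (?W \<sigma>))"
      by (simp add: R_def)
    also have "\<dots> = (\<Sum>n. h n * of_real (prime_sum (legendre_residue b (n * m)) \<sigma>)) / of_real (?W \<sigma>)"
      by (rule suminf_divide[OF s])
    also have "\<dots> = 0" using twisted_sums_average[OF h(1) b elim zero] by simp
    finally show ?case .
  qed
  ultimately have "((\<lambda>\<sigma>. 0) \<longlongrightarrow> (\<Sum>n. if \<exists>r. n * m = r\<^sup>2 then h n else 0)) (at_right (1 :: real))"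
    by (rule Lim_transform_eventually)
  then show ?thesis by (simp add: tendsto_const_iff)
qed

lemma squarefree_dvd_square_imp_dvd:
  fixes m r :: nat
  assumes m: "squarefree m" and dvd: "m dvd r\<^sup>2"
  shows "m dvd r"
proof -
  define g where "g = gcd m r"
  have m0: "m > 0" by (rule squarefree_nat_pos[OF m])
  then have g0: "g > 0" by (simp add: g_def)
  obtain m' r' where mr: "m = g * m'" "r = g * r'" unfolding g_def by (meson dvdE gcd_dvd1 gcd_dvd2)
  have cop: "coprime m' r'"
    using mr g0 g_def by (metis gcd_mult_distrib_nat coprime_iff_gcd_eq_1 mult_cancel1 mult_1_right neq0_conv)
  have "g * m' dvd g * (g * r'\<^sup>2)" using dvd unfolding mr by (simp add: power2_eq_square mult_ac)
  then have "m' dvd g * r'\<^sup>2" using g0 by simp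
  then have "m' dvd g" using cop by (simp add: coprime_dvd_mult_left_iff)
  then have "m'\<^sup>2 dvd m" unfolding mr by (simp add: power2_eq_square)
  then have "m' dvd 1" by (rule squarefreeD[OF m])
  then show ?thesis using mr by simp
qed

lemma mult_square_iff:
  fixes m n :: nat
  assumes "squarefree m"
  shows "(\<exists>r. n * m = r\<^sup>2) \<longleftrightarrow> (\<exists>j. n = m * j\<^sup>2)"
proof
  have m0: "m > 0" by (rule squarefree_nat_pos[OF assms])
  assume "\<exists>r. n * m = r\<^sup>2"
  then obtain r where r: "n * m = r\<^sup>2" ..
  then have "m dvd r\<^sup>2" by (metis dvd_triv_right)
  then obtain j where "r = m * j" using squarefree_dvd_square_imp_dvd[OF assms] by (auto elim: dvdE)
  then have "n = m * j\<^sup>2" using r m0 by (simp add: power2_eq_square)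
  then show "\<exists>j. n = m * j\<^sup>2" ..
next
  assume "\<exists>j. n = m * j\<^sup>2"
  then obtain j where "n = m * j\<^sup>2" ..
  then have "n * m = (m * j)\<^sup>2" by (simp add: power2_eq_square)
  then show "\<exists>r. n * m = r\<^sup>2" ..
qed

section \<open>Modular forms and Hecke operators\<close>

lemma lin_nonzero:
  fixes c d :: int
  assumes "Im z > 0" "c \<noteq> 0 \<or> d \<noteq> 0"
  shows "of_int c * z + of_int d \<noteq> 0"
proof
  assume eq: "of_int c * z + of_int d = 0"
  then have "Im (of_int c * z + of_int d) = 0" by simp
  then have "c = 0" using assms(1) by simp
  with eq assms(2) show False by simp
qed

lemma Im_moebius:
  fixes a b c d :: int
  assumes "a * d - b * c = 1"
  shows "Im ((of_int a * z + of_int b) / (of_int c * z + of_int d)) = Im z / (norm (of_int c * z + of_int d))\<^sup>2"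
proof -
  have "Im ((of_int a * z + of_int b) / (of_int c * z + of_int d)) =
      (of_int a * of_int d - of_int b * of_int c) * Im z / (norm (of_int c * z + of_int d))\<^sup>2"
    by (simp add: Im_divide cmod_power2 algebra_simps)
  also have "of_int a * of_int d - of_int b * of_int c = (1 :: real)"
    by (metis assms of_int_1 of_int_diff of_int_mult)
  finally show ?thesis by simp
qed

lemma det_bottom_nonzero: "a * d - b * c = (1 :: int) \<Longrightarrow> c \<noteq> 0 \<or> d \<noteq> 0"
  by auto

lemma Im_moebius_pos:
  fixes a b c d :: int
  assumes "a * d - b * c = 1" "Im z > 0"
  shows "Im ((of_int a * z + of_int b) / (of_int c * z + of_int d)) > 0"
  using lin_nonzero[OF assms(2) det_bottom_nonzero[OF assms(1)]] assms
  by (simp add: Im_moebius)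

text \<open>Only the transformation law under Gamma_0(M). Higher levels come in because removing the
  coefficients at multiples of \<open>p\<close> multiplies the level by \<open>p\<^sup>2\<close>;
  the argument there works with this law and the q-expansion at infinity.\<close>

definition modular_gamma0 :: "nat \<Rightarrow> nat \<Rightarrow> (complex \<Rightarrow> complex) \<Rightarrow> bool" where
  "modular_gamma0 k M f \<longleftrightarrow> (\<forall>a b c d :: int. \<forall>z. Im z > 0 \<longrightarrow> a * d - b * c = 1 \<longrightarrow> int M dvd c \<longrightarrow>
        f ((of_int a * z + of_int b) / (of_int c * z + of_int d)) =
          (of_int c * z + of_int d) ^ k * f z)"

lemma modular_gamma0D:
  assumes "modular_gamma0 k M f" "Im z > 0" "a * d - b * c = 1" "int M dvd c"
  shows "f ((of_int a * z + of_int b) / (of_int c * z + of_int d)) = (of_int c * z + of_int d) ^ k * f z"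
  using assms unfolding modular_gamma0_def by blast

lemma cusp_forms_iff:
  "f \<in> cusp_forms k \<longleftrightarrow> f holomorphic_on upper_half_plane \<and> modular_gamma0 k 1 f \<and>
     (\<exists>a. has_q_expansion f a \<and> a 0 = 0)"
  unfolding cusp_forms_def modular_gamma0_def upper_half_plane_def by auto

lemma modular_gamma0_shift:
  assumes "modular_gamma0 k M f" "Im z > 0"
  shows "f (z + of_int n) = f z"
  using modular_gamma0D[OF assms, of 1 1 n 0] by simp

text \<open>The Euclidean algorithm on the first column \<open>(a, c)\<close>: with
  \<open>a = c * q + r\<close>, the matrix is a translation by \<open>q\<close> after the inversion
  after a matrix with lower left entry \<open>r\<close>, where
  \<open>\<bar>r\<bar> < \<bar>c\<bar>\<close>. Evenness of \<open>k\<close> makes minus the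
  identity act trivially.\<close>

lemma modular_if_generators:
  fixes a b c d :: int
  assumes k: "even k"
    and per: "\<And>z. Im z > 0 \<Longrightarrow> f (z + 1) = f z"
    and inv: "\<And>z. Im z > 0 \<Longrightarrow> f (- 1 / z) = z ^ k * f z"
    and det: "a * d - b * c = 1" and z: "Im z > 0"
  shows "f ((of_int a * z + of_int b) / (of_int c * z + of_int d)) = (of_int c * z + of_int d) ^ k * f z"
  using det
proof (induction "nat \<bar>c\<bar>" arbitrary: a b c d rule: less_induct)
  case less
  have per_nat: "f (z + of_nat n) = f z" if "Im z > 0" for z n
  proof (induction n)
    case (Suc n)
    show ?case using per[of "z + of_nat n"] that Suc by (simp add: add_ac)
  qed simp
  have per_int: "f (z + of_int n) = f z" if "Im z > 0" for z n
  proof (cases "n \<ge> 0")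
    case True
    then show ?thesis using per_nat[OF that, of "nat n"] by simp
  next
    case False
    then show ?thesis using per_nat[of "z + of_int n" "nat (- n)"] that by simp
  qed
  show ?case
  proof (cases "c = 0")
    case True
    then have "(a = 1 \<and> d = 1) \<or> (a = - 1 \<and> d = - 1)"
      using less.prems zmult_eq_1_iff by simp
    then show ?thesis
      using per_int[OF z, of b] per_int[OF z, of "- b"] k True by auto
  next
    case False
    define q r b' where "q = a div c" and "r = a mod c" and "b' = b - q * d"
    have a: "a = c * q + r" by (simp add: q_def r_def)
    have det': "r * d - c * b' = 1" using less.prems by (simp add: a b'_def algebra_simps)
    have r: "\<bar>r\<bar> < \<bar>c\<bar>" using False by (simp add: r_def abs_mod_less)
    \<comment> \<open>The matrix with rows \<open>(- c, - d)\<close> and \<open>(r, b')\<close>;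
      inverting \<open>w\<close> and translating by \<open>q\<close> returns the original image of
      \<open>z\<close>.\<close>
    define w where "w = (of_int (- c) * z + of_int (- d)) / (of_int r * z + of_int b')"
    have IH: "f w = (of_int r * z + of_int b') ^ k * f z"
      unfolding w_def by (rule less.hyps) (use r det' in \<open>simp_all add: algebra_simps\<close>)
    have w: "Im w > 0"
      unfolding w_def by (rule Im_moebius_pos) (use det' z in \<open>simp_all add: algebra_simps\<close>)
    have nz: "of_int r * z + of_int b' \<noteq> 0" "of_int c * z + of_int d \<noteq> 0"
      using det' less.prems by (auto intro!: lin_nonzero[OF z])
    have "(of_int a * z + of_int b) / (of_int c * z + of_int d) =
        (of_int r * z + of_int b') / (of_int c * z + of_int d) + of_int q"
      using nz by (simp add: a b'_def field_simps)
    also have "(of_int r * z + of_int b') / (of_int c * z + of_int d) = - 1 / w"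
    proof -
      have neg: "of_int (- c) * z + of_int (- d) = - (of_int c * z + of_int d)" by simp
      have "x / y = - 1 / (- y / x)" for x y :: complex by simp
      then show ?thesis unfolding w_def neg .
    qed
    finally have eq: "(of_int a * z + of_int b) / (of_int c * z + of_int d) = - 1 / w + of_int q" .
    have "Im (- 1 / w) > 0" using w Im_moebius_pos[of 0 0 "-1" 1 w] by simp
    then have "f (- 1 / w + of_int q) = f (- 1 / w)" by (rule per_int)
    also have "\<dots> = w ^ k * ((of_int r * z + of_int b') ^ k * f z)" by (simp only: inv[OF w] IH)
    also have "\<dots> = (w * (of_int r * z + of_int b')) ^ k * f z" by (simp add: power_mult_distrib)
    also have "w * (of_int r * z + of_int b') = - (of_int c * z + of_int d)"
      using nz by (simp add: w_def)
    finally show ?thesis unfolding eq power_minus_even[OF k] .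
  qed
qed

lemma sum_roots_of_unity:
  assumes "p > 0"
  shows "(\<Sum>b<p. exp (2 * of_real pi * \<i> * (of_nat b / of_nat p)) ^ n) = (if p dvd n then of_nat p else 0 :: complex)"
proof -
  define w where "w = exp (2 * of_real pi * \<i> * (of_nat n / of_nat p))"
  have "(\<Sum>b<p. exp (2 * of_real pi * \<i> * (of_nat b / of_nat p)) ^ n) = (\<Sum>b<p. w ^ b)"
    by (simp add: w_def exp_of_nat_mult[symmetric] mult_ac)
  also have "\<dots> = (if p dvd n then of_nat p else 0)"
  proof (cases "p dvd n")
    case True
    then obtain m where m: "n = p * m" by auto
    have "w = exp (2 * of_real pi * \<i>) ^ m"
      using assms by (simp add: w_def m exp_of_nat_mult[symmetric] mult_ac)
    then show ?thesis using True by simp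
  next
    case False
    have "w ^ p = exp (2 * of_real pi * \<i>) ^ n"
      using assms by (simp add: w_def exp_of_nat_mult[symmetric] mult_ac)
    then have "w ^ p = 1" by simp
    moreover have "w \<noteq> 1"
    proof
      assume "w = 1"
      then have "exp (2 * of_real pi * \<i> * of_nat n / of_nat p) = 1" by (simp add: w_def)
      then show False using complex_root_unity_eq_1[of p n] assms False by simp
    qed
    ultimately show ?thesis using False by (simp add: geometric_sum)
  qed
  finally show ?thesis .
qed

section \<open>Operations on q-expansions\<close>

lemma has_q_expansionD:
  assumes "has_q_expansion f a" "Im z > 0"
  shows "(\<lambda>n. a n * exp (2 * of_real pi * \<i> * z) ^ n) sums f z"
  using assms by (simp add: has_q_expansion_def upper_half_plane_def)

lemma has_q_expansion_lincomb:
  assumes "has_q_expansion f a" "has_q_expansion g b"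
  shows "has_q_expansion (\<lambda>z. f z + c * g z) (\<lambda>n. a n + c * b n)"
  unfolding has_q_expansion_def
proof
  fix z assume "z \<in> upper_half_plane"
  then have "(\<lambda>n. a n * exp (2 * of_real pi * \<i> * z) ^ n + c * (b n * exp (2 * of_real pi * \<i> * z) ^ n)) sums (f z + c * g z)"
    using assms by (intro sums_add sums_mult) (auto simp: has_q_expansion_def)
  then show "(\<lambda>n. (a n + c * b n) * exp (2 * of_real pi * \<i> * z) ^ n) sums (f z + c * g z)"
    by (simp add: algebra_simps)
qed

text \<open>Orthogonality of the p-th roots of unity: averaging over translates by
  \<open>v / p\<close> projects onto the exponents divisible by \<open>p\<close>.\<close>

lemma has_q_expansion_average:
  assumes f: "has_q_expansion f a" and p: "p > 0"
  shows "has_q_expansion (\<lambda>z. (\<Sum>v<p. f (z + of_nat v / of_nat p)) / of_nat p) (\<lambda>n. if p dvd n then a n else 0)"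
  unfolding has_q_expansion_def
proof
  fix z assume z: "z \<in> upper_half_plane"
  let ?e = "\<lambda>z. exp (2 * of_real pi * \<i> * z)"
  have "(\<lambda>n. (\<Sum>v<p. a n * ?e (z + of_nat v / of_nat p) ^ n) / of_nat p) sums
      ((\<Sum>v<p. f (z + of_nat v / of_nat p)) / of_nat p)"
    by (intro sums_divide sums_sum has_q_expansionD[OF f]) (use z p in \<open>auto simp: upper_half_plane_def\<close>)
  moreover have "(\<Sum>v<p. a n * ?e (z + of_nat v / of_nat p) ^ n) / of_nat p = (if p dvd n then a n else 0) * ?e z ^ n" for n
  proof -
    have "(\<Sum>v<p. a n * ?e (z + of_nat v / of_nat p) ^ n) = (\<Sum>v<p. a n * ?e z ^ n * ?e (of_nat v / of_nat p) ^ n)"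
      by (simp add: distrib_left exp_add power_mult_distrib mult.assoc)
    also have "\<dots> = a n * ?e z ^ n * (if p dvd n then of_nat p else 0)"
      by (simp only: sum_distrib_left[symmetric] sum_roots_of_unity[OF p])
    finally show ?thesis using p by simp
  qed
  ultimately show "(\<lambda>n. (if p dvd n then a n else 0) * ?e z ^ n) sums ((\<Sum>v<p. f (z + of_nat v / of_nat p)) / of_nat p)"
    by simp
qed

lemma has_q_expansion_dilate:
  assumes f: "has_q_expansion f a" and p: "p > 0"
  shows "has_q_expansion (\<lambda>z. f (of_nat p * z)) (\<lambda>n. if p dvd n then a (n div p) else 0)"
  unfolding has_q_expansion_def
proof
  fix z assume z: "z \<in> upper_half_plane"
  let ?e = "\<lambda>z. exp (2 * of_real pi * \<i> * z)"
  have mono: "strict_mono (\<lambda>n. p * n)" using p by (simp add: strict_mono_def)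
  have pow: "?e z ^ (p * n) = ?e (of_nat p * z) ^ n" for n
    by (simp add: power_mult exp_of_nat_mult[symmetric] mult_ac)
  have "(\<lambda>n. a n * ?e (of_nat p * z) ^ n) sums f (of_nat p * z)"
    by (rule has_q_expansionD[OF f]) (use z p in \<open>auto simp: upper_half_plane_def\<close>)
  then have "(\<lambda>n. (\<lambda>n. (if p dvd n then a (n div p) else 0) * ?e z ^ n) (p * n)) sums f (of_nat p * z)"
    using p by (simp add: pow)
  then show "(\<lambda>n. (if p dvd n then a (n div p) else 0) * ?e z ^ n) sums f (of_nat p * z)"
    by (subst (asm) sums_mono_reindex[OF mono]) (auto simp: dvd_def)
qed

text \<open>The preceding average evaluated at \<open>z / p\<close>, where the surviving exponents
  are divided by \<open>p\<close>: the operator U_p.\<close>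

lemma has_q_expansion_contract:
  assumes f: "has_q_expansion f a" and p: "p > 0"
  shows "has_q_expansion (\<lambda>z. (\<Sum>v<p. f ((z + of_nat v) / of_nat p)) / of_nat p) (\<lambda>n. a (p * n))"
  unfolding has_q_expansion_def
proof
  fix z assume z: "z \<in> upper_half_plane"
  let ?e = "\<lambda>z. exp (2 * of_real pi * \<i> * z)"
  have mono: "strict_mono (\<lambda>n. p * n)" using p by (simp add: strict_mono_def)
  have pow: "?e (z / of_nat p) ^ (p * n) = ?e z ^ n" for n
    using p by (simp add: power_mult exp_of_nat_mult[symmetric] mult_ac)
  have "(\<lambda>n. (if p dvd n then a n else 0) * ?e (z / of_nat p) ^ n) sums
      ((\<Sum>v<p. f (z / of_nat p + of_nat v / of_nat p)) / of_nat p)"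
    by (rule has_q_expansionD[OF has_q_expansion_average[OF f p]])
      (use z p in \<open>auto simp: upper_half_plane_def\<close>)
  then have "(\<lambda>n. (if p dvd p * n then a (p * n) else 0) * ?e (z / of_nat p) ^ (p * n)) sums
      ((\<Sum>v<p. f (z / of_nat p + of_nat v / of_nat p)) / of_nat p)"
    by (subst (asm) sums_mono_reindex[OF mono, symmetric]) (auto simp: dvd_def)
  then show "(\<lambda>n. a (p * n) * ?e z ^ n) sums ((\<Sum>v<p. f ((z + of_nat v) / of_nat p)) / of_nat p)"
    by (simp only: pow add_divide_distrib dvd_triv_left if_True)
qed

section \<open>Hecke operators on modular forms\<close>

text \<open>The classical T_p, as U_p plus \<open>p ^ (k - 1)\<close> times the dilation by
  \<open>p\<close>. In this normalisation the first coefficient of the image is the p-th coefficient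
  of \<open>f\<close>.\<close>

definition hecke_op :: "nat \<Rightarrow> nat \<Rightarrow> (complex \<Rightarrow> complex) \<Rightarrow> complex \<Rightarrow> complex" where
  "hecke_op k p f z = of_nat p ^ (k - 1) * f (of_nat p * z) + (\<Sum>v<p. f ((z + of_nat v) / of_nat p)) / of_nat p"

text \<open>\<open>s v\<close> is -1/v modulo \<open>p\<close>. This involution describes how the
  inversion \<open>- 1 / z\<close> permutes the terms \<open>v = 1, ..., p - 1\<close> of the Hecke
  operator.\<close>

lemma neg_inverse_mod:
  assumes "prime (p :: nat)"
  obtains s where "\<And>v. v \<in> {1..<p} \<Longrightarrow> s v \<in> {1..<p}" "\<And>v. v \<in> {1..<p} \<Longrightarrow> int p dvd int v * int (s v) + 1"
    "\<And>v. v \<in> {1..<p} \<Longrightarrow> s (s v) = v"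
proof -
  have ex: "\<exists>w\<in>{1..<p}. int p dvd int v * int w + 1" if v: "v \<in> {1..<p}" for v
  proof -
    have "\<not> p dvd v" using v by (auto dest: dvd_imp_le)
    then have "coprime (int v) (int p)"
      using assms by (simp add: coprime_commute prime_imp_coprime)
    then obtain x where x: "[int v * x = 1] (mod int p)" using cong_solve_coprime_int by blast
    define w where "w = (- x) mod int p"
    have p: "int p > 1" using prime_gt_1_nat[OF assms] by simp
    have "[int v * w + 1 = int v * (- x) + 1] (mod int p)"
      unfolding w_def by (intro cong_add cong_mult) (auto simp: cong_def)
    moreover have "[int v * (- x) + 1 = - 1 + 1] (mod int p)"
      using cong_minus_minus_iff[THEN iffD2, OF x] by (intro cong_add) simp_all
    ultimately have "[int v * w + 1 = - 1 + 1] (mod int p)" by (rule cong_trans)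
    then have dvd: "int p dvd int v * w + 1" by (simp add: cong_0_iff)
    have "w \<noteq> 0" using dvd p by (intro notI) simp
    moreover have "0 \<le> w" "w < int p" using p by (simp_all add: w_def)
    ultimately show ?thesis using dvd by (intro bexI[of _ "nat w"]) auto
  qed
  define s where "s = (\<lambda>v. SOME w. w \<in> {1..<p} \<and> int p dvd int v * int w + 1)"
  have s: "s v \<in> {1..<p}" "int p dvd int v * int (s v) + 1" if "v \<in> {1..<p}" for v
    using someI_ex[of "\<lambda>w. w \<in> {1..<p} \<and> int p dvd int v * int w + 1"] ex[OF that] unfolding s_def by blast+
  have "s (s v) = v" if v: "v \<in> {1..<p}" for v
  proof -
    let ?w = "s (s v)"
    have "int p dvd (int (s v) * int ?w + 1) - (int v * int (s v) + 1)"
      by (rule dvd_diff[OF s(2)[OF s(1)[OF v]] s(2)[OF v]])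
    also have "(int (s v) * int ?w + 1) - (int v * int (s v) + 1) = int (s v) * (int ?w - int v)"
      by (simp add: algebra_simps)
    finally have "int p dvd int (s v) * (int ?w - int v)" .
    moreover have "\<not> int p dvd int (s v)" using s(1)[OF v] by (auto dest: dvd_imp_le)
    ultimately have "int p dvd int ?w - int v" using assms by (simp add: prime_dvd_mult_iff)
    moreover have "?w \<in> {1..<p}" using s(1)[OF s(1)[OF v]] .
    ultimately have "int ?w mod int p = int v mod int p" "?w < p" by (simp_all only: mod_eq_dvd_iff) simp
    then show ?thesis using v by simp
  qed
  with s show ?thesis using that by blast
qed

text \<open>Checked on the generators. Translation shifts the terms cyclically; the inversion
  exchanges the dilated term with the term \<open>v = 0\<close> and permutes the others by the
  involution -1/v.\<close>

lemma hecke_op_modular: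
  assumes k: "even k" "k > 0" and f: "modular_gamma0 k 1 f" and p: "prime p"
  shows "modular_gamma0 k 1 (hecke_op k p f)"
proof -
  have p0: "p > 0" using p prime_gt_0_nat by auto
  have shift: "f (z + of_int n) = f z" if "Im z > 0" for z n
    by (rule modular_gamma0_shift[OF f that])
  have per: "hecke_op k p f (z + 1) = hecke_op k p f z" if z: "Im z > 0" for z
  proof -
    let ?F = "\<lambda>v. f ((z + of_nat v) / of_nat p)"
    have "f (of_nat p * (z + 1)) = f (of_nat p * z)"
      using shift[of "of_nat p * z" "int p"] z p0 by (simp add: distrib_left)
    moreover have "(\<Sum>v<p. f ((z + 1 + of_nat v) / of_nat p)) = (\<Sum>v<p. ?F v)"
    proof -
      have "(\<Sum>v<p. ?F (Suc v)) + ?F 0 = (\<Sum>v<Suc p. ?F v)"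
        by (simp only: sum.lessThan_Suc_shift add.commute)
      also have "\<dots> = (\<Sum>v<p. ?F v) + ?F p" by simp
      also have "?F p = ?F 0"
        using shift[of "z / of_nat p" 1] z p0 by (simp add: add_divide_distrib)
      finally show ?thesis by (simp add: add_ac)
    qed
    ultimately show ?thesis by (simp add: hecke_op_def)
  qed
  have inv: "hecke_op k p f (- 1 / z) = z ^ k * hecke_op k p f z" if z: "Im z > 0" for z
  proof -
    have z0: "z \<noteq> 0" using z by auto
    have S: "f (- 1 / w) = w ^ k * f w" if "Im w > 0" for w
      using modular_gamma0D[OF f that, of 0 0 "-1" 1] by simp
    have pk: "of_nat p ^ k = of_nat p * (of_nat p :: complex) ^ (k - 1)"
      using k by (cases k) auto
    have t1: "of_nat p ^ (k - 1) * f (of_nat p * (- 1 / z)) = z ^ k * (f (z / of_nat p) / of_nat p)"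
    proof -
      have "of_nat p * (- 1 / z) = - 1 / (z / of_nat p)" using p0 by simp
      moreover have "Im (z / of_nat p) > 0" using z p0 by simp
      ultimately have "f (of_nat p * (- 1 / z)) = (z / of_nat p) ^ k * f (z / of_nat p)" using S by metis
      then show ?thesis using p0 by (simp add: power_divide pk)
    qed
    have t2: "f (- 1 / z / of_nat p) / of_nat p = z ^ k * (of_nat p ^ (k - 1) * f (of_nat p * z))"
    proof -
      have "- 1 / z / of_nat p = - 1 / (of_nat p * z)" by simp
      moreover have "Im (of_nat p * z) > 0" using z p0 by simp
      ultimately have "f (- 1 / z / of_nat p) = (of_nat p * z) ^ k * f (of_nat p * z)" using S by metis
      then show ?thesis using p0 by (simp add: power_mult_distrib pk)
    qed
    obtain s where s: "\<And>v. v \<in> {1..<p} \<Longrightarrow> s v \<in> {1..<p}"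
      "\<And>v. v \<in> {1..<p} \<Longrightarrow> int p dvd int v * int (s v) + 1" "\<And>v. v \<in> {1..<p} \<Longrightarrow> s (s v) = v"
      by (rule neg_inverse_mod[OF p]) (rule that)
    have tm: "f ((- 1 / z + of_nat v) / of_nat p) = z ^ k * f ((z + of_nat (s v)) / of_nat p)"
      if v: "v \<in> {1..<p}" for v
    proof -
      obtain u where u: "int v * int (s v) + 1 = int p * u" using s(2)[OF v] by (auto elim: dvdE)
      define w where "w = (z + of_nat (s v)) / of_nat p"
      have w: "Im w > 0" using z p0 by (simp add: w_def)
      have zw: "z = of_nat p * w - of_nat (s v)" using p0 by (simp add: w_def)
      \<comment> \<open>The matrix with rows \<open>(v, - u)\<close> and \<open>(p, - s v)\<close>
        has determinant 1 by the choice of \<open>u\<close>, and its denominator at \<open>w\<close>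
        is \<open>z\<close>.\<close>
      have "f ((of_int (int v) * w + of_int (- u)) / (of_int (int p) * w + of_int (- int (s v)))) =
          (of_int (int p) * w + of_int (- int (s v))) ^ k * f w"
        by (rule modular_gamma0D[OF f w]) (use u in \<open>simp_all add: algebra_simps\<close>)
      moreover have "of_int (int p) * w + of_int (- int (s v)) = z" by (simp add: zw)
      moreover have "(of_int (int v) * w + of_int (- u)) / z = (- 1 / z + of_nat v) / of_nat p"
      proof -
        have "of_nat v * of_nat (s v) + 1 = of_nat p * (of_int u :: complex)"
          using arg_cong[OF u, of "of_int :: int \<Rightarrow> complex"] by simp
        then have "of_nat p * (of_int (int v) * w + of_int (- u)) = of_nat v * z - 1"
          by (simp add: zw algebra_simps)
        moreover have "X / z = (- 1 / z + V) / P" if "P * X = V * z - 1" "P \<noteq> 0" for X V P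
          using that z0 by (simp add: field_simps)
        ultimately show ?thesis using p0 by simp
      qed
      ultimately show ?thesis by (simp add: w_def)
    qed
    have split: "(\<Sum>v<p. F v) = F 0 + (\<Sum>v\<in>{1..<p}. F v)" for F :: "nat \<Rightarrow> complex"
      using p0 by (simp add: lessThan_atLeast0 sum.atLeast_Suc_lessThan)
    have "(\<Sum>v\<in>{1..<p}. f ((- 1 / z + of_nat v) / of_nat p)) = (\<Sum>v\<in>{1..<p}. z ^ k * f ((z + of_nat (s v)) / of_nat p))"
      by (rule sum.cong) (use tm in auto)
    also have "\<dots> = (\<Sum>v\<in>{1..<p}. z ^ k * f ((z + of_nat v) / of_nat p))"
      by (rule sum.reindex_bij_witness[of _ s s]) (use s in auto)
    finally have t3: "(\<Sum>v\<in>{1..<p}. f ((- 1 / z + of_nat v) / of_nat p)) = z ^ k * (\<Sum>v\<in>{1..<p}. f ((z + of_nat v) / of_nat p))"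
      by (simp add: sum_distrib_left)
    have "hecke_op k p f (- 1 / z) = of_nat p ^ (k - 1) * f (of_nat p * (- 1 / z)) +
        (f (- 1 / z / of_nat p) / of_nat p + (\<Sum>v\<in>{1..<p}. f ((- 1 / z + of_nat v) / of_nat p)) / of_nat p)"
      by (simp add: hecke_op_def split add_divide_distrib)
    also have "\<dots> = z ^ k * (of_nat p ^ (k - 1) * f (of_nat p * z) +
        (f (z / of_nat p) + (\<Sum>v\<in>{1..<p}. f ((z + of_nat v) / of_nat p))) / of_nat p)"
      unfolding t1 t2 t3 by (simp add: algebra_simps add_divide_distrib)
    also have "\<dots> = z ^ k * hecke_op k p f z" by (simp add: hecke_op_def split)
    finally show ?thesis .
  qed
  show ?thesis unfolding modular_gamma0_def
    using modular_if_generators[OF k(1) per inv] by blast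
qed

lemma hecke_op_q_expansion:
  assumes "has_q_expansion f a" "p > 0"
  shows "has_q_expansion (hecke_op k p f) (\<lambda>n. a (p * n) + of_nat p ^ (k - 1) * (if p dvd n then a (n div p) else 0))"
  using has_q_expansion_lincomb[OF has_q_expansion_contract[OF assms] has_q_expansion_dilate[OF assms], of "of_nat p ^ (k - 1)"]
  by (simp add: hecke_op_def[abs_def] add.commute)

lemma hecke_op_holomorphic:
  assumes f: "f holomorphic_on upper_half_plane" and p: "p > 0"
  shows "hecke_op k p f holomorphic_on upper_half_plane"
proof -
  have *: "(\<lambda>z. f (g z)) holomorphic_on upper_half_plane"
    if "g holomorphic_on upper_half_plane" "\<And>z. Im z > 0 \<Longrightarrow> Im (g z) > 0" for g
    using holomorphic_on_compose_gen[OF that(1) f] that(2) by (auto simp: o_def upper_half_plane_def)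
  show ?thesis unfolding hecke_op_def[abs_def] using p
    by (intro holomorphic_intros *) auto
qed

lemma hecke_op_cusp_forms:
  assumes "even k" "k > 0" "f \<in> cusp_forms k" "prime p"
  shows "hecke_op k p f \<in> cusp_forms k"
proof -
  have p: "p > 0" using assms prime_gt_0_nat by auto
  obtain a where a: "has_q_expansion f a" "a 0 = 0" using assms(3) by (auto simp: cusp_forms_iff)
  show ?thesis unfolding cusp_forms_iff
    using hecke_op_holomorphic[of f p k] hecke_op_modular[of k f p] hecke_op_q_expansion[OF a(1) p, of k] assms a(2) p
    by (auto simp: cusp_forms_iff)
qed

section \<open>Forms whose coefficients away from given primes vanish\<close>

text \<open>Translation by \<open>v / p\<close> after the given matrix equals another integral
  matrix after translation by \<open>v' / p\<close>, where \<open>v'\<close> is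
  \<open>v * d\<^sup>2\<close> modulo \<open>p\<close>. Integrality holds because
  \<open>p\<^sup>2\<close> divides \<open>c\<close>, the lower left entry stays \<open>c\<close>,
  and \<open>v\<close> to \<open>v'\<close> is a permutation since \<open>a * d\<close> is 1 modulo
  \<open>p\<close>.\<close>

lemma average_modular:
  assumes f: "modular_gamma0 k M f" and p: "p > 0"
  shows "modular_gamma0 k (M * p\<^sup>2) (\<lambda>z. (\<Sum>v<p. f (z + of_nat v / of_nat p)) / of_nat p)"
  unfolding modular_gamma0_def
proof (intro allI impI)
  fix a b c d :: int and z
  assume z: "Im z > 0" and det: "a * d - b * c = 1" and "int (M * p\<^sup>2) dvd c"
  then obtain c0 where c: "c = int M * (int p)\<^sup>2 * c0" by (auto elim: dvdE)
  let ?j = "of_int c * z + of_int d :: complex" and ?\<gamma> = "(of_int a * z + of_int b) / (of_int c * z + of_int d)"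
  have j0: "?j \<noteq> 0" by (rule lin_nonzero[OF z det_bottom_nonzero[OF det]])
  define s where "s = (\<lambda>e v. nat ((int v * e\<^sup>2) mod int p))"
  have int_s: "int (s e v) = (int v * e\<^sup>2) mod int p" for e v using p by (simp add: s_def)
  have ad: "[a * d = 1] (mod int p)"
  proof -
    have "a * d - 1 = int p * (b * int M * int p * c0)" using det by (simp add: c power2_eq_square algebra_simps)
    then show ?thesis by (simp add: cong_iff_dvd_diff)
  qed
  have inv: "s e' (s e v) = v" if "[e * e' = 1] (mod int p)" "v < p" for e e' v
  proof -
    have "[int (s e v) * e'\<^sup>2 = int v * e\<^sup>2 * e'\<^sup>2] (mod int p)"
      unfolding int_s by (intro cong_mult) (auto simp: cong_def)
    also have "int v * e\<^sup>2 * e'\<^sup>2 = int v * (e * e')\<^sup>2" by (simp add: power_mult_distrib)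
    also have "[int v * (e * e')\<^sup>2 = int v * 1\<^sup>2] (mod int p)"
      using that(1) by (intro cong_mult cong_pow) auto
    finally have "int (s e' (s e v)) = int v mod int p" unfolding int_s by (simp add: cong_def)
    then show ?thesis using that(2) by simp
  qed
  have s_less: "s e v < p" for e v using p by (simp add: s_def nat_less_iff)
  have tm: "f (?\<gamma> + of_nat v / of_nat p) = ?j ^ k * f (z + of_nat (s d v) / of_nat p)" for v
  proof -
    let ?v' = "int (s d v)"
    have "[int v * d - ?v' * a = int v * d - int v * d\<^sup>2 * a] (mod int p)"
      unfolding int_s by (intro cong_diff cong_mult) (auto simp: cong_def)
    also have "int v * d - int v * d\<^sup>2 * a = int v * d * (1 - a * d)" by (simp add: power2_eq_square algebra_simps)
    also have "[int v * d * (1 - a * d) = int v * d * (1 - 1)] (mod int p)"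
      using ad by (intro cong_mult cong_diff) auto
    finally have "int p dvd int v * d - ?v' * a" by (simp add: cong_0_iff)
    then obtain e where e: "int v * d - ?v' * a = int p * e" by (auto elim: dvdE)
    \<comment> \<open>These are \<open>a + v c / p\<close>,
      \<open>b + (v d - v' a) / p - v v' c / p\<^sup>2\<close> and \<open>d - v' c / p\<close>, with
      the divisions carried out.\<close>
    define A B D where "A = a + int v * int M * int p * c0" and "B = b + e - int v * ?v' * int M * c0"
      and "D = d - int M * int p * c0 * ?v'"
    define w where "w = z + of_nat (s d v) / of_nat p"
    have w: "Im w > 0" using z by (simp add: w_def)
    have pw: "of_nat p * w = of_nat p * z + of_nat (s d v)" using p by (simp add: w_def distrib_left)
    have "A * D - B * c = (a * d - b * c) + int M * int p * c0 * ((int v * d - ?v' * a) - int p * e)"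
      by (simp add: A_def B_def D_def c power2_eq_square algebra_simps)
    then have detA: "A * D - B * c = 1" using det e by simp
    have Mc: "int M dvd c" by (simp add: c)
    have cc: "of_int c = of_nat M * (of_nat p)\<^sup>2 * (of_int c0 :: complex)" by (simp add: c)
    have "of_int c * w + of_int D = of_int c * z + of_int d + of_nat M * of_nat p * of_int c0 * (of_nat p * w - of_nat p * z - of_nat (s d v))"
      by (simp add: D_def cc power2_eq_square algebra_simps)
    then have jw: "of_int c * w + of_int D = ?j" by (simp add: pw)
    have ec: "of_nat v * of_int d - of_nat (s d v) * of_int a = of_nat p * (of_int e :: complex)"
      using arg_cong[OF e, of "of_int :: int \<Rightarrow> complex"] by simp
    have "of_nat p * (of_int A * w + of_int B) = of_int a * (of_nat p * w) + of_nat v * of_nat M * of_nat p * of_int c0 * (of_nat p * w) +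
        of_nat p * of_int b + of_nat p * of_int e - of_nat v * of_nat (s d v) * of_nat M * of_nat p * of_int c0"
      by (simp add: A_def B_def algebra_simps)
    also have "\<dots> = of_nat p * (of_int a * z + of_int b) + of_nat v * ?j"
      unfolding pw ec[symmetric] by (simp add: cc power2_eq_square algebra_simps)
    finally have "of_nat p * (of_int A * w + of_int B) = of_nat p * (of_int a * z + of_int b) + of_nat v * ?j" .
    moreover have "X / J = Y / J + V / P" if "P * X = P * Y + V * J" "P \<noteq> 0" "J \<noteq> 0" for X Y J V P :: complex
      using that by (simp add: field_simps)
    ultimately have "(of_int A * w + of_int B) / ?j = ?\<gamma> + of_nat v / of_nat p"
      using p j0 by simp
    then show ?thesis
      using modular_gamma0D[OF f w detA Mc] unfolding jw by (simp only: w_def)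
  qed
  have "(\<Sum>v<p. f (?\<gamma> + of_nat v / of_nat p)) = (\<Sum>v<p. ?j ^ k * f (z + of_nat (s d v) / of_nat p))"
    by (simp only: tm)
  also have "\<dots> = (\<Sum>v<p. ?j ^ k * f (z + of_nat v / of_nat p))"
    by (rule sum.reindex_bij_witness[of _ "s a" "s d"])
      (use s_less inv[of d a] inv[of a d] ad in \<open>auto simp: mult.commute\<close>)
  finally show "(\<Sum>v<p. f (?\<gamma> + of_nat v / of_nat p)) / of_nat p = ?j ^ k * ((\<Sum>v<p. f (z + of_nat v / of_nat p)) / of_nat p)"
    by (simp add: sum_distrib_left)
qed

text \<open>Translation by \<open>1/p\<close> together with \<open>\<Gamma>\<^sub>0(M)\<close> generates a matrix with diagonal
  \<open>(1/p, p)\<close> and lower left entry \<open>0\<close>, whence \<open>f z = p ^ k * f (p\<^sup>2 z)\<close>.\<close>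
lemma multiples_only_zero:
  assumes f: "modular_gamma0 k M f" "has_q_expansion f a" and k: "k > 0" and p: "prime p" "\<not> p dvd M"
    and a: "\<And>n. \<not> p dvd n \<Longrightarrow> a n = 0"
  shows "a = (\<lambda>_. 0)"
proof -
  have p1: "p > 1" using p prime_gt_1_nat by auto
  have per: "f (z + 1 / of_nat p) = f z" if z: "Im z > 0" for z
  proof -
    let ?e = "\<lambda>z. exp (2 * of_real pi * \<i> * z)"
    have root: "?e (1 / of_nat p) ^ n = 1" if n: "p dvd n" for n
    proof -
      obtain m where m: "n = p * m" using n by (auto elim: dvdE)
      have "?e (1 / of_nat p) ^ n = exp (2 * of_real pi * \<i>) ^ m"
        using p1 by (simp add: m exp_of_nat_mult[symmetric] mult_ac)
      then show ?thesis by simp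
    qed
    have "(\<lambda>n. a n * ?e (z + 1 / of_nat p) ^ n) = (\<lambda>n. a n * ?e z ^ n)"
    proof (intro ext)
      show "a n * ?e (z + 1 / of_nat p) ^ n = a n * ?e z ^ n" for n
      proof (cases "p dvd n")
        case True
        then show ?thesis by (simp only: distrib_left exp_add power_mult_distrib root mult_1_right)
      next
        case False
        then show ?thesis by (simp only: a[OF False] mult_zero_left)
      qed
    qed
    moreover have "(\<lambda>n. a n * ?e (z + 1 / of_nat p) ^ n) sums f (z + 1 / of_nat p)"
      using z by (intro has_q_expansionD[OF f(2)]) simp
    ultimately show ?thesis using has_q_expansionD[OF f(2) z] by (simp only: sums_unique2)
  qed
  have gcd: "gcd (int p) (int M) = 1" using p by (simp add: prime_imp_coprime flip: coprime_iff_gcd_eq_1)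
  have "gcd (int p + int M) (int M) = 1" by (simp only: gcd_add1 gcd)
  moreover have "gcd (int p + int M) (int p) = 1"
    by (simp only: add.commute[of "int p"] gcd_add1 gcd.commute[of "int M"] gcd)
  ultimately have "coprime (int (p + M)) (int (p * M))"
    by (simp only: coprime_iff_gcd_eq_1[symmetric] of_nat_add of_nat_mult coprime_mult_right_iff)
  \<comment> \<open>This puts the matrix with rows \<open>(x, y)\<close> and
    \<open>(- p M, p + M)\<close> in Gamma_0(M). Applied after the translation by
    \<open>1 / p\<close> and the matrix with rows \<open>(1, 0)\<close> and \<open>(M, 1)\<close>,
    its lower left entry cancels, and the product sends \<open>z'\<close> to
    \<open>(z' + x + p y) / p\<^sup>2\<close>.\<close>
  then obtain x y where xy: "x * int (p + M) + y * int (p * M) = 1"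
    using bezout_int by (metis coprime_iff_gcd_eq_1)
  have rel: "f z = of_nat p ^ k * f (of_nat (p\<^sup>2) * z)" if z: "Im z > 0" for z
  proof -
    let ?c = "x + int p * y"
    define z' where "z' = of_nat (p\<^sup>2) * z - of_int ?c"
    have z': "Im z' > 0" using z p1 by (simp add: z'_def)
    define w1 where "w1 = z' / (of_nat M * z' + 1)"
    have w1: "Im w1 > 0" "f w1 = (of_nat M * z' + 1) ^ k * f z'"
      using Im_moebius_pos[of 1 1 0 "int M", OF _ z'] modular_gamma0D[OF f(1) z', of 1 1 0 "int M"] by (simp_all add: w1_def)
    have nz: "of_nat M * z' + 1 \<noteq> 0" using lin_nonzero[OF z', of "int M" 1] by simp
    define w2 where "w2 = w1 + 1 / of_nat p"
    have w2: "Im w2 > 0" "f w2 = f w1" using w1 per by (simp_all add: w2_def)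
    have pw2: "of_nat p * w2 * (of_nat M * z' + 1) = of_nat p * z' + of_nat M * z' + 1"
    proof -
      have "P * (X / J + 1 / P) * J = P * X + J" if "P \<noteq> 0" "J \<noteq> 0" for P X J :: complex
        using that by (simp add: field_simps)
      from this[of "of_nat p" _ z'] show ?thesis using nz p1 unfolding w2_def w1_def by simp
    qed
    let ?j = "of_int (- int (p * M)) * w2 + of_int (int (p + M)) :: complex"
    have "f ((of_int x * w2 + of_int y) / ?j) = ?j ^ k * f w2"
      by (rule modular_gamma0D[OF f(1) w2(1)]) (use xy in \<open>simp_all add: algebra_simps\<close>)
    then have eq: "f ((of_int x * w2 + of_int y) / ?j) = (?j * (of_nat M * z' + 1)) ^ k * f z'"
      by (simp add: w2 w1 power_mult_distrib)
    have jp: "?j * (of_nat M * z' + 1) = of_nat p"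
    proof -
      have "?j * (of_nat M * z' + 1) = - of_nat M * (of_nat p * w2 * (of_nat M * z' + 1)) + (of_nat p + of_nat M) * (of_nat M * z' + 1)"
        by (simp add: algebra_simps)
      also have "\<dots> = of_nat p" unfolding pw2 by (simp add: algebra_simps)
      finally show ?thesis .
    qed
    have "of_nat p * ((of_int x * w2 + of_int y) * (of_nat M * z' + 1)) =
        of_int x * (of_nat p * w2 * (of_nat M * z' + 1)) + of_nat p * of_int y * (of_nat M * z' + 1)"
      by (simp add: algebra_simps)
    also have "\<dots> = (of_int x * (of_nat p + of_nat M) + of_int y * (of_nat p * of_nat M)) * z' + of_int ?c"
      unfolding pw2 by (simp add: algebra_simps)
    also have "of_int x * (of_nat p + of_nat M) + of_int y * (of_nat p * of_nat M) = (1 :: complex)"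
      using arg_cong[OF xy, of "of_int :: int \<Rightarrow> complex"] by simp
    finally have "of_nat p * ((of_int x * w2 + of_int y) * (of_nat M * z' + 1)) = of_nat (p\<^sup>2) * z"
      by (simp add: z'_def)
    then have "(of_int x * w2 + of_int y) * (of_nat M * z' + 1) = of_nat p * z"
      using p1 by (simp add: power2_eq_square)
    moreover have "(of_int x * w2 + of_int y) / ?j = (of_int x * w2 + of_int y) * (of_nat M * z' + 1) / (?j * (of_nat M * z' + 1))"
      using nz by simp
    ultimately have "(of_int x * w2 + of_int y) / ?j = z" unfolding jp using p1 by simp
    then have "f z = of_nat p ^ k * f z'" using eq unfolding jp by simp
    also have "f z' = f (of_nat (p\<^sup>2) * z)"
    proof -
      have "z' = of_nat (p\<^sup>2) * z + of_int (- ?c)" by (simp add: z'_def)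
      moreover have "Im (of_nat (p\<^sup>2) * z) > 0" using z p1 by simp
      ultimately show ?thesis by (simp only: modular_gamma0_shift[OF f(1)])
    qed
    finally show ?thesis .
  qed
  define b where "b = (\<lambda>n. of_nat p ^ k * (if p\<^sup>2 dvd n then a (n div p\<^sup>2) else 0))"
  have "has_q_expansion f b"
  proof -
    have "has_q_expansion (\<lambda>z. f (of_nat (p\<^sup>2) * z)) (\<lambda>n. if p\<^sup>2 dvd n then a (n div p\<^sup>2) else 0)"
      by (rule has_q_expansion_dilate[OF f(2)]) (use p1 in simp)
    then show ?thesis unfolding has_q_expansion_def b_def
      using rel by (auto simp: upper_half_plane_def mult.assoc intro!: sums_mult)
  qed
  \<comment> \<open>So \<open>a n\<close> is \<open>p ^ k\<close> times the coefficient at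
    \<open>n div p\<^sup>2\<close>, or 0 if \<open>p\<^sup>2\<close> does not divide
    \<open>n\<close>. Descent settles \<open>n > 0\<close>, and at \<open>n = 0\<close> the factor
    \<open>p ^ k\<close> differs from 1.\<close>
  then have ab: "a = b" by (rule has_q_expansion_unique[OF f(2)])
  have "a n = 0" for n
  proof (induction n rule: less_induct)
    case (less n)
    show ?case
    proof (cases "n = 0")
      case True
      have "a 0 = of_nat p ^ k * a 0" using fun_cong[OF ab, of 0] by (simp add: b_def)
      moreover have "(of_nat p :: complex) ^ k \<noteq> 1"
      proof
        assume "(of_nat p :: complex) ^ k = 1"
        then have "p ^ k = 1" by (metis of_nat_eq_1_iff of_nat_power)
        then show False using k p1 by simp
      qed
      ultimately show ?thesis using True by simp
    next
      case False
      have "p\<^sup>2 > 1" by (rule one_less_power[OF p1]) simp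
      then have "n div p\<^sup>2 < n" using False by (intro div_less_dividend) auto
      then show ?thesis using fun_cong[OF ab, of n] less by (simp add: b_def)
    qed
  qed
  then show ?thesis by auto
qed

text \<open>Sieving out the multiples of one prime \<open>p\<close> at a time raises the level by \<open>p\<^sup>2\<close> only,
  so the level stays coprime to the remaining primes.\<close>
theorem coprime_coeffs_zero:
  assumes "finite Q" "\<And>p. p \<in> Q \<Longrightarrow> prime p" "k > 0" "modular_gamma0 k M f" "has_q_expansion f a"
    "\<And>p. p \<in> Q \<Longrightarrow> \<not> p dvd M" "\<And>n. (\<And>p. p \<in> Q \<Longrightarrow> \<not> p dvd n) \<Longrightarrow> a n = 0"
  shows "a = (\<lambda>_. 0)"
  using assms
proof (induction Q arbitrary: M f a rule: finite_induct)
  case empty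
  then show ?case by auto
next
  case (insert p Q)
  have p: "prime p" "p > 0" using insert.prems(1) prime_gt_0_nat by auto
  define g where "g = (\<lambda>z. f z + (- 1) * ((\<Sum>v<p. f (z + of_nat v / of_nat p)) / of_nat p))"
  define b where "b = (\<lambda>n. a n + (- 1) * (if p dvd n then a n else 0))"
  have b0: "b = (\<lambda>_. 0)"
  proof (rule insert.IH)
    show "modular_gamma0 k (M * p\<^sup>2) g"
      unfolding modular_gamma0_def g_def
    proof (intro allI impI)
      fix a b c d :: int and z
      assume *: "Im z > 0" "a * d - b * c = 1" "int (M * p\<^sup>2) dvd c"
      have "int M dvd c" using *(3) by (metis dvd_mult_left of_nat_mult)
      note f = modular_gamma0D[OF insert.prems(3) *(1,2) this]
        and av = modular_gamma0D[OF average_modular[OF insert.prems(3) p(2)] *]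
      show "f ((of_int a * z + of_int b) / (of_int c * z + of_int d)) +
          - 1 * ((\<Sum>v<p. f ((of_int a * z + of_int b) / (of_int c * z + of_int d) + of_nat v / of_nat p)) / of_nat p) =
          (of_int c * z + of_int d) ^ k * (f z + - 1 * ((\<Sum>v<p. f (z + of_nat v / of_nat p)) / of_nat p))"
        unfolding f av by (simp add: algebra_simps)
    qed
    show "has_q_expansion g b"
      unfolding g_def b_def
      by (rule has_q_expansion_lincomb[OF insert.prems(4) has_q_expansion_average[OF insert.prems(4) p(2)]])
    show "\<not> q dvd M * p\<^sup>2" if "q \<in> Q" for q
    proof -
      have "prime q" "q \<noteq> p" "\<not> q dvd M" using insert that by auto
      then show ?thesis using p(1) by (metis prime_dvd_mult_iff prime_dvd_power primes_dvd_imp_eq)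
    qed
    show "b n = 0" if "\<And>q. q \<in> Q \<Longrightarrow> \<not> q dvd n" for n
      using insert.prems(6)[of n] that by (auto simp: b_def)
  qed (use insert.prems in auto)
  \<comment> \<open>The induction has removed everything off the multiples of \<open>p\<close>; the
    rest is handled at the original level \<open>M\<close>, which \<open>p\<close> does not
    divide.\<close>
  have az: "a n = 0" if "\<not> p dvd n" for n
    using that fun_cong[OF b0, of n] by (simp add: b_def)
  show ?case
    by (rule multiples_only_zero[OF insert.prems(3,4,2) p(1) _ az]) (use insert.prems(5) in auto)
qed

section \<open>Size of the coefficients\<close>

text \<open>The fundamental domain argument: a bottom row minimising the norm of
  \<open>c z + d\<close>, followed by a translation, gives a point \<open>w\<close> with
  \<open>\<bar>Re w\<bar> \<le> 1 / 2\<close> and norm at least 1, whence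
  \<open>(Im w)\<^sup>2 \<ge> 3 / 4\<close>. The weaker bound 3/4 for \<open>Im w\<close> avoids a
  square root.\<close>

lemma reduction:
  assumes z: "Im z > 0"
  obtains a b c d :: int where "a * d - b * c = 1"
    "Im ((of_int a * z + of_int b) / (of_int c * z + of_int d)) \<ge> 3 / 4"
proof -
  let ?n = "\<lambda>(c, d). norm (of_int c * z + of_int d)"
  \<comment> \<open>Only rows of norm at most 1 compete: there are finitely many of them, and
    \<open>(0, 1)\<close> is one.\<close>
  define T where "T = {(c, d). (\<exists>a b :: int. a * d - b * c = 1) \<and> norm (of_int c * z + of_int d) \<le> 1}"
  define C where "C = \<lceil>1 / Im z\<rceil>"
  define D where "D = \<lceil>1 + of_int C * norm z\<rceil>"
  have "T \<subseteq> {- C..C} \<times> {- D..D}"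
  proof
    fix x assume "x \<in> T"
    then obtain c d where x: "x = (c, d)" and le: "norm (of_int c * z + of_int d) \<le> 1" by (auto simp: T_def)
    have "\<bar>of_int c\<bar> * Im z = \<bar>Im (of_int c * z + of_int d)\<bar>" using z by (simp add: abs_mult)
    also have "\<dots> \<le> 1" using abs_Im_le_cmod[of "of_int c * z + of_int d"] le by linarith
    finally have "\<bar>of_int c\<bar> \<le> 1 / Im z" using z by (simp add: field_simps)
    then have c: "\<bar>c\<bar> \<le> C" unfolding C_def by linarith
    have "norm (of_int d :: complex) \<le> norm (of_int c * z + of_int d) + norm (of_int c * z)"
      using norm_triangle_ineq4[of "of_int c * z + of_int d" "of_int c * z"] by simp
    also have "\<dots> \<le> 1 + of_int C * norm z"
      using le c by (intro add_mono) (auto simp: norm_mult intro!: mult_right_mono)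
    finally have "\<bar>d\<bar> \<le> D" unfolding D_def norm_of_int by linarith
    with c x show "x \<in> {- C..C} \<times> {- D..D}" by auto
  qed
  then have fin: "finite T" by (rule finite_subset) simp
  have "(0, 1) \<in> T" by (auto simp: T_def intro: exI[of _ 1])
  then have "T \<noteq> {}" by auto
  then obtain c d where cd: "(c, d) \<in> T" and min: "\<And>x. x \<in> T \<Longrightarrow> ?n (c, d) \<le> ?n x"
    using ex_is_arg_min_if_finite[OF fin, of ?n]
    by (metis (no_types, lifting) is_arg_min_linorder surj_pair)
  from cd obtain a b where det: "a * d - b * c = 1" and le: "norm (of_int c * z + of_int d) \<le> 1"
    by (auto simp: T_def)
  let ?j = "of_int c * z + of_int d :: complex"
  have j0: "?j \<noteq> 0" by (rule lin_nonzero[OF z det_bottom_nonzero[OF det]])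
  define n where "n = round (Re ((of_int a * z + of_int b) / ?j))"
  define a' b' where "a' = a - n * c" and "b' = b - n * d"
  have det': "a' * d - b' * c = 1" using det by (simp add: a'_def b'_def algebra_simps)
  define w where "w = (of_int a' * z + of_int b') / ?j"
  have "of_int a' * z + of_int b' = (of_int a * z + of_int b) - of_int n * ?j"
    by (simp add: a'_def b'_def algebra_simps)
  then have "w = (of_int a * z + of_int b) / ?j - of_int n"
    using j0 by (simp add: w_def diff_divide_distrib)
  then have Re_w: "\<bar>Re w\<bar> \<le> 1 / 2"
    using of_int_round_abs_le[of "Re ((of_int a * z + of_int b) / ?j)"] by (simp add: n_def abs_minus_commute)
  \<comment> \<open>Otherwise an inversion would lead to the bottom row \<open>(a', b')\<close>,
    smaller than the minimal one.\<close>
  have "norm w \<ge> 1"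
  proof (rule ccontr)
    assume "\<not> norm w \<ge> 1"
    then have "norm w * norm ?j < 1 * norm ?j" using j0 by (intro mult_strict_right_mono) auto
    moreover have "norm w * norm ?j = norm (of_int a' * z + of_int b')" using j0 by (simp add: w_def norm_divide)
    ultimately have less: "norm (of_int a' * z + of_int b') < norm ?j" by simp
    moreover have "(- c) * b' - (- d) * a' = 1" using det' by (simp add: algebra_simps)
    ultimately have "(a', b') \<in> T" using le unfolding T_def by fastforce
    from min[OF this] less show False by simp
  qed
  have Im_w: "Im w > 0" unfolding w_def by (rule Im_moebius_pos[OF det' z])
  have "1 \<le> (norm w)\<^sup>2" using \<open>norm w \<ge> 1\<close> by (simp add: one_le_power)
  also have "\<dots> = (Re w)\<^sup>2 + (Im w)\<^sup>2" by (rule cmod_power2)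
  also have "(Re w)\<^sup>2 \<le> (1 / 2)\<^sup>2" using Re_w by (metis abs_ge_zero power2_abs power_mono)
  finally have "(3 / 4)\<^sup>2 \<le> (Im w)\<^sup>2" by (simp add: power2_eq_square)
  then have "3 / 4 \<le> Im w" using Im_w by (simp add: power2_le_iff_abs_le)
  with det' show ?thesis unfolding w_def by (rule that)
qed

section \<open>Parseval's identity and the growth of the coefficients\<close>

lemma q_norm: "norm (exp (2 * of_real pi * \<i> * z)) = exp (- 2 * pi * Im z)"
  by (simp add: norm_exp_eq_Re)

lemma q_expansion_abs_summable:
  assumes f: "has_q_expansion f a" and y: "y > 0"
  shows "summable (\<lambda>n. norm (a n) * exp (- 2 * pi * y) ^ n)"
proof -
  let ?e = "\<lambda>y. exp (2 * of_real pi * \<i> * Complex 0 y)"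
  have "summable (\<lambda>n. a n * ?e (y / 2) ^ n)"
    using has_q_expansionD[OF f, of "Complex 0 (y / 2)"] y by (simp add: sums_iff)
  moreover have "norm (?e y) < norm (?e (y / 2))" using y unfolding q_norm by simp
  ultimately have "summable (\<lambda>n. norm (a n * ?e y ^ n))" by (rule powser_insidea)
  then show ?thesis by (simp only: norm_mult norm_power q_norm complex.sel)
qed

text \<open>Parseval for the cyclic group of order \<open>N\<close>; sampling at roots of unity
  replaces the integral over a horizontal segment.\<close>

lemma sum_norm_square_roots:
  fixes c :: "nat \<Rightarrow> complex"
  assumes "N > 0"
  shows "(\<Sum>j<N. (norm (\<Sum>n<N. c n * exp (2 * of_real pi * \<i> * (of_nat j / of_nat N)) ^ n))\<^sup>2) = N * (\<Sum>n<N. (norm (c n))\<^sup>2)"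
proof -
  let ?w = "\<lambda>j. exp (2 * of_real pi * \<i> * (of_nat j / of_nat N)) :: complex"
  have w1: "?w j * cnj (?w j) = 1" for j
    by (simp add: complex_norm_square[symmetric] norm_exp_eq_Re)
  have orth1: "(\<Sum>j<N. ?w j ^ n * cnj (?w j) ^ m) = (if n = m then of_nat N else 0)" if "m \<le> n" "n < N" for n m
  proof -
    have "?w j ^ n * cnj (?w j) ^ m = ?w j ^ (n - m)" for j
    proof -
      have "?w j ^ n * cnj (?w j) ^ m = ?w j ^ (n - m) * (?w j * cnj (?w j)) ^ m"
        using that by (simp add: power_mult_distrib flip: power_add mult.assoc)
      then show ?thesis by (simp only: w1 power_one mult_1_right)
    qed
    then have "(\<Sum>j<N. ?w j ^ n * cnj (?w j) ^ m) = (if N dvd n - m then of_nat N else 0)"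
      by (simp only: sum_roots_of_unity[OF assms])
    moreover have "N dvd n - m \<longleftrightarrow> n = m" using that by (auto dest: dvd_imp_le)
    ultimately show ?thesis by simp
  qed
  have orth: "(\<Sum>j<N. ?w j ^ n * cnj (?w j) ^ m) = (if n = m then of_nat N else 0)" if "m < N" "n < N" for n m
  proof (cases "m \<le> n")
    case True
    then show ?thesis using orth1 that by blast
  next
    case False
    then have "cnj (\<Sum>j<N. ?w j ^ m * cnj (?w j) ^ n) = cnj 0" using orth1[of n m] that by simp
    then show ?thesis using False by (simp only: cnj_sum complex_cnj_mult complex_cnj_power complex_cnj_cnj) (simp add: mult.commute)
  qed
  have "of_real (\<Sum>j<N. (norm (\<Sum>n<N. c n * ?w j ^ n))\<^sup>2) = (\<Sum>j<N. (\<Sum>n<N. c n * ?w j ^ n) * cnj (\<Sum>m<N. c m * ?w j ^ m))"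
    by (simp only: of_real_sum complex_norm_square)
  also have "\<dots> = (\<Sum>j<N. \<Sum>n<N. \<Sum>m<N. c n * cnj (c m) * (?w j ^ n * cnj (?w j) ^ m))"
    by (simp only: cnj_sum sum_product complex_cnj_mult complex_cnj_power) (simp only: mult_ac)
  also have "\<dots> = (\<Sum>n<N. \<Sum>m<N. \<Sum>j<N. c n * cnj (c m) * (?w j ^ n * cnj (?w j) ^ m))"
    by (subst sum.swap, rule sum.cong[OF refl], rule sum.swap)
  also have "\<dots> = (\<Sum>n<N. \<Sum>m<N. c n * cnj (c m) * (if n = m then of_nat N else 0))"
    by (intro sum.cong refl) (simp only: sum_distrib_left[symmetric] orth lessThan_iff)
  also have "\<dots> = (\<Sum>n<N. c n * cnj (c n) * of_nat N)"
    by (intro sum.cong refl) (simp add: if_distrib cong: if_cong)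
  also have "\<dots> = of_real (N * (\<Sum>n<N. (norm (c n))\<^sup>2))"
    by (simp only: of_real_mult of_real_sum complex_norm_square of_real_of_nat_eq sum_distrib_left mult.commute)
  finally show ?thesis by (simp only: of_real_eq_iff)
qed

text \<open>Discrete Parseval for the first \<open>M\<close> terms of the expansion at height
  \<open>y\<close>. The truncation error is uniform in \<open>x\<close> and disappears as
  \<open>M\<close> grows with \<open>N\<close> fixed.\<close>

lemma q_coeffs_bessel:
  assumes f: "has_q_expansion f a" and y: "y > 0" and K: "\<And>x. norm (f (Complex x y)) \<le> K"
  shows "(\<Sum>n<N. (norm (a n) * exp (- 2 * pi * y) ^ n)\<^sup>2) \<le> K\<^sup>2"
proof -
  define r where "r = exp (- 2 * pi * y)"
  define c where "c = (\<lambda>n. a n * of_real (r ^ n))"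
  have norm_c: "norm (c n) = norm (a n) * r ^ n" for n by (simp add: c_def norm_mult norm_power r_def)
  have summ: "summable (\<lambda>n. norm (c n))"
    unfolding norm_c r_def by (rule q_expansion_abs_summable[OF f y])
  define \<epsilon> where "\<epsilon> = (\<lambda>N. \<Sum>n. norm (c (n + N)))"
  have e_0: "\<epsilon> \<longlonglongrightarrow> 0" unfolding \<epsilon>_def by (rule suminf_exist_split2[OF summ])
  let ?e = "\<lambda>x. exp (2 * of_real pi * \<i> * x) :: complex"
  have trunc: "norm (\<Sum>n<N. c n * ?e (of_real x) ^ n) \<le> K + \<epsilon> N" for x N
  proof -
    have "?e (Complex x y) = of_real r * ?e (of_real x)"
      by (simp add: r_def Complex_eq exp_of_real exp_add[symmetric] algebra_simps flip: exp_of_real)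
    then have sums: "(\<lambda>n. c n * ?e (of_real x) ^ n) sums f (Complex x y)"
      using has_q_expansionD[OF f, of "Complex x y"] y by (simp add: c_def power_mult_distrib mult.assoc)
    have norm_e: "norm (c n * ?e (of_real x) ^ n) = norm (c n)" for n
      by (simp add: norm_mult norm_power norm_exp_eq_Re)
    have "f (Complex x y) - (\<Sum>n<N. c n * ?e (of_real x) ^ n) = (\<Sum>n. c (n + N) * ?e (of_real x) ^ (n + N))"
      using sums suminf_minus_initial_segment[OF sums_summable[OF sums], of N] by (simp add: sums_iff)
    also have "norm \<dots> \<le> \<epsilon> N" unfolding \<epsilon>_def
      by (rule norm_suminf_le) (auto simp: norm_e intro: summable_ignore_initial_segment[OF summ])
    finally have "norm (f (Complex x y) - (\<Sum>n<N. c n * ?e (of_real x) ^ n)) \<le> \<epsilon> N" .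
    then show ?thesis using K[of x] norm_triangle_sub[of "\<Sum>n<N. c n * ?e (of_real x) ^ n" "f (Complex x y)"]
      by (simp add: norm_minus_commute)
  qed
  have le: "(\<Sum>n<M. (norm (c n))\<^sup>2) \<le> (K + \<epsilon> M)\<^sup>2" if M: "M > 0" for M
  proof -
    have "M * (\<Sum>n<M. (norm (c n))\<^sup>2) = (\<Sum>j<M. (norm (\<Sum>n<M. c n * ?e (of_nat j / of_nat M) ^ n))\<^sup>2)"
      by (rule sum_norm_square_roots[OF M, symmetric])
    also have "\<dots> \<le> (\<Sum>j<M. (K + \<epsilon> M)\<^sup>2)"
      using trunc[of "real j / real M" M for j] by (intro sum_mono power_mono) simp_all
    also have "\<dots> = M * (K + \<epsilon> M)\<^sup>2" by simp
    finally show ?thesis using M by simp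
  qed
  have "(\<lambda>M. (K + \<epsilon> M)\<^sup>2) \<longlonglongrightarrow> (K + 0)\<^sup>2" by (intro tendsto_intros e_0)
  moreover have "(\<Sum>n<N. (norm (c n))\<^sup>2) \<le> (K + \<epsilon> M)\<^sup>2" if "M \<ge> Suc N" for M
  proof -
    have "(\<Sum>n<N. (norm (c n))\<^sup>2) \<le> (\<Sum>n<M. (norm (c n))\<^sup>2)"
      by (rule sum_mono2) (use that in auto)
    with le[of M] that show ?thesis by simp
  qed
  ultimately have "(\<Sum>n<N. (norm (c n))\<^sup>2) \<le> (K + 0)\<^sup>2"
    by (intro LIMSEQ_le_const) auto
  then show ?thesis by (simp add: norm_c r_def)
qed

lemma q_coeff_bound:
  assumes f: "has_q_expansion f a" and y: "y > 0" and K: "\<And>x. norm (f (Complex x y)) \<le> K"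
  shows "norm (a n) * exp (- 2 * pi * y) ^ n \<le> K"
proof -
  have K0: "K \<ge> 0" using order.trans[OF norm_ge_zero K] .
  have "(norm (a n) * exp (- 2 * pi * y) ^ n)\<^sup>2 \<le> (\<Sum>n<Suc n. (norm (a n) * exp (- 2 * pi * y) ^ n)\<^sup>2)"
    by (rule member_le_sum) auto
  also have "\<dots> \<le> K\<^sup>2" by (rule q_coeffs_bessel[OF f y K])
  finally show ?thesis using K0 by (rule power2_le_imp_le)
qed

text \<open>The squared norm of \<open>c z + d\<close> that divides \<open>Im z\<close> cancels the
  automorphy factor. The weight is written \<open>2 * l\<close> so that the height carries a natural
  exponent.\<close>

lemma modular_norm_invariant:
  fixes a b c d :: int
  assumes f: "modular_gamma0 (2 * l) 1 f" and det: "a * d - b * c = 1" and z: "Im z > 0"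
  defines "w \<equiv> (of_int a * z + of_int b) / (of_int c * z + of_int d)"
  shows "norm (f w) * Im w ^ l = norm (f z) * Im z ^ l"
proof -
  let ?j = "of_int c * z + of_int d :: complex"
  have j0: "?j \<noteq> 0" by (rule lin_nonzero[OF z det_bottom_nonzero[OF det]])
  have "f w = ?j ^ (2 * l) * f z" unfolding w_def by (rule modular_gamma0D[OF f z det]) simp
  moreover have "Im w = Im z / (norm ?j)\<^sup>2" unfolding w_def by (rule Im_moebius[OF det])
  ultimately show ?thesis using j0 by (simp add: norm_mult norm_power power_divide power_mult)
qed

text \<open>By invariance and \<open>reduction\<close> only heights at least 3/4 matter. There
  \<open>a 0 = 0\<close> leaves a factor decaying exponentially in the height, which beats
  \<open>Im z ^ l\<close>.\<close>

lemma cusp_form_bounded: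
  assumes f: "modular_gamma0 (2 * l) 1 f" "has_q_expansion f a" "a 0 = 0" and l: "l > 0"
  obtains K where "\<And>z. Im z > 0 \<Longrightarrow> norm (f z) * Im z ^ l \<le> K"
proof -
  \<comment> \<open>The norm of q at height 1/2, safely below 3/4; at height \<open>y\<close> it is
    \<open>r0 * s\<close> with \<open>s \<le> 1\<close>.\<close>
  define r0 where "r0 = exp (- pi)"
  have summ: "summable (\<lambda>n. norm (a n) * r0 ^ n)"
    using q_expansion_abs_summable[OF f(2), of "1 / 2"] by (simp add: r0_def)
  define C where "C = (\<Sum>n. norm (a n) * r0 ^ n)"
  have C0: "C \<ge> 0" unfolding C_def by (intro suminf_nonneg[OF summ]) (simp add: r0_def)
  define K where "K = C * exp pi * real l ^ l"
  have high: "norm (f z) * Im z ^ l \<le> K" if z: "Im z \<ge> 3 / 4" for z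
  proof -
    define y where "y = Im z"
    define s where "s = exp (- pi * (2 * y - 1))"
    have s: "0 < s" "s \<le> 1" using z pi_gt_zero by (auto simp: s_def y_def)
    have rs: "exp (- 2 * pi * y) = r0 * s" by (simp add: r0_def s_def algebra_simps flip: exp_add)
    have "norm (a n * exp (2 * of_real pi * \<i> * z) ^ n) \<le> s * (norm (a n) * r0 ^ n)" for n
    proof (cases "n = 0")
      case False
      have "norm (a n * exp (2 * of_real pi * \<i> * z) ^ n) = s ^ n * (norm (a n) * r0 ^ n)"
        unfolding norm_mult norm_power q_norm y_def[symmetric] rs by (simp add: power_mult_distrib)
      also have "s ^ n \<le> s ^ 1" using False s by (intro power_decreasing) auto
      finally show ?thesis by (simp add: r0_def mult_right_mono)
    qed (simp add: f(3))
    then have "norm (\<Sum>n. a n * exp (2 * of_real pi * \<i> * z) ^ n) \<le> (\<Sum>n. s * (norm (a n) * r0 ^ n))"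
      by (intro norm_suminf_le summable_mult summ)
    also have "(\<Sum>n. a n * exp (2 * of_real pi * \<i> * z) ^ n) = f z"
      using has_q_expansionD[OF f(2), of z] z by (simp add: sums_iff)
    also have "(\<Sum>n. s * (norm (a n) * r0 ^ n)) = s * C" unfolding C_def by (rule suminf_mult[OF summ])
    finally have fz: "norm (f z) \<le> s * C" .
    have y0: "y \<ge> 0" using z by (simp add: y_def)
    have "y / l \<le> exp (y / l)" using exp_ge_add_one_self[of "y / l"] by linarith
    then have "(y / l) ^ l \<le> exp (y / l) ^ l" using y0 by (intro power_mono) auto
    also have "exp (y / l) ^ l = exp y" using l by (simp flip: exp_of_nat_mult)
    finally have yl: "y ^ l \<le> real l ^ l * exp y" using l by (simp add: power_divide field_simps)
    have "s * exp y = exp pi * exp (y - 2 * pi * y)" by (simp add: s_def algebra_simps flip: exp_add)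
    also have "\<dots> \<le> exp pi * 1"
    proof -
      have "1 * y \<le> (2 * pi) * y" using y0 pi_ge_two by (intro mult_right_mono) auto
      then show ?thesis by simp
    qed
    finally have sy: "s * exp y \<le> exp pi" by simp
    have "norm (f z) * y ^ l \<le> (s * C) * (real l ^ l * exp y)"
      using s C0 y0 by (intro mult_mono fz yl) auto
    also have "\<dots> = C * real l ^ l * (s * exp y)" by simp
    also have "\<dots> \<le> C * real l ^ l * exp pi" using C0 by (intro mult_left_mono sy) auto
    finally show ?thesis by (simp add: K_def y_def mult_ac)
  qed
  show ?thesis
  proof
    fix z assume z: "Im z > 0"
    obtain a b c d :: int where "a * d - b * c = 1" "Im ((of_int a * z + of_int b) / (of_int c * z + of_int d)) \<ge> 3 / 4"
      using reduction[OF z] .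
    then show "norm (f z) * Im z ^ l \<le> K"
      using high modular_norm_invariant[OF f(1) _ z] by metis
  qed
qed

text \<open>Parseval at height \<open>1 / N\<close>: there \<open>f\<close> has norm at most
  \<open>K * N ^ l\<close>, and the squared weights of the first \<open>N\<close> coefficients are
  at least \<open>exp (- 4 * pi)\<close>.\<close>

lemma cusp_form_coeff_square_sum:
  assumes f: "modular_gamma0 (2 * l) 1 f" "has_q_expansion f a" "a 0 = 0" and l: "l > 0"
  obtains C where "\<And>N. (\<Sum>n<N. (norm (a n))\<^sup>2) \<le> C * real N ^ (2 * l)"
proof -
  obtain K where K: "\<And>z. Im z > 0 \<Longrightarrow> norm (f z) * Im z ^ l \<le> K"
    by (rule cusp_form_bounded[OF assms]) (rule that)
  show ?thesis
  proof
    fix N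
    show "(\<Sum>n<N. (norm (a n))\<^sup>2) \<le> (K\<^sup>2 * exp (4 * pi)) * real N ^ (2 * l)"
    proof (cases "N = 0")
      case False
      define y where "y = 1 / real N"
      have y: "y > 0" using False by (simp add: y_def)
      have "norm (f (Complex x y)) \<le> K * real N ^ l" for x
        using K[of "Complex x y"] y False by (simp add: y_def power_divide field_simps)
      then have bes: "(\<Sum>n<N. (norm (a n) * exp (- 2 * pi * y) ^ n)\<^sup>2) \<le> (K * real N ^ l)\<^sup>2"
        by (rule q_coeffs_bessel[OF f(2) y])
      have "(\<Sum>n<N. (norm (a n))\<^sup>2) \<le> (\<Sum>n<N. exp (4 * pi) * (norm (a n) * exp (- 2 * pi * y) ^ n)\<^sup>2)"
      proof (rule sum_mono)
        fix n assume n: "n \<in> {..<N}"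
        have "1 \<le> exp (4 * pi * (1 - n * y))"
          using n False by (simp add: y_def field_simps)
        also have "\<dots> = exp (4 * pi) * (exp (- 2 * pi * y) ^ n)\<^sup>2"
          by (simp add: algebra_simps flip: exp_of_nat_mult exp_add exp_double)
        finally have "1 * (norm (a n))\<^sup>2 \<le> exp (4 * pi) * (exp (- 2 * pi * y) ^ n)\<^sup>2 * (norm (a n))\<^sup>2"
          by (intro mult_right_mono) auto
        then show "(norm (a n))\<^sup>2 \<le> exp (4 * pi) * (norm (a n) * exp (- 2 * pi * y) ^ n)\<^sup>2"
          by (simp add: power_mult_distrib mult_ac)
      qed
      also have "\<dots> \<le> exp (4 * pi) * (K * real N ^ l)\<^sup>2"
        unfolding sum_distrib_left[symmetric] by (intro mult_left_mono bes) auto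
      finally show ?thesis by (simp add: power_mult_distrib mult_ac flip: power_mult)
    qed simp
  qed
qed

section \<open>Absolute convergence, and forms with vanishing initial coefficients\<close>

text \<open>Cut at powers of 2: the block starting at \<open>2 ^ J\<close> contributes at most
  \<open>C * 2 ^ k * \<rho> ^ J\<close>, a geometric series with ratio
  \<open>2 powr (k - \<tau>) < 1\<close>.\<close>

lemma dyadic_summable:
  fixes b :: "nat \<Rightarrow> real"
  assumes b: "\<And>n. b n \<ge> 0" "\<And>N. (\<Sum>n<N. b n) \<le> C * real N ^ k" and \<tau>: "\<tau> > real k"
  shows "summable (\<lambda>n. b n * real n powr (- \<tau>))"
proof -
  let ?g = "\<lambda>n. b n * real n powr (- \<tau>)"
  define \<rho> where "\<rho> = 2 powr (real k - \<tau>)"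
  have \<rho>: "0 < \<rho>" "\<rho> < 1" using \<tau> by (auto simp: \<rho>_def powr_less_one)
  have C: "C \<ge> 0" using b(2)[of 1] b(1)[of 0] by simp
  have block: "(\<Sum>n<2 ^ J. ?g n) \<le> C * 2 ^ k * (\<Sum>i<J. \<rho> ^ i)" for J
  proof (induction J)
    case (Suc J)
    have "(\<Sum>n<2 ^ Suc J. ?g n) = (\<Sum>n<2 ^ J. ?g n) + (\<Sum>n\<in>{2 ^ J..<2 ^ Suc J}. ?g n)"
      by (subst sum.union_disjoint[symmetric]) (auto intro!: sum.cong)
    also have "(\<Sum>n\<in>{2 ^ J..<2 ^ Suc J}. ?g n) \<le> (\<Sum>n\<in>{2 ^ J..<2 ^ Suc J}. (2 ^ J) powr (- \<tau>) * b n)"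
    proof (rule sum_mono)
      fix n :: nat assume "n \<in> {2 ^ J..<2 ^ Suc J}"
      then have "real (2 ^ J) \<le> real n" by (simp only: atLeastLessThan_iff of_nat_le_iff)
      then have "real n powr (- \<tau>) \<le> (2 ^ J) powr (- \<tau>)" using \<tau> by (intro powr_mono2') auto
      from mult_left_mono[OF this b(1)[of n]]
      show "?g n \<le> (2 ^ J) powr (- \<tau>) * b n" by (simp only: mult.commute)
    qed
    also have "\<dots> = (2 ^ J) powr (- \<tau>) * (\<Sum>n\<in>{2 ^ J..<2 ^ Suc J}. b n)" by (simp only: sum_distrib_left)
    also have "\<dots> \<le> (2 ^ J) powr (- \<tau>) * (C * real (2 ^ Suc J) ^ k)"
    proof (intro mult_left_mono)
      have "(\<Sum>n\<in>{2 ^ J..<2 ^ Suc J}. b n) \<le> (\<Sum>n<2 ^ Suc J. b n)"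
        by (rule sum_mono2) (auto simp: b(1))
      then show "(\<Sum>n\<in>{2 ^ J..<2 ^ Suc J}. b n) \<le> C * real (2 ^ Suc J) ^ k"
        using b(2) by (rule order.trans)
    qed simp
    also have "\<dots> = C * 2 ^ k * ((2 ^ J) powr (- \<tau>) * (2 ^ J) ^ k)" by (simp add: power_mult_distrib mult_ac)
    also have "(2 ^ J) powr (- \<tau>) * (2 ^ J) ^ k = \<rho> ^ J"
    proof -
      have "x powr (- \<tau>) * x ^ k = x powr (real k - \<tau>)" if "x > 0" for x :: real
        using that by (simp add: powr_realpow[symmetric] powr_add[symmetric])
      from this[of "2 ^ J"] have "(2 ^ J) powr (- \<tau>) * (2 ^ J) ^ k = (2 ^ J :: real) powr (real k - \<tau>)"
        by simp
      also have "\<dots> = \<rho> ^ J" by (simp add: \<rho>_def powr_powr mult.commute flip: powr_realpow)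
      finally show ?thesis .
    qed
    finally show ?case using Suc by (simp add: distrib_left)
  qed simp
  have "(\<Sum>n<N. ?g n) \<le> C * 2 ^ k * (1 / (1 - \<rho>))" for N
  proof -
    have "(\<Sum>n<N. ?g n) \<le> (\<Sum>n<2 ^ N. ?g n)"
      by (rule sum_mono2) (use b(1) less_exp[of N] in \<open>auto intro: less_trans\<close>)
    also have "\<dots> \<le> C * 2 ^ k * (\<Sum>i<N. \<rho> ^ i)" by (rule block)
    also have "\<dots> \<le> C * 2 ^ k * (1 / (1 - \<rho>))"
    proof (intro mult_left_mono)
      have "(\<Sum>i<N. \<rho> ^ i) = (1 - \<rho> ^ N) / (1 - \<rho>)" using \<rho> by (simp add: sum_gp_strict)
      also have "\<dots> \<le> 1 / (1 - \<rho>)" using \<rho> by (intro divide_right_mono) auto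
      finally show "(\<Sum>i<N. \<rho> ^ i) \<le> 1 / (1 - \<rho>)" .
    qed (use C in auto)
    finally show ?thesis .
  qed
  then show ?thesis
    using b(1) by (intro summableI_nonneg_bounded) auto
qed

text \<open>AM-GM reduces absolute convergence to the mean square of the coefficients, which replaces Deligne's bound.\<close>
lemma cusp_form_dirichlet_summable:
  assumes f: "modular_gamma0 (2 * l) 1 f" "has_q_expansion f a" "a 0 = 0" and l: "l > 0"
    and \<sigma>: "\<sigma> > (2 * real l + 1) / 2"
  shows "summable (\<lambda>n. norm (a n) * real n powr (- \<sigma>))"
proof -
  obtain C where C: "\<And>N. (\<Sum>n<N. (norm (a n))\<^sup>2) \<le> C * real N ^ (2 * l)"
    by (rule cusp_form_coeff_square_sum[OF f l]) (rule that)
  \<comment> \<open>The balancing exponent (weight minus 1)/2: both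
    \<open>\<sigma> + \<mu> > 2 * l\<close> and \<open>\<sigma> - \<mu> > 1\<close> then say the
    same as the hypothesis on \<open>\<sigma>\<close>.\<close>
  define \<mu> where "\<mu> = (2 * real l - 1) / 2"
  have 1: "summable (\<lambda>n. (norm (a n))\<^sup>2 * real n powr (- (\<sigma> + \<mu>)))"
    by (rule dyadic_summable[OF _ C]) (use \<sigma> in \<open>auto simp: \<mu>_def field_simps\<close>)
  have 2: "summable (\<lambda>n. real n powr (\<mu> - \<sigma>))"
    using \<sigma> by (simp add: summable_real_powr_iff \<mu>_def field_simps)
  show ?thesis
  proof (rule summable_comparison_test'[OF summable_add[OF 1 2], of 0])
    fix n :: nat
    show "norm (norm (a n) * real n powr (- \<sigma>)) \<le> (norm (a n))\<^sup>2 * real n powr (- (\<sigma> + \<mu>)) + real n powr (\<mu> - \<sigma>)"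
    proof (cases "n = 0")
      case False
      define x where "x = real n powr \<mu>"
      have x: "x > 0" using False by (simp add: x_def)
      have "0 \<le> (norm (a n) - x)\<^sup>2 + (norm (a n))\<^sup>2 + x\<^sup>2" by simp
      then have "norm (a n) * x \<le> (norm (a n))\<^sup>2 + x\<^sup>2" by (simp add: power2_eq_square algebra_simps)
      then have "norm (a n) \<le> (norm (a n))\<^sup>2 / x + x" using x by (simp add: field_simps power2_eq_square)
      then have "norm (a n) * real n powr (- \<sigma>) \<le> ((norm (a n))\<^sup>2 / x + x) * real n powr (- \<sigma>)"
        by (intro mult_right_mono) auto
      also have "\<dots> = (norm (a n))\<^sup>2 * real n powr (- (\<sigma> + \<mu>)) + real n powr (\<mu> - \<sigma>)"
        using False by (simp add: x_def powr_minus powr_add powr_diff field_simps)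
      finally show ?thesis by simp
    qed simp
  qed
qed

text \<open>If the first \<open>k\<close> coefficients vanish, the expansion at height \<open>\<ge> 3/4\<close> turns
  a bound \<open>M\<close> for \<open>\<bar>f\<bar> y\<^sup>l\<close> into the bound \<open>M / 2\<close>.\<close>
lemma initial_coeffs_zero:
  assumes f: "modular_gamma0 (2 * l) 1 f" "has_q_expansion f a" and l: "l \<ge> 2"
    and a: "\<And>n. n < 2 * l \<Longrightarrow> a n = 0"
  shows "a = (\<lambda>_. 0)"
proof -
  have halve: "norm (f z) * Im z ^ l \<le> M / 2"
    if M: "\<And>z. Im z > 0 \<Longrightarrow> norm (f z) * Im z ^ l \<le> M" and z: "Im z \<ge> 3 / 4" for M z
  proof -
    have "norm (f (Complex x (1 / 2))) \<le> M * 2 ^ l" for x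
      using M[of "Complex x (1 / 2)"] by (simp add: power_divide field_simps)
    \<comment> \<open>Coefficients are estimated at height 1/2, strictly below \<open>z\<close>; the
      difference in height gains \<open>\<rho> ^ n\<close> with
      \<open>\<rho> \<le> 2 / 5\<close>.\<close>
    then have coeff: "norm (a n) * exp (- pi) ^ n \<le> M * 2 ^ l" for n
      using q_coeff_bound[OF f(2), of "1 / 2" "M * 2 ^ l" n] by simp
    have M0: "M \<ge> 0" using order.trans[OF _ M[of \<i>]] by simp
    define t where "t = 2 * Im z - 1"
    have t: "t \<ge> 1 / 2" using z by (simp add: t_def)
    define \<rho> where "\<rho> = exp (- pi * t)"
    have pi3: "pi \<ge> 3" using pi_approx by simp
    have pt: "pi * t \<ge> 3 / 2" using mult_mono[OF pi3 t] by simp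
    have "\<rho> = 1 / exp (pi * t)" by (simp add: \<rho>_def exp_minus field_simps)
    also have "\<dots> \<le> 1 / (1 + pi * t)"
      using pt exp_ge_add_one_self[of "pi * t"] by (intro divide_left_mono) auto
    also have "\<dots> \<le> 1 / (5 / 2)" using pt by (intro divide_left_mono) auto
    finally have \<rho>: "0 < \<rho>" "\<rho> \<le> 2 / 5" by (auto simp: \<rho>_def)
    let ?e = "exp (2 * of_real pi * \<i> * z)"
    have tm: "norm (a n * ?e ^ n) \<le> M * 2 ^ l * \<rho> ^ n" for n
    proof -
      have eq: "exp (- 2 * pi * Im z) = exp (- pi) * \<rho>" by (simp add: \<rho>_def t_def algebra_simps flip: exp_add)
      have "norm (a n * ?e ^ n) = norm (a n) * exp (- pi) ^ n * \<rho> ^ n"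
        unfolding norm_mult norm_power q_norm eq power_mult_distrib by (simp only: mult.assoc)
      also have "\<dots> \<le> M * 2 ^ l * \<rho> ^ n" using \<rho> by (intro mult_right_mono coeff) auto
      finally show ?thesis .
    qed
    have geo: "(\<lambda>n. M * 2 ^ l * \<rho> ^ (2 * l) * \<rho> ^ n) sums (M * 2 ^ l * \<rho> ^ (2 * l) * (1 / (1 - \<rho>)))"
      using \<rho> by (intro sums_mult geometric_sums) auto
    have "(\<lambda>n. a (n + 2 * l) * ?e ^ (n + 2 * l)) sums f z"
      using sums_split_initial_segment[OF has_q_expansionD[OF f(2)], of z "2 * l"] z a by simp
    then have "norm (f z) = norm (\<Sum>n. a (n + 2 * l) * ?e ^ (n + 2 * l))" by (simp add: sums_iff)
    also have "\<dots> \<le> (\<Sum>n. M * 2 ^ l * \<rho> ^ (2 * l) * \<rho> ^ n)"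
      using tm[of "n + 2 * l" for n] by (intro norm_suminf_le sums_summable[OF geo]) (simp add: power_add mult_ac)
    also have "\<dots> = M * 2 ^ l * \<rho> ^ (2 * l) * (1 / (1 - \<rho>))" using geo by (simp add: sums_iff)
    finally have fz: "norm (f z) \<le> M * 2 ^ l * \<rho> ^ (2 * l) * (1 / (1 - \<rho>))" .
    have "2 * Im z = 1 + t" by (simp add: t_def)
    also have "\<dots> \<le> exp t" by (rule exp_ge_add_one_self)
    finally have "(2 * Im z) ^ l \<le> exp t ^ l" using z by (intro power_mono) auto
    then have "(2 * Im z) ^ l * \<rho> ^ (2 * l) \<le> exp t ^ l * \<rho> ^ (2 * l)" using \<rho> by (intro mult_right_mono) auto
    also have "\<dots> = 1 / exp (l * ((2 * pi - 1) * t))"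
    proof -
      have "exp t ^ l * \<rho> ^ (2 * l) = exp (real l * t + real (2 * l) * (- pi * t))"
        by (simp only: \<rho>_def exp_add exp_of_nat_mult)
      also have "real l * t + real (2 * l) * (- pi * t) = - (l * ((2 * pi - 1) * t))"
        by (simp add: algebra_simps)
      finally show ?thesis by (simp only: exp_minus inverse_eq_divide)
    qed
    also have "\<dots> \<le> 1 / exp 5"
    proof -
      \<comment> \<open>From \<open>l \<ge> 2\<close>, \<open>2 * pi - 1 \<ge> 5\<close> and
        \<open>t \<ge> 1 / 2\<close>. The final constant is then 1/6 times 5/3, that is 5/18 <
        1/2.\<close>
      have "2 * (5 * (1 / 2)) \<le> real l * ((2 * pi - 1) * t)"
        using l pi3 t by (intro mult_mono) auto
      then show ?thesis by (intro divide_left_mono) auto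
    qed
    also have "\<dots> \<le> 1 / 6" using exp_ge_add_one_self[of 5] by (intro divide_left_mono) auto
    finally have small: "(2 * Im z) ^ l * \<rho> ^ (2 * l) \<le> 1 / 6" .
    have "norm (f z) * Im z ^ l \<le> M * 2 ^ l * \<rho> ^ (2 * l) * (1 / (1 - \<rho>)) * Im z ^ l"
      using z by (intro mult_right_mono fz) auto
    also have "\<dots> = M * (((2 * Im z) ^ l * \<rho> ^ (2 * l)) * (1 / (1 - \<rho>)))" by (simp add: power_mult_distrib mult_ac)
    also have "\<dots> \<le> M * ((1 / 6) * (5 / 3))"
    proof (intro mult_left_mono mult_mono small M0)
      show "1 / (1 - \<rho>) \<le> 5 / 3" using \<rho> by (simp add: field_simps)
    qed (use \<rho> z in auto)
    also have "\<dots> \<le> M / 2" using M0 by simp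
    finally show ?thesis .
  qed
  have "a 0 = 0" using a l by simp
  then obtain K where K: "\<And>z. Im z > 0 \<Longrightarrow> norm (f z) * Im z ^ l \<le> K"
    by (rule cusp_form_bounded[OF f _ order.strict_trans2[OF zero_less_numeral l]]) (rule that)
  have bound: "\<forall>z. Im z > 0 \<longrightarrow> norm (f z) * Im z ^ l \<le> K / 2 ^ j" for j
  proof (induction j)
    case (Suc j)
    show ?case
    proof (intro allI impI)
      fix z assume z: "Im z > 0"
      obtain a b c d :: int where det: "a * d - b * c = 1" "Im ((of_int a * z + of_int b) / (of_int c * z + of_int d)) \<ge> 3 / 4"
        using reduction[OF z] .
      show "norm (f z) * Im z ^ l \<le> K / 2 ^ Suc j"
        using halve[OF _ det(2), of "K / 2 ^ j"] Suc modular_norm_invariant[OF f(1) det(1) z] by simp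
    qed
  qed (use K in simp)
  have "f z = 0" if z: "Im z > 0" for z
  proof -
    have "(\<lambda>j. K * (1 / 2) ^ j) \<longlonglongrightarrow> K * 0" by (intro tendsto_intros LIMSEQ_power_zero) simp
    moreover have "norm (f z) * Im z ^ l \<le> K * (1 / 2) ^ j" for j
      using bound[of j] z by (simp add: power_one_over field_simps)
    ultimately have "norm (f z) * Im z ^ l \<le> K * 0" by (intro LIMSEQ_le_const) auto
    moreover have "Im z ^ l > 0" using z by simp
    ultimately have "norm (f z) \<le> 0" by (metis mult_le_cancel_right mult_zero_left mult_zero_right not_less)
    then show ?thesis by simp
  qed
  then have "has_q_expansion f (\<lambda>_. 0)" by (simp add: has_q_expansion_def upper_half_plane_def)
  then show ?thesis by (rule has_q_expansion_unique[OF f(2)])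
qed

section \<open>Hecke-stable sequence spaces\<close>

text \<open>The effect of \<open>hecke_op\<close> on coefficients. The linear algebra is done on
  sequences, which are unique, whereas forms are total functions of which only the values on the
  half plane count.\<close>

definition hecke_seq :: "nat \<Rightarrow> nat \<Rightarrow> (nat \<Rightarrow> complex) \<Rightarrow> nat \<Rightarrow> complex" where
  "hecke_seq k p a n = a (p * n) + of_nat p ^ (k - 1) * (if p dvd n then a (n div p) else 0)"

text \<open>For distinct primes both sides expand into the same four terms; the numbered facts
  identify their indices.\<close>

lemma hecke_seq_commute:
  assumes "prime p" "prime q"
  shows "hecke_seq k p (hecke_seq k q a) = hecke_seq k q (hecke_seq k p a)"
proof (cases "p = q")
  case False
  have cop: "coprime p q" using assms False by (simp add: primes_coprime)
  have pos: "p > 0" "q > 0" using assms prime_gt_0_nat by auto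
  show ?thesis
  proof
    fix n
    have 1: "q dvd p * n \<longleftrightarrow> q dvd n" "p dvd q * n \<longleftrightarrow> p dvd n"
      using cop by (auto simp: coprime_dvd_mult_right_iff coprime_commute)
    have 2: "(p * n) div q = p * (n div q)" if "q dvd n"
      using that by (simp add: div_mult_swap)
    have 3: "(q * n) div p = q * (n div p)" if "p dvd n"
      using that by (simp add: div_mult_swap)
    have 4: "p dvd n \<and> q dvd n div p \<longleftrightarrow> q dvd n \<and> p dvd n div q"
    proof -
      have "p dvd n \<and> q dvd n div p \<longleftrightarrow> p * q dvd n"
        using pos by (metis dvd_div_iff_mult dvd_mult_left mult.commute less_numeral_extra(3) dvd_mult_imp_div dvd_mult_right)
      moreover have "q dvd n \<and> p dvd n div q \<longleftrightarrow> p * q dvd n"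
        using pos by (metis dvd_div_iff_mult dvd_mult_left mult.commute less_numeral_extra(3) dvd_mult_imp_div dvd_mult_right)
      ultimately show ?thesis by blast
    qed
    have 5: "n div p div q = n div q div p" by (metis div_mult2_eq mult.commute)
    show "hecke_seq k p (hecke_seq k q a) n = hecke_seq k q (hecke_seq k p a) n"
      unfolding hecke_seq_def 1 5 using 4 2 3
      by (cases "p dvd n"; cases "q dvd n") (simp_all add: distrib_left mult.left_commute)
  qed
qed simp

section \<open>Linear algebra by leading positions\<close>

definition seq_subspace :: "(nat \<Rightarrow> complex) set \<Rightarrow> bool" where
  "seq_subspace U \<longleftrightarrow> (\<lambda>_. 0) \<in> U \<and> (\<forall>a\<in>U. \<forall>b\<in>U. (\<lambda>n. a n + b n) \<in> U) \<and> (\<forall>a\<in>U. \<forall>c. (\<lambda>n. c * a n) \<in> U)"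

lemma seq_subspaceD:
  assumes "seq_subspace U"
  shows "(\<lambda>_. 0) \<in> U" "a \<in> U \<Longrightarrow> b \<in> U \<Longrightarrow> (\<lambda>n. a n + b n) \<in> U" "a \<in> U \<Longrightarrow> (\<lambda>n. c * a n) \<in> U"
  using assms by (auto simp: seq_subspace_def)

lemma seq_subspace_lincomb:
  assumes "seq_subspace U" "a \<in> U" "b \<in> U"
  shows "(\<lambda>n. a n + c * b n) \<in> U" "(\<lambda>n. a n - c * b n) \<in> U"
proof -
  show "(\<lambda>n. a n + c * b n) \<in> U" for c
    using seq_subspaceD(2)[OF assms(1,2) seq_subspaceD(3)[OF assms(1,3)]] .
  from this[of "-c"] show "(\<lambda>n. a n - c * b n) \<in> U" by simp
qed

text \<open>The leading positions of an echelon form; their number plays the role of the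
  dimension.\<close>

definition pivots :: "(nat \<Rightarrow> complex) set \<Rightarrow> nat set" where
  "pivots U = {n. \<exists>u\<in>U. u n \<noteq> 0 \<and> (\<forall>i<n. u i = 0)}"

lemma pivots_mono: "U \<subseteq> V \<Longrightarrow> pivots U \<subseteq> pivots V"
  by (auto simp: pivots_def)

lemma hecke_seq_linear:
  "hecke_seq k p (\<lambda>n. a n + b n) = (\<lambda>n. hecke_seq k p a n + hecke_seq k p b n)"
  "hecke_seq k p (\<lambda>n. a n - b n) = (\<lambda>n. hecke_seq k p a n - hecke_seq k p b n)"
  "hecke_seq k p (\<lambda>n. c * a n) = (\<lambda>n. c * hecke_seq k p a n)"
  "hecke_seq k p (\<lambda>n. 0) = (\<lambda>n. 0)"
  by (auto simp: hecke_seq_def fun_eq_iff algebra_simps)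

text \<open>The vector q(T) v, by Horner's scheme.\<close>

definition poly_apply :: "((nat \<Rightarrow> complex) \<Rightarrow> (nat \<Rightarrow> complex)) \<Rightarrow> (nat \<Rightarrow> complex) \<Rightarrow> complex poly \<Rightarrow> nat \<Rightarrow> complex" where
  "poly_apply T v q = fold_coeffs (\<lambda>c w n. c * v n + T w n) q (\<lambda>_. 0)"

lemma poly_apply_0: "poly_apply T v 0 = (\<lambda>_. 0)"
  by (simp add: poly_apply_def)

lemma poly_apply_pCons:
  assumes "T (\<lambda>_. 0) = (\<lambda>_. 0)"
  shows "poly_apply T v (pCons c q) = (\<lambda>n. c * v n + T (poly_apply T v q) n)"
proof (cases "c = 0 \<and> q = 0")
  case True
  then show ?thesis using assms by (simp add: poly_apply_0)
next
  case False
  then show ?thesis by (cases "c = 0") (simp_all add: poly_apply_def)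
qed

lemma poly_apply_add:
  assumes "T (\<lambda>_. 0) = (\<lambda>_. 0)" "\<And>a b. T (\<lambda>n. a n + b n) = (\<lambda>n. T a n + T b n)"
  shows "poly_apply T v (q + r) = (\<lambda>n. poly_apply T v q n + poly_apply T v r n)"
proof (induction q r rule: poly_induct2)
  case 0
  show ?case by (simp add: poly_apply_0)
next
  case (pCons a p b q)
  then show ?case
    by (simp add: poly_apply_pCons[of T, OF assms(1)] assms(2) algebra_simps)
qed

lemma poly_apply_smult:
  assumes "T (\<lambda>_. 0) = (\<lambda>_. 0)" "\<And>a c. T (\<lambda>n. c * a n) = (\<lambda>n. c * T a n)"
  shows "poly_apply T v (Polynomial.smult c q) = (\<lambda>n. c * poly_apply T v q n)"
proof (induction q)
  case 0
  show ?case by (simp add: poly_apply_0)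
next
  case (pCons a p)
  then show ?case
    by (simp add: poly_apply_pCons[of T, OF assms(1)] assms(2) algebra_simps)
qed

lemma poly_apply_in_subspace:
  assumes "T (\<lambda>_. 0) = (\<lambda>_. 0)" "seq_subspace U" "v \<in> U" "\<And>u. u \<in> U \<Longrightarrow> T u \<in> U"
  shows "poly_apply T v q \<in> U"
proof (induction q)
  case 0
  show ?case using seq_subspaceD(1)[OF assms(2)] by (simp add: poly_apply_0)
next
  case (pCons a p)
  have "(\<lambda>n. T (poly_apply T v p) n + a * v n) \<in> U"
    by (rule seq_subspace_lincomb(1)[OF assms(2) assms(4)[OF pCons(2)] assms(3)])
  then show ?case
    by (simp add: poly_apply_pCons[of T, OF assms(1)] add.commute)
qed

text \<open>What the algebra needs from the coefficients of cusp forms. \<open>t j\<close> stands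
  for j^(-2s), \<open>B\<close> for a number of initial coefficients that determine a form, and the
  quantity in \<open>t_factor\<close> is the numerator of the Euler factor of the square sum of an
  eigenform.\<close>

locale hecke_space =
  fixes S :: "(nat \<Rightarrow> complex) set" and k B :: nat and t :: "nat \<Rightarrow> complex"
  assumes subspace: "seq_subspace S"
    and hecke: "\<And>p a. prime p \<Longrightarrow> a \<in> S \<Longrightarrow> hecke_seq k p a \<in> S"
    and coprime_zero: "\<And>Q a. finite Q \<Longrightarrow> (\<And>p. p \<in> Q \<Longrightarrow> prime p) \<Longrightarrow> a \<in> S \<Longrightarrow>
          (\<And>n. (\<And>p. p \<in> Q \<Longrightarrow> \<not> p dvd n) \<Longrightarrow> a n = 0) \<Longrightarrow> a = (\<lambda>_. 0)"
    and initial_zero: "\<And>a. a \<in> S \<Longrightarrow> (\<And>n. n < B \<Longrightarrow> a n = 0) \<Longrightarrow> a = (\<lambda>_. 0)"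
    and coeff_0: "\<And>a. a \<in> S \<Longrightarrow> a 0 = 0"
    and t_mult: "\<And>m n. t (m * n) = t m * t n" and t_0: "t 0 = 0" and t_1: "t 1 = 1"
    and t_factor: "\<And>p. prime p \<Longrightarrow> 1 + of_nat p ^ (k - 1) * t p \<noteq> 0"
    and square_summable: "\<And>a m. a \<in> S \<Longrightarrow> m > 0 \<Longrightarrow> (\<lambda>j. norm (t j * a (m * j\<^sup>2))) summable_on UNIV"
begin

lemma pivots_bounded: "U \<subseteq> S \<Longrightarrow> pivots U \<subseteq> {..<B}"
proof
  fix n assume "U \<subseteq> S" "n \<in> pivots U"
  then obtain u where u: "u \<in> S" "u n \<noteq> 0" "\<forall>i<n. u i = 0" by (auto simp: pivots_def)
  show "n \<in> {..<B}"
  proof (rule ccontr)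
    assume "n \<notin> {..<B}"
    then have "u = (\<lambda>_. 0)" using u by (intro initial_zero) auto
    with u(2) show False by simp
  qed
qed

lemma finite_pivots: "U \<subseteq> S \<Longrightarrow> finite (pivots U)"
  using pivots_bounded finite_subset by blast

text \<open>Gaussian elimination from the left: the first disagreement between \<open>v\<close> and
  its approximation in \<open>U\<close> is at a pivot of \<open>V\<close>, hence of
  \<open>U\<close>, and can be corrected there. After \<open>B\<close> steps
  \<open>initial_zero\<close> makes the agreement exact.\<close>

lemma eq_if_pivots_eq:
  assumes "seq_subspace U" "seq_subspace V" "U \<subseteq> V" "V \<subseteq> S" "pivots V \<subseteq> pivots U"
  shows "U = V"
proof
  show "V \<subseteq> U"
  proof
    fix v assume v: "v \<in> V"
    have "\<exists>u\<in>U. \<forall>i<n. v i = u i" for n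
    proof (induction n)
      case 0
      show ?case using seq_subspaceD(1)[OF assms(1)] by auto
    next
      case (Suc n)
      then obtain u where u: "u \<in> U" "\<forall>i<n. v i = u i" by blast
      show ?case
      proof (cases "v n = u n")
        case True
        then show ?thesis using u less_Suc_eq by auto
      next
        case False
        have "(\<lambda>i. v i - 1 * u i) \<in> V"
          using seq_subspace_lincomb(2)[OF assms(2) v, of u 1] u(1) assms(3) by blast
        moreover have "v n - 1 * u n \<noteq> 0" "\<forall>i<n. v i - 1 * u i = 0"
          using False u(2) by simp_all
        ultimately have "n \<in> pivots V" unfolding pivots_def mem_Collect_eq
          by (intro bexI[where x = "\<lambda>i. v i - 1 * u i"] conjI)
        then obtain w where w: "w \<in> U" "w n \<noteq> 0" "\<forall>i<n. w i = 0"
          using assms(5) unfolding pivots_def by blast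
        have "(\<lambda>i. u i + ((v n - u n) / w n) * w i) \<in> U"
          by (rule seq_subspace_lincomb(1)[OF assms(1) u(1) w(1)])
        moreover have "\<forall>i<Suc n. v i = u i + ((v n - u n) / w n) * w i"
          using u(2) w(2,3) by (simp add: less_Suc_eq)
        ultimately show ?thesis
          by (intro bexI[where x = "\<lambda>i. u i + ((v n - u n) / w n) * w i"])
      qed
    qed
    then obtain u where u: "u \<in> U" "\<forall>i<B. v i = u i" by blast
    have "(\<lambda>i. v i - 1 * u i) \<in> V"
      using seq_subspace_lincomb(2)[OF assms(2) v, of u 1] u(1) assms(3) by blast
    then have "(\<lambda>i. v i - 1 * u i) \<in> S" using assms(4) by blast
    moreover have "v i - 1 * u i = 0" if "i < B" for i using u(2) that by simp
    ultimately have "(\<lambda>i. v i - 1 * u i) = (\<lambda>_. 0)" by (rule initial_zero)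
    then have "v i = u i" for i by (metis (lifting) eq_iff_diff_eq_0 mult_1)
    then have "v = u" by (rule ext)
    then show "v \<in> U" using u by simp
  qed
qed (rule assms(3))

definition square_sum :: "nat \<Rightarrow> (nat \<Rightarrow> complex) \<Rightarrow> complex" where
  "square_sum m a = (\<Sum>\<^sub>\<infinity>j. t j * a (m * j\<^sup>2))"

lemma square_summable': "a \<in> S \<Longrightarrow> m > 0 \<Longrightarrow> (\<lambda>j. t j * a (m * j\<^sup>2)) summable_on A"
  by (rule summable_on_subset_banach[OF abs_summable_summable[OF square_summable]]) auto

lemma square_sum_lincomb:
  assumes "a \<in> S" "b \<in> S" "m > 0"
  shows "square_sum m (\<lambda>n. a n + c * b n) = square_sum m a + c * square_sum m b"
proof -
  have "square_sum m (\<lambda>n. a n + c * b n) =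
      (\<Sum>\<^sub>\<infinity>j. t j * a (m * j\<^sup>2) + c * (t j * b (m * j\<^sup>2)))"
    by (simp add: square_sum_def algebra_simps)
  also have "\<dots> = square_sum m a + c * square_sum m b"
    unfolding square_sum_def infsum_add[OF square_summable'[OF assms(1,3)]
        summable_on_cmult_right[OF square_summable'[OF assms(2,3)]]] infsum_cmult_right' ..
  finally show ?thesis .
qed

lemma infsum_multiples:
  fixes g :: "nat \<Rightarrow> complex"
  assumes "p > 0"
  shows "(\<Sum>\<^sub>\<infinity>j. t j * (if p dvd j then g (j div p) else 0)) = t p * (\<Sum>\<^sub>\<infinity>j. t j * g j)"
proof -
  have inj: "inj_on (\<lambda>i. p * i) UNIV" using assms by (auto intro: inj_onI)
  have "(\<Sum>\<^sub>\<infinity>j. t j * (if p dvd j then g (j div p) else 0)) =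
      (\<Sum>\<^sub>\<infinity>j\<in>range (\<lambda>i. p * i). t j * g (j div p))"
  proof (rule infsum_cong_neutral)
    show "t j * (if p dvd j then g (j div p) else 0) = 0" if "j \<in> UNIV - range (\<lambda>i. p * i)" for j
      using that by (auto simp: dvd_def)
  qed auto
  also have "\<dots> = (\<Sum>\<^sub>\<infinity>i. t (p * i) * g i)"
    using assms by (subst infsum_reindex[OF inj]) (simp add: o_def)
  also have "\<dots> = (\<Sum>\<^sub>\<infinity>i. t p * (t i * g i))"
    by (simp add: t_mult mult.assoc)
  also have "\<dots> = t p * (\<Sum>\<^sub>\<infinity>j. t j * g j)" by (rule infsum_cmult_right')
  finally show ?thesis .
qed

text \<open>Since \<open>p\<close> does not divide \<open>m\<close>, it divides
  \<open>m * j\<^sup>2\<close> only for \<open>j = p * i\<close>, and then the quotient is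
  \<open>(m * p) * i\<^sup>2\<close>. So both terms of the Hecke operator run over the square class
  of \<open>m * p\<close>, the second with the extra factor \<open>t p\<close>.\<close>

lemma square_sum_hecke:
  assumes "prime p" "a \<in> S" "m > 0" "\<not> p dvd m"
  shows "square_sum m (hecke_seq k p a) = (1 + of_nat p ^ (k - 1) * t p) * square_sum (m * p) a"
proof -
  have pos: "p > 0" using assms prime_gt_0_nat by auto
  have dvd: "p dvd m * j\<^sup>2 \<longleftrightarrow> p dvd j" for j
    using assms by (auto simp: prime_dvd_mult_iff prime_dvd_power_iff)
  have eq: "t j * hecke_seq k p a (m * j\<^sup>2) = t j * a ((m * p) * j\<^sup>2) +
      of_nat p ^ (k - 1) * (t j * (if p dvd j then a ((m * p) * (j div p)\<^sup>2) else 0))" for j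
  proof (cases "p dvd j")
    case True
    then obtain i where i: "j = p * i" by auto
    have "m * (p * i)\<^sup>2 div p = m * p * i\<^sup>2" using pos by (simp add: power2_eq_square)
    moreover have "p * (m * (p * i)\<^sup>2) = (m * p) * (p*i)\<^sup>2" by simp
    ultimately show ?thesis using i pos dvd[of j] by (simp add: hecke_seq_def algebra_simps)
  qed (use dvd[of j] in \<open>simp add: hecke_seq_def algebra_simps\<close>)
  have s: "(\<lambda>j. t j * a ((m * p) * j\<^sup>2)) summable_on UNIV"
    using square_summable' assms pos by simp
  have s1: "(\<lambda>j. t j * hecke_seq k p a (m * j\<^sup>2)) summable_on UNIV"
    using square_summable' hecke assms by simp
  have s2: "(\<lambda>j. of_nat p ^ (k - 1) * (t j * (if p dvd j then a ((m * p) * (j div p)\<^sup>2) else 0))) summable_on UNIV"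
    using summable_on_add[OF s1 summable_on_uminus[THEN iffD2, OF s]] unfolding eq by simp
  have "square_sum m (hecke_seq k p a) = square_sum (m * p) a +
      of_nat p ^ (k - 1) * (\<Sum>\<^sub>\<infinity>j. t j * (if p dvd j then a ((m * p) * (j div p)\<^sup>2) else 0))"
    unfolding square_sum_def eq infsum_add[OF s s2] infsum_cmult_right' ..
  also have "\<dots> = (1 + of_nat p ^ (k - 1) * t p) * square_sum (m * p) a"
    unfolding infsum_multiples[OF pos, of "\<lambda>i. a ((m * p) * i\<^sup>2)"] square_sum_def
    by (simp only: distrib_right mult_1 mult.assoc)
  finally show ?thesis .
qed

text \<open>The spaces of all q(T) v with \<open>degree q \<le> d\<close> increase with
  \<open>d\<close> but have at most \<open>B\<close> pivots. Once two consecutive ones agree,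
  T^(d+1) v is a combination of lower powers.\<close>

lemma annihilating_poly_exists:
  assumes T0: "T (\<lambda>_. 0) = (\<lambda>_. 0)"
    and add: "\<And>a b. T (\<lambda>n. a n + b n) = (\<lambda>n. T a n + T b n)"
    and smult: "\<And>a c. T (\<lambda>n. c * a n) = (\<lambda>n. c * T a n)"
    and U: "seq_subspace U" "U \<subseteq> S" "\<And>u. u \<in> U \<Longrightarrow> T u \<in> U" and v: "v \<in> U"
  shows "\<exists>q. q \<noteq> 0 \<and> poly_apply T v q = (\<lambda>_. 0)"
proof -
  define W where "W = (\<lambda>d. {poly_apply T v q |q. degree q \<le> d})"
  have W_S: "W d \<subseteq> S" for d
    using poly_apply_in_subspace[of T, OF T0 U(1) v U(3)] U(2) by (auto simp: W_def)
  have mono: "W d \<subseteq> W (Suc d)" for d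
    unfolding W_def by (auto intro: le_SucI)
  have W_sub: "seq_subspace (W d)" for d
    unfolding seq_subspace_def
  proof (intro conjI ballI allI)
    show "(\<lambda>_. 0) \<in> W d"
      unfolding W_def mem_Collect_eq by (intro exI[of _ 0]) (simp add: poly_apply_0)
    fix a assume "a \<in> W d"
    then obtain q where q: "a = poly_apply T v q" "degree q \<le> d" by (auto simp: W_def)
    show "(\<lambda>n. c * a n) \<in> W d" for c
      unfolding W_def mem_Collect_eq
      using q poly_apply_smult[of T, OF T0 smult, of v c q]
      by (intro exI[of _ "Polynomial.smult c q"]) (auto intro: order.trans[OF degree_smult_le])
    fix b assume "b \<in> W d"
    then obtain r where r: "b = poly_apply T v r" "degree r \<le> d" by (auto simp: W_def)
    show "(\<lambda>n. a n + b n) \<in> W d"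
      unfolding W_def mem_Collect_eq
      using q r poly_apply_add[of T, OF T0 add, of v q r]
      by (intro exI[of _ "q + r"]) (auto intro: degree_add_le)
  qed
  have "\<exists>d. W d = W (Suc d)"
  proof (rule ccontr)
    assume neq: "\<nexists>d. W d = W (Suc d)"
    have "card (pivots (W d)) \<ge> d" for d
    proof (induction d)
      case (Suc d)
      have "\<not> pivots (W (Suc d)) \<subseteq> pivots (W d)"
        using neq eq_if_pivots_eq[OF W_sub W_sub mono W_S] by blast
      then have "pivots (W d) \<subset> pivots (W (Suc d))" using pivots_mono[OF mono] by blast
      then have "card (pivots (W d)) < card (pivots (W (Suc d)))"
        by (rule psubset_card_mono[OF finite_pivots[OF W_S]])
      with Suc show ?case by simp
    qed simp
    moreover have "card (pivots (W d)) \<le> B" for d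
      using card_mono[OF _ pivots_bounded[OF W_S]] by simp
    ultimately show False by (meson Suc_n_not_le_n order_trans)
  qed
  then obtain d where d: "W d = W (Suc d)" ..
  have "poly_apply T v (Polynomial.monom 1 (Suc d)) \<in> W (Suc d)"
    unfolding W_def mem_Collect_eq by (intro exI[of _ "Polynomial.monom 1 (Suc d)"]) (simp add: degree_monom_le)
  then obtain q where q: "poly_apply T v (Polynomial.monom 1 (Suc d)) = poly_apply T v q" "degree q \<le> d"
    unfolding d[symmetric] by (auto simp: W_def)
  have "poly_apply T v (Polynomial.monom 1 (Suc d) + Polynomial.smult (- 1) q) = (\<lambda>_. 0)"
    using q(1) by (simp only: poly_apply_add[of T, OF T0 add] poly_apply_smult[of T, OF T0 smult]) simp
  moreover have "Polynomial.monom 1 (Suc d) + Polynomial.smult (- 1) q \<noteq> 0"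
  proof
    assume "Polynomial.monom 1 (Suc d) + Polynomial.smult (- 1) q = 0"
    then have "Polynomial.coeff (Polynomial.monom 1 (Suc d) + Polynomial.smult (- 1) q) (Suc d) = 0" by simp
    moreover have "Polynomial.coeff q (Suc d) = 0" using q(2) by (intro coeff_eq_0) simp
    ultimately show False by simp
  qed
  ultimately show ?thesis by blast
qed

text \<open>Split a root \<open>z\<close> off a nonzero annihilating polynomial of least degree: the
  cofactor \<open>r\<close> does not annihilate \<open>v\<close>, so r(T) v is an eigenvector for
  \<open>z\<close>.\<close>

lemma eigenvector_exists:
  assumes T0: "T (\<lambda>_. 0) = (\<lambda>_. 0)"
    and add: "\<And>a b. T (\<lambda>n. a n + b n) = (\<lambda>n. T a n + T b n)"
    and smult: "\<And>a c. T (\<lambda>n. c * a n) = (\<lambda>n. c * T a n)"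
    and U: "seq_subspace U" "U \<subseteq> S" "\<And>u. u \<in> U \<Longrightarrow> T u \<in> U" and v: "v \<in> U" "v \<noteq> (\<lambda>_. 0)"
  shows "\<exists>u\<in>U. \<exists>c. u \<noteq> (\<lambda>_. 0) \<and> T u = (\<lambda>n. c * u n)"
proof -
  let ?P = "\<lambda>q. q \<noteq> 0 \<and> poly_apply T v q = (\<lambda>_. 0)"
  obtain q0 where "?P q0" using annihilating_poly_exists[of T, OF T0 add smult U v(1)] by blast
  then obtain q where q: "?P q" and min: "\<And>r. ?P r \<Longrightarrow> degree q \<le> degree r"
    using ex_has_least_nat[of ?P q0 degree] by blast
  have "degree q \<noteq> 0"
  proof
    assume "degree q = 0"
    then obtain c where c: "q = [:c:]" by (rule degree_eq_zeroE)
    have "poly_apply T v q = (\<lambda>n. c * v n)"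
      by (simp add: c poly_apply_pCons[of T, OF T0] poly_apply_0 T0)
    with q have "(\<lambda>n. c * v n) = (\<lambda>_. 0)" by simp
    moreover obtain n where "v n \<noteq> 0" using v(2) by auto
    ultimately have "c = 0" by (metis mult_eq_0_iff)
    with c q show False by simp
  qed
  then have "\<not> (\<exists>a l. a \<noteq> 0 \<and> l = 0 \<and> q = pCons a l)" by auto
  then obtain z where "poly q z = 0" using fundamental_theorem_of_algebra_alt by blast
  then obtain r where r: "q = [:- z, 1:] * r" by (auto simp: poly_eq_0_iff_dvd elim: dvdE)
  have "r \<noteq> 0" using q r by auto
  then have "degree r < degree q" unfolding r by (subst degree_mult_eq) auto
  then have ne: "poly_apply T v r \<noteq> (\<lambda>_. 0)" using min[of r] \<open>r \<noteq> 0\<close> by linarith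
  have "q = pCons 0 r + Polynomial.smult (- z) r" by (simp add: r)
  then have "poly_apply T v q = (\<lambda>n. T (poly_apply T v r) n - z * poly_apply T v r n)"
    by (simp only: poly_apply_add[of T, OF T0 add] poly_apply_smult[of T, OF T0 smult] poly_apply_pCons[of T, OF T0]) simp
  with q have "T (poly_apply T v r) n = z * poly_apply T v r n" for n
    by (metis (lifting) eq_iff_diff_eq_0)
  moreover have "poly_apply T v r \<in> U" by (rule poly_apply_in_subspace[of T, OF T0 U(1) v(1) U(3)])
  ultimately show ?thesis using ne by blast
qed

section \<open>The spaces V_Q and their common eigenvectors\<close>

definition vanishing :: "nat set \<Rightarrow> (nat \<Rightarrow> complex) set" where
  "vanishing Q = {a \<in> S. \<forall>m. squarefree m \<longrightarrow> (\<forall>p\<in>Q. \<not> p dvd m) \<longrightarrow> square_sum m a = 0}"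

lemma square_sum_0: "square_sum m (\<lambda>_. 0) = 0"
  by (simp add: square_sum_def)

lemma subspace_vanishing: "seq_subspace (vanishing Q)"
  unfolding seq_subspace_def
proof (intro conjI ballI allI)
  show "(\<lambda>_. 0) \<in> vanishing Q"
    using seq_subspaceD(1)[OF subspace] by (simp add: vanishing_def square_sum_0)
  fix a assume a: "a \<in> vanishing Q"
  have *: "(\<lambda>n. x n + c * y n) \<in> vanishing Q" if "x \<in> vanishing Q" "y \<in> vanishing Q" for x y c
    using that seq_subspace_lincomb(1)[OF subspace, of x y c]
    by (simp add: vanishing_def square_sum_lincomb squarefree_nat_pos)
  show "(\<lambda>n. a n + b n) \<in> vanishing Q" if "b \<in> vanishing Q" for b
    using *[OF a that, of 1] by simp
  show "(\<lambda>n. c * a n) \<in> vanishing Q" for c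
    using *[OF \<open>(\<lambda>_. 0) \<in> vanishing Q\<close> a, of c] by simp
qed

lemma vanishing_mono: "Q \<subseteq> R \<Longrightarrow> vanishing Q \<subseteq> vanishing R"
  unfolding vanishing_def by blast

lemma vanishing_subset: "vanishing Q \<subseteq> S"
  by (auto simp: vanishing_def)

text \<open>\<open>Q\<close> is chosen with the most pivots, so that adding a prime changes nothing.
  By \<open>square_sum_hecke\<close> the operator at \<open>p\<close> leads from \<open>Q\<close> to
  \<open>insert p Q\<close>: the index \<open>m\<close> becomes \<open>m * p\<close>, still
  squarefree and free of primes of \<open>Q\<close>.\<close>

lemma vanishing_stabilizes:
  obtains Q where "finite Q" "\<And>p. p \<in> Q \<Longrightarrow> prime p"
    "\<And>p a. prime p \<Longrightarrow> p \<notin> Q \<Longrightarrow> a \<in> vanishing Q \<Longrightarrow> hecke_seq k p a \<in> vanishing Q"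
proof -
  let ?P = "\<lambda>Q. finite Q \<and> (\<forall>p\<in>Q. prime (p::nat))"
  let ?c = "\<lambda>Q. card (pivots (vanishing Q))"
  have "?P {}" by simp
  moreover have "\<forall>Q. ?P Q \<longrightarrow> ?c Q < Suc B"
    using card_mono[OF _ pivots_bounded[OF vanishing_subset]] by (auto simp: less_Suc_eq_le)
  ultimately obtain Q where Q: "?P Q" and max: "\<forall>R. ?P R \<longrightarrow> ?c R \<le> ?c Q"
    using ex_has_greatest_nat[of ?P "{}" ?c "Suc B"] by (metis (no_types, lifting))
  have eq: "vanishing (insert p Q) = vanishing Q" if "prime p" for p
  proof -
    have sub: "vanishing Q \<subseteq> vanishing (insert p Q)" by (rule vanishing_mono) auto
    have "?c (insert p Q) \<le> ?c Q" using max Q that by simp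
    with pivots_mono[OF sub] have "pivots (vanishing Q) = pivots (vanishing (insert p Q))"
      by (intro card_seteq finite_pivots vanishing_subset)
    then show ?thesis
      using eq_if_pivots_eq[OF subspace_vanishing subspace_vanishing sub vanishing_subset] by simp
  qed
  show ?thesis
  proof
    fix p a assume p: "prime p" "p \<notin> Q" and a: "a \<in> vanishing Q"
    have aS: "a \<in> S" using a vanishing_subset by blast
    have "square_sum m (hecke_seq k p a) = 0"
      if m: "squarefree m" "\<forall>q\<in>insert p Q. \<not> q dvd m" for m
    proof -
      have "coprime m p" using m(2) p prime_imp_coprime[of p m] by (simp add: coprime_commute)
      then have "squarefree (m * p)"
        using m(1) p by (simp add: squarefree_mult_coprime squarefree_prime)
      moreover have "\<forall>q\<in>Q. \<not> q dvd m * p"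
        using m(2) p Q by (metis insertCI prime_dvd_mult_iff primes_dvd_imp_eq)
      ultimately have "square_sum (m * p) a = 0" using a by (simp add: vanishing_def)
      then show ?thesis
        using square_sum_hecke[OF p(1) aS, of m] m by (simp add: squarefree_nat_pos)
    qed
    then have "hecke_seq k p a \<in> vanishing (insert p Q)"
      unfolding vanishing_def mem_Collect_eq using hecke[OF p(1) aS] by blast
    then show "hecke_seq k p a \<in> vanishing Q" using eq p by simp
  qed (use Q in auto)
qed

definition hecke_stable :: "nat set \<Rightarrow> (nat \<Rightarrow> complex) set \<Rightarrow> bool" where
  "hecke_stable Q U \<longleftrightarrow> seq_subspace U \<and> U \<subseteq> S \<and>
     (\<forall>p a. prime p \<longrightarrow> p \<notin> Q \<longrightarrow> a \<in> U \<longrightarrow> hecke_seq k p a \<in> U)"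

text \<open>On a minimal stable subspace every Hecke operator is scalar, since its eigenspaces are stable.\<close>
lemma simultaneous_eigenvector_exists:
  assumes V: "hecke_stable Q V" and v: "v \<in> V" "v \<noteq> (\<lambda>_. 0)"
  shows "\<exists>u\<in>V. u \<noteq> (\<lambda>_. 0) \<and> (\<exists>l. \<forall>p. prime p \<longrightarrow> p \<notin> Q \<longrightarrow> hecke_seq k p u = (\<lambda>n. l p * u n))"
proof -
  let ?P = "\<lambda>U. hecke_stable Q U \<and> U \<subseteq> V \<and> (\<exists>u\<in>U. u \<noteq> (\<lambda>_. 0))"
  let ?c = "\<lambda>U. card (pivots U)"
  have "?P V" using V v by blast
  \<comment> \<open>Minimality is measured by the number of pivots; \<open>eq_if_pivots_eq\<close>
    turns equality of pivots into equality of spaces.\<close>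
  then obtain U where U: "?P U" and min: "\<forall>W. ?P W \<longrightarrow> ?c U \<le> ?c W"
    using ex_has_least_nat[of ?P V ?c, OF \<open>?P V\<close>] by (elim exE conjE) (rule that, simp_all)
  have U_sub: "seq_subspace U" and U_S: "U \<subseteq> S"
    and U_hecke: "\<And>p a. prime p \<Longrightarrow> p \<notin> Q \<Longrightarrow> a \<in> U \<Longrightarrow> hecke_seq k p a \<in> U"
    using U unfolding hecke_stable_def by blast+
  obtain u where u: "u \<in> U" "u \<noteq> (\<lambda>_. 0)" using U by blast
  have "\<exists>c. hecke_seq k p u = (\<lambda>n. c * u n)" if p: "prime p" "p \<notin> Q" for p
  proof -
    obtain w c where w: "w \<in> U" "w \<noteq> (\<lambda>_. 0)" "hecke_seq k p w = (\<lambda>n. c * w n)"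
      using eigenvector_exists[of "hecke_seq k p" U u, OF hecke_seq_linear(4,1,3) U_sub U_S _ u] U_hecke[OF p]
      by blast
    define W where "W = {w \<in> U. hecke_seq k p w = (\<lambda>n. c * w n)}"
    have W_U: "W \<subseteq> U" by (auto simp: W_def)
    have W_sub: "seq_subspace W"
      unfolding seq_subspace_def
    proof (intro conjI ballI allI)
      show "(\<lambda>_. 0) \<in> W"
        using seq_subspaceD(1)[OF U_sub] by (simp add: W_def hecke_seq_linear(4))
      fix a assume a: "a \<in> W"
      show "(\<lambda>n. d * a n) \<in> W" for d
        using seq_subspaceD(3)[OF U_sub, of a d] a by (simp add: W_def hecke_seq_linear(3) mult.left_commute)
      show "(\<lambda>n. a n + b n) \<in> W" if "b \<in> W" for b
        using seq_subspaceD(2)[OF U_sub, of a b] a that by (simp add: W_def hecke_seq_linear(1) distrib_left)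
    qed
    moreover have "hecke_seq k q a \<in> W" if "prime q" "q \<notin> Q" "a \<in> W" for q a
    proof -
      have "hecke_seq k p (hecke_seq k q a) = hecke_seq k q (\<lambda>n. c * a n)"
        using that by (simp add: hecke_seq_commute[OF p(1)] W_def)
      then show ?thesis using that U_hecke by (simp add: W_def hecke_seq_linear(3))
    qed
    ultimately have "hecke_stable Q W" using W_U U_S unfolding hecke_stable_def by blast
    moreover have "w \<in> W" using w by (simp add: W_def)
    ultimately have "?P W" using w(2) W_U U by blast
    with min have "?c U \<le> ?c W" by blast
    then have "pivots W = pivots U"
      by (intro card_seteq finite_pivots U_S pivots_mono W_U)
    then have "W = U" using eq_if_pivots_eq[OF W_sub U_sub W_U U_S] by simp
    then show ?thesis using u by (auto simp: W_def)
  qed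
  then have "\<forall>p. \<exists>c. prime p \<longrightarrow> p \<notin> Q \<longrightarrow> hecke_seq k p u = (\<lambda>n. c * u n)" by blast
  from choice[OF this] show ?thesis using u U by blast
qed

text \<open>The eigenvalue relation computes \<open>w (p * m)\<close> from \<open>w m\<close> and
  \<open>w (m div p)\<close>, so every coefficient free of primes of \<open>Q\<close> is a multiple
  of \<open>w 1 = 0\<close>, and \<open>coprime_zero\<close> finishes.\<close>

lemma eigenvector_zero:
  assumes Q: "finite Q" "\<And>p. p \<in> Q \<Longrightarrow> prime p" and w: "w \<in> S" "w 1 = 0"
    and eig: "\<And>p. prime p \<Longrightarrow> p \<notin> Q \<Longrightarrow> hecke_seq k p w = (\<lambda>n. l p * w n)"
  shows "w = (\<lambda>_. 0)"
proof (rule coprime_zero[OF Q w(1)])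
  show "w n = 0" if "\<And>p. p \<in> Q \<Longrightarrow> \<not> p dvd n" for n
    using that
  proof (induction n rule: less_induct)
    case (less n)
    show ?case
    proof (cases "n \<le> 1")
      case True
      then show ?thesis using coeff_0[OF w(1)] w(2) by (cases n) auto
    next
      case False
      then obtain p where p: "prime p" "p dvd n" using prime_factor_nat[of n] by auto
      then obtain m where m: "n = p * m" by auto
      have pQ: "p \<notin> Q" using less.prems p by blast
      have "m > 0" using False m by (cases m) auto
      then have "m < n" using p m prime_gt_1_nat[of p] by simp
      have "w m = 0"
      proof (rule less.IH[OF \<open>m < n\<close>])
        show "\<not> q dvd m" if "q \<in> Q" for q using less.prems[OF that] m by (metis dvd_mult)
      qed
      moreover have "w (m div p) = 0" if "p dvd m"
      proof (rule less.IH)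
        show "m div p < n" using \<open>m < n\<close> by (meson div_le_dividend le_less_trans)
        show "\<not> q dvd m div p" if "q \<in> Q" for q
          using less.prems[OF that] \<open>p dvd m\<close> m by (metis dvd_mult dvd_mult_div_cancel)
      qed
      moreover have "hecke_seq k p w m = l p * w m" using eig[OF p(1) pQ] by simp
      ultimately show ?thesis by (auto simp: hecke_seq_def m split: if_splits)
    qed
  qed
qed

text \<open>The Hecke operators at the primes of \<open>Q\<close> preserve the eigenspace, and by
  \<open>eigenvector_zero\<close> that space is one-dimensional.\<close>
lemma full_eigenvector:
  assumes Q: "finite Q" "\<And>p. p \<in> Q \<Longrightarrow> prime p" and u: "u \<in> S" "u 1 = 1"
    and eig: "\<And>p. prime p \<Longrightarrow> p \<notin> Q \<Longrightarrow> hecke_seq k p u = (\<lambda>n. l p * u n)"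
    and p: "prime p"
  shows "hecke_seq k p u = (\<lambda>n. u p * u n)"
proof -
  \<comment> \<open>At index 1 the second term of the operator is absent, so the only possible
    eigenvalue is \<open>u p\<close>, and the difference \<open>w\<close> has first coefficient
    0.\<close>
  have val: "hecke_seq k p u 1 = u p"
    using prime_gt_1_nat[OF p] u(2) by (simp add: hecke_seq_def)
  define w where "w = (\<lambda>n. hecke_seq k p u n - u p * u n)"
  have "w = (\<lambda>_. 0)"
  proof (rule eigenvector_zero[OF Q])
    show "w \<in> S" unfolding w_def
      by (rule seq_subspace_lincomb(2)[OF subspace hecke[OF p u(1)] u(1)])
    show "w 1 = 0" using u(2) unfolding w_def val by simp
    fix q assume q: "prime q" "q \<notin> Q"
    have "hecke_seq k q (hecke_seq k p u) = hecke_seq k p (\<lambda>n. l q * u n)"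
      by (simp add: hecke_seq_commute[OF q(1) p] eig[OF q])
    then show "hecke_seq k q w = (\<lambda>n. l q * w n)"
      unfolding w_def hecke_seq_linear(2,3) eig[OF q] by (simp add: right_diff_distrib mult.left_commute)
  qed
  then show ?thesis by (auto simp: w_def fun_eq_iff)
qed

text \<open>Multiplying the sum over \<open>j\<close> coprime to \<open>Q\<close> by the inverse Euler factor at \<open>p\<close>
  restricts it to \<open>j\<close> coprime to \<open>p\<close> as well.\<close>
lemma sieved_sum_zero:
  assumes u: "u \<in> S" and eig: "hecke_seq k p u = (\<lambda>n. l * u n)"
    and Q: "\<And>q. q \<in> Q \<Longrightarrow> prime q" and p: "prime p" "p \<notin> Q"
    and zero: "(\<Sum>\<^sub>\<infinity>j. t j * (if \<forall>q\<in>Q. \<not> q dvd j then u (j\<^sup>2) else 0)) = 0"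
  shows "(\<Sum>\<^sub>\<infinity>j. t j * (if \<forall>q\<in>insert p Q. \<not> q dvd j then u (j\<^sup>2) else 0)) = 0"
proof -
  define P :: complex where "P = of_nat p ^ (k - 1)"
  define g where "g = (\<lambda>j. if \<forall>q\<in>Q. \<not> q dvd j then u (j\<^sup>2) else 0)"
  define h where "h = (\<lambda>j. if \<forall>q\<in>insert p Q. \<not> q dvd j then u (j\<^sup>2) else 0)"
  define sh where "sh = (\<lambda>(g :: nat \<Rightarrow> complex) j. if p dvd j then g (j div p) else 0)"
  have pos: "p > 0" using p prime_gt_0_nat by auto
  have rec: "u (p * n) = l * u n - P * (if p dvd n then u (n div p) else 0)" for n
    using fun_cong[OF eig, of n] by (simp add: hecke_seq_def P_def algebra_simps)
  \<comment> \<open>To be used with \<open>A\<close>, \<open>B\<close>, \<open>X\<close>,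
    \<open>Y\<close> the coefficients at m^2, p m^2, p^2 m^2 and p^3 m^2; then
    \<open>l * Y - P * X\<close> is the one at p^4 m^2.\<close>
  have euler_identity: "l * Y - P * X + (2 * P - l\<^sup>2) * X + P\<^sup>2 * A = 0"
    if "X = l * B - P * A" "Y = l * X - P * B" for X Y A B
    unfolding that by (simp add: power2_eq_square algebra_simps)
  have dvd_Q: "(\<forall>q\<in>Q. \<not> q dvd p * i) \<longleftrightarrow> (\<forall>q\<in>Q. \<not> q dvd i)" for i
    using Q p by (metis prime_dvd_mult_iff primes_dvd_imp_eq)
  have sh_mult: "sh f (p * i) = f i" for f i using pos by (simp add: sh_def)
  \<comment> \<open>The local identity sum u(p^(2i)) x^i = (1 + P x) / (1 - (l^2 - 2P) x + P^2 x^2),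
    cleared of its denominator, with the shift \<open>sh\<close> in the role of multiplication by
    x.\<close>
  have pt: "g j + (2 * P - l\<^sup>2) * sh g j + P\<^sup>2 * sh (sh g) j = h j + P * sh h j" for j
  proof (cases "p dvd j")
    case False
    then show ?thesis by (simp add: sh_def g_def h_def)
  next
    case True
    then obtain i where i: "j = p * i" by auto
    have gj: "g j = (if \<forall>q\<in>Q. \<not> q dvd i then u ((p * i)\<^sup>2) else 0)"
      by (simp only: g_def i dvd_Q)
    define C where "C \<longleftrightarrow> (\<forall>q\<in>Q. \<not> q dvd i)"
    have hj: "h j = 0" by (simp add: h_def i)
    have sq: "(p * i)\<^sup>2 = p * (p * i\<^sup>2)" by (simp add: power2_eq_square)
    have up: "u ((p * i)\<^sup>2) = l * u (p * i\<^sup>2) - P * u (i\<^sup>2)"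
      unfolding sq rec[of "p * i\<^sup>2"] using pos by simp
    show ?thesis
    proof (cases "p dvd i")
      case False
      then have "\<not> p dvd i\<^sup>2" using p(1) prime_dvd_power by blast
      then have "u (p * i\<^sup>2) = l * u (i\<^sup>2)" by (simp add: rec)
      moreover have "sh (sh g) j = 0" using False by (simp add: i sh_mult) (simp add: sh_def)
      moreover have "h i = g i" using False by (simp add: h_def g_def)
      moreover have "g i = (if \<forall>q\<in>Q. \<not> q dvd i then u (i\<^sup>2) else 0)" by (simp add: g_def)
      moreover have "sh g j = g i" "sh h j = h i" by (simp_all add: i sh_mult)
      ultimately show ?thesis
        unfolding gj hj up C_def[symmetric] by (cases C) (simp_all add: power2_eq_square left_diff_distrib)
    next
      case True
      then obtain m where m: "i = p * m" by auto
      have "u (i\<^sup>2) = l * u (p * m\<^sup>2) - P * u (m\<^sup>2)"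
        unfolding m power_mult_distrib using rec[of "p * m\<^sup>2"] pos by (simp add: power2_eq_square mult.assoc)
      moreover have "u (p * i\<^sup>2) = l * u (i\<^sup>2) - P * u (p * m\<^sup>2)"
        unfolding m power_mult_distrib using rec[of "p\<^sup>2 * m\<^sup>2"] pos by (simp add: power2_eq_square mult.assoc)
      ultimately have "u ((p * i)\<^sup>2) + (2 * P - l\<^sup>2) * u (i\<^sup>2) + P\<^sup>2 * u (m\<^sup>2) = 0"
        unfolding up by (rule euler_identity)
      moreover have "g i = (if \<forall>q\<in>Q. \<not> q dvd i then u (i\<^sup>2) else 0)" by (simp add: g_def)
      moreover have "g m = (if \<forall>q\<in>Q. \<not> q dvd i then u (m\<^sup>2) else 0)"
        by (simp only: g_def m dvd_Q)
      moreover have "h i = 0" by (simp add: h_def m)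
      moreover have "sh g j = g i" "sh (sh g) j = g m" "sh h j = h i" by (simp_all add: i sh_mult) (simp add: m sh_mult)
      ultimately show ?thesis unfolding gj hj C_def[symmetric] by (cases C) simp_all
    qed
  qed
  have sum_sh: "(\<Sum>\<^sub>\<infinity>j. t j * sh f j) = t p * (\<Sum>\<^sub>\<infinity>j. t j * f j)" for f
    unfolding sh_def by (rule infsum_multiples[OF pos])
  have summ: "(\<lambda>j. t j * (if c j then u (j\<^sup>2) else 0)) summable_on UNIV" for c
  proof -
    have "(\<lambda>j. t j * u (1 * j\<^sup>2)) summable_on {j. c j}" by (rule square_summable'[OF u]) simp
    then show ?thesis by (rule summable_on_cong_neutral[THEN iffD1, rotated -1]) auto
  qed
  have summ_g: "(\<lambda>j. t j * g j) summable_on UNIV" and summ_h: "(\<lambda>j. t j * h j) summable_on UNIV"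
    unfolding g_def h_def by (rule summ)+
  have summ_sh: "(\<lambda>j. t j * sh f j) summable_on UNIV" if "(\<lambda>j. t j * f j) summable_on UNIV" for f
  proof -
    have inj: "inj_on (\<lambda>i. p * i) UNIV" using pos by (auto intro: inj_onI)
    have "(\<lambda>i. t p * (t i * f i)) summable_on UNIV" by (rule summable_on_cmult_right[OF that])
    then have "(\<lambda>j. t j * sh f j) summable_on range (\<lambda>i. p * i)"
      by (subst summable_on_reindex[OF inj]) (simp add: o_def t_mult sh_mult mult.assoc)
    then show ?thesis
      by (rule summable_on_cong_neutral[THEN iffD1, rotated -1]) (auto simp: sh_def dvd_def)
  qed
  let ?G = "\<Sum>\<^sub>\<infinity>j. t j * g j" and ?H = "\<Sum>\<^sub>\<infinity>j. t j * h j"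
  have "(\<Sum>\<^sub>\<infinity>j. t j * g j + (2 * P - l\<^sup>2) * (t j * sh g j) + P\<^sup>2 * (t j * sh (sh g) j)) =
      (\<Sum>\<^sub>\<infinity>j. t j * h j + P * (t j * sh h j))"
  proof (rule infsum_cong)
    fix j
    have "t j * g j + (2 * P - l\<^sup>2) * (t j * sh g j) + P\<^sup>2 * (t j * sh (sh g) j) =
        t j * (g j + (2 * P - l\<^sup>2) * sh g j + P\<^sup>2 * sh (sh g) j)"
      by (simp only: distrib_left mult.left_commute)
    then show "t j * g j + (2 * P - l\<^sup>2) * (t j * sh g j) + P\<^sup>2 * (t j * sh (sh g) j) =
        t j * h j + P * (t j * sh h j)" unfolding pt by (simp only: distrib_left mult.left_commute)
  qed
  moreover have "(\<Sum>\<^sub>\<infinity>j. t j * g j + (2 * P - l\<^sup>2) * (t j * sh g j) + P\<^sup>2 * (t j * sh (sh g) j)) =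
      ?G + (2 * P - l\<^sup>2) * (t p * ?G) + P\<^sup>2 * (t p * (t p * ?G))"
    by (simp only: infsum_add summable_on_add summ_g summ_sh summable_on_cmult_right infsum_cmult_right' sum_sh)
  moreover have "(\<Sum>\<^sub>\<infinity>j. t j * h j + P * (t j * sh h j)) = (1 + P * t p) * ?H"
    by (simp only: infsum_add summ_h summ_sh summable_on_cmult_right infsum_cmult_right' sum_sh distrib_right mult_1 mult.assoc)
  moreover have "?G = 0" using zero unfolding g_def .
  ultimately have "(1 + P * t p) * ?H = 0" by simp
  moreover have "1 + P * t p \<noteq> 0" using t_factor[OF p(1)] by (simp add: P_def)
  ultimately show ?thesis unfolding h_def by simp
qed

text \<open>If the sum were 0, sieving by all primes up to \<open>N\<close> would keep it 0; but the
  sieved sum is the term 1 at \<open>j = 1\<close> plus a tail beyond \<open>N\<close> of norm at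
  most 1/2. Thus finitely many Euler factors at a time suffice.\<close>

lemma eigenform_square_sum_nonzero:
  assumes u: "u \<in> S" "u 1 = 1" and eig: "\<And>p. prime p \<Longrightarrow> hecke_seq k p u = (\<lambda>n. u p * u n)"
  shows "square_sum 1 u \<noteq> 0"
proof
  assume zero: "square_sum 1 u = 0"
  define \<Phi> where "\<Phi> = (\<lambda>Q. \<Sum>\<^sub>\<infinity>j. t j * (if \<forall>q\<in>Q. \<not> q dvd j then u (j\<^sup>2) else 0))"
  have \<Phi>_zero: "\<Phi> Q = 0" if "finite Q" "\<forall>q\<in>Q. prime q" for Q
    using that
  proof (induction Q rule: finite_induct)
    case empty
    then show ?case using zero by (simp add: \<Phi>_def square_sum_def)
  next
    case (insert p Q)
    then show ?case
      unfolding \<Phi>_def by (intro sieved_sum_zero[OF u(1) eig]) auto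
  qed
  define g where "g = (\<lambda>j. norm (t j * u (j\<^sup>2)))"
  have g: "g summable_on UNIV" using square_summable[OF u(1), of 1] by (simp add: g_def)
  obtain F where F: "finite F" "dist (sum g F) (infsum g UNIV) \<le> 1 / 2"
    using infsum_finite_approximation[OF g, of "1/2"] by auto
  \<comment> \<open>\<open>Suc\<close> ensures \<open>1 \<le> N\<close>, so that the term at
    \<open>j = 1\<close> lies in the head; \<open>insert 0\<close> covers an empty
    \<open>F\<close>.\<close>
  define N where "N = Suc (Max (insert 0 F))"
  have FN: "F \<subseteq> {..N}" using F(1) by (auto simp: N_def intro!: le_SucI)
  have summ: "g summable_on A" for A using g by (rule summable_on_subset_banach) simp
  have UNIV_split: "(UNIV :: nat set) = {..N} \<union> {N<..}" "{..N} \<inter> {N<..} = {}" by auto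
  have "infsum g UNIV = sum g {..N} + infsum g {N<..}"
    unfolding UNIV_split(1) infsum_Un_disjoint[OF summ summ UNIV_split(2)] by simp
  moreover have "sum g F \<le> sum g {..N}" by (rule sum_mono2) (use FN in \<open>auto simp: g_def\<close>)
  ultimately have tail: "infsum g {N<..} \<le> 1 / 2" using abs_le_D2[OF F(2)[unfolded dist_real_def]] by linarith
  define Q where "Q = {q. prime q \<and> q \<le> N}"
  define h where "h = (\<lambda>j. t j * (if \<forall>q\<in>Q. \<not> q dvd j then u (j\<^sup>2) else 0))"
  have h_g: "norm (h j) \<le> g j" for j by (simp add: h_def g_def)
  have norm_h: "(\<lambda>j. norm (h j)) summable_on A" for A
    by (rule summable_on_comparison_test[OF summ]) (use h_g in auto)
  have summ_h: "h summable_on A" for A by (rule abs_summable_summable[OF norm_h])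
  have h_small: "h j = 0" if j: "j \<le> N" "j \<noteq> 1" for j
  proof (cases "j = 0")
    case True
    then show ?thesis by (simp add: h_def t_0)
  next
    case False
    then obtain p where p: "prime p" "p dvd j" using prime_factor_nat[OF j(2)] by blast
    then have "p \<le> N" using dvd_imp_le[of p j] False j(1) by simp
    then have "p \<in> Q" using p by (simp add: Q_def)
    then show ?thesis using p by (auto simp: h_def)
  qed
  have h1: "h 1 = 1"
    using u(2) t_1 by (auto simp: h_def Q_def)
  have "sum h {..N} = sum h {1}"
    by (rule sum.mono_neutral_right) (use h_small in \<open>auto simp: N_def\<close>)
  then have "sum h {..N} = 1" using h1 by simp
  moreover have "infsum h UNIV = sum h {..N} + infsum h {N<..}"
    unfolding UNIV_split(1) infsum_Un_disjoint[OF summ_h summ_h UNIV_split(2)] by simp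
  moreover have "infsum h UNIV = 0"
  proof -
    have "finite Q" unfolding Q_def by (rule finite_subset[of _ "{..N}"]) auto
    then have "\<Phi> Q = 0" by (rule \<Phi>_zero) (simp add: Q_def)
    then show ?thesis unfolding \<Phi>_def h_def .
  qed
  ultimately have "infsum h {N<..} = - 1" by (simp add: add_eq_0_iff)
  then have "1 = norm (infsum h {N<..})" by simp
  also have "\<dots> \<le> infsum (\<lambda>j. norm (h j)) {N<..}" by (rule norm_infsum_bound[OF norm_h])
  also have "\<dots> \<le> infsum g {N<..}" by (rule infsum_mono[OF norm_h summ h_g])
  finally show False using tail by simp
qed

theorem zero_if_square_sums_zero:
  assumes a: "a \<in> S" and zero: "\<And>m. squarefree m \<Longrightarrow> square_sum m a = 0"
  shows "a = (\<lambda>_. 0)"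
proof (rule ccontr)
  assume ne: "a \<noteq> (\<lambda>_. 0)"
  obtain Q where Q: "finite Q" "\<And>p. p \<in> Q \<Longrightarrow> prime p"
    and stable: "\<And>p a. prime p \<Longrightarrow> p \<notin> Q \<Longrightarrow> a \<in> vanishing Q \<Longrightarrow> hecke_seq k p a \<in> vanishing Q"
    by (rule vanishing_stabilizes) (rule that)
  have "hecke_stable Q (vanishing Q)"
    unfolding hecke_stable_def using subspace_vanishing vanishing_subset stable by blast
  moreover have "a \<in> vanishing Q" using a zero by (simp add: vanishing_def)
  ultimately have "\<exists>u\<in>vanishing Q. u \<noteq> (\<lambda>_. 0) \<and>
      (\<exists>l. \<forall>p. prime p \<longrightarrow> p \<notin> Q \<longrightarrow> hecke_seq k p u = (\<lambda>n. l p * u n))"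
    by (rule simultaneous_eigenvector_exists) (rule ne)
  then obtain u l where u: "u \<in> vanishing Q" "u \<noteq> (\<lambda>_. 0)"
    and eig: "\<And>p. prime p \<Longrightarrow> p \<notin> Q \<Longrightarrow> hecke_seq k p u = (\<lambda>n. l p * u n)"
    by (elim bexE conjE exE) (rule that, assumption+, blast)
  have uS: "u \<in> S" using u(1) vanishing_subset by blast
  have u1: "u 1 \<noteq> 0" using eigenvector_zero[OF Q uS _ eig] u(2) by blast
  define v where "v = (\<lambda>n. (1 / u 1) * u n)"
  have v: "v \<in> vanishing Q" unfolding v_def by (rule seq_subspaceD(3)[OF subspace_vanishing u(1)])
  then have vS: "v \<in> S" using vanishing_subset by blast
  have v1: "v 1 = 1" using u1 by (simp add: v_def)
  have "hecke_seq k p v = (\<lambda>n. l p * v n)" if "prime p" "p \<notin> Q" for p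
    unfolding v_def hecke_seq_linear(3) eig[OF that] by (simp add: fun_eq_iff)
  then have "hecke_seq k p v = (\<lambda>n. v p * v n)" if "prime p" for p
    using full_eigenvector[OF Q vS v1, of l p] that by blast
  then have "square_sum 1 v \<noteq> 0" by (rule eigenform_square_sum_nonzero[OF vS v1])
  \<comment> \<open>The relation at \<open>m = 1\<close> belongs to the definition of V_Q for every
    \<open>Q\<close>, and it is the one the eigenform violates.\<close>
  moreover have "\<forall>p\<in>Q. \<not> p dvd 1" using Q(2) not_prime_unit by blast
  ultimately show False using v squarefree_1 unfolding vanishing_def by blast
qed

end

section \<open>Vanishing of cusp forms\<close>

lemma powr_of_nat_mult: "(of_nat (m * n) :: complex) powr s = of_nat m powr s * of_nat n powr s"
  using powr_times_real[of "of_nat m" "of_nat n" s] by simp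

lemma norm_powr_of_nat: "norm ((of_nat n :: complex) powr s) = real n powr Re s"
  by (cases "n = 0") (simp_all add: norm_powr_real_powr)

definition cusp_form_coeffs :: "nat \<Rightarrow> (nat \<Rightarrow> complex) set" where
  "cusp_form_coeffs k = {a. \<exists>f\<in>cusp_forms k. has_q_expansion f a}"

lemma cusp_form_coeffsE:
  assumes "a \<in> cusp_form_coeffs k"
  obtains f where "f \<in> cusp_forms k" "has_q_expansion f a" "modular_gamma0 k 1 f" "a 0 = 0"
proof -
  obtain f where f: "f \<in> cusp_forms k" "has_q_expansion f a" using assms by (auto simp: cusp_form_coeffs_def)
  then obtain b where "has_q_expansion f b" "b 0 = 0" "modular_gamma0 k 1 f" by (auto simp: cusp_forms_iff)
  then show ?thesis using f has_q_expansion_unique that by blast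
qed

lemma cusp_form_coeffs_subspace: "seq_subspace (cusp_form_coeffs k)"
proof -
  have lincomb: "(\<lambda>n. a n + c * b n) \<in> cusp_form_coeffs k" if a: "a \<in> cusp_form_coeffs k" and b: "b \<in> cusp_form_coeffs k" for a b c
  proof -
    obtain f where f: "f \<in> cusp_forms k" "has_q_expansion f a" "modular_gamma0 k 1 f" "a 0 = 0" by (rule cusp_form_coeffsE[OF a])
    obtain g where g: "g \<in> cusp_forms k" "has_q_expansion g b" "modular_gamma0 k 1 g" "b 0 = 0" by (rule cusp_form_coeffsE[OF b])
    have exp: "has_q_expansion (\<lambda>z. f z + c * g z) (\<lambda>n. a n + c * b n)" by (rule has_q_expansion_lincomb[OF f(2) g(2)])
    moreover have "modular_gamma0 k 1 (\<lambda>z. f z + c * g z)"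
      unfolding modular_gamma0_def using modular_gamma0D[OF f(3)] modular_gamma0D[OF g(3)] by (simp add: distrib_left mult.left_commute)
    moreover have "(\<lambda>z. f z + c * g z) holomorphic_on upper_half_plane"
      using f(1) g(1) by (auto simp: cusp_forms_iff intro!: holomorphic_intros)
    ultimately have "(\<lambda>z. f z + c * g z) \<in> cusp_forms k" using f(4) g(4) by (auto simp: cusp_forms_iff)
    then show ?thesis using exp by (auto simp: cusp_form_coeffs_def)
  qed
  have zero: "(\<lambda>_. 0) \<in> cusp_form_coeffs k"
  proof -
    have "has_q_expansion (\<lambda>_. 0) (\<lambda>_. 0)" by (simp add: has_q_expansion_def)
    then have "(\<lambda>_. 0) \<in> cusp_forms k" unfolding cusp_forms_iff modular_gamma0_def by auto
    with \<open>has_q_expansion (\<lambda>_. 0) (\<lambda>_. 0)\<close> show ?thesis unfolding cusp_form_coeffs_def by blast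
  qed
  show ?thesis unfolding seq_subspace_def
    using zero lincomb[of _ _ 1] lincomb[OF zero] by simp
qed

lemma cusp_form_coeffs_summable:
  assumes k: "k \<ge> 4" "even k" and a: "a \<in> cusp_form_coeffs k" and s: "Re s > (real k + 1) / 2"
  shows "summable (\<lambda>n. norm (a n * of_nat n powr (- s)))"
proof -
  obtain l where l: "k = 2 * l" using k(2) by (auto elim: evenE)
  obtain f where f: "f \<in> cusp_forms k" "has_q_expansion f a" "modular_gamma0 k 1 f" "a 0 = 0" by (rule cusp_form_coeffsE[OF a])
  have "summable (\<lambda>n. norm (a n) * real n powr (- Re s))"
    by (rule cusp_form_dirichlet_summable[of l f]) (use f l k s in auto)
  then show ?thesis by (simp only: norm_mult norm_powr_of_nat uminus_complex.sel)
qed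

text \<open>A subseries of an absolutely convergent series, with the constant factor coming from
  \<open>m\<close> divided out.\<close>

lemma square_multiples_summable:
  fixes a :: "nat \<Rightarrow> complex"
  assumes a: "summable (\<lambda>n. norm (a n * of_nat n powr (- s)))" and m: "m > 0"
  shows "(\<lambda>j. norm ((of_nat j powr (- s))\<^sup>2 * a (m * j\<^sup>2))) summable_on UNIV"
proof -
  have inj: "inj_on (\<lambda>j. m * j\<^sup>2) UNIV" using m by (auto intro!: inj_onI simp: power2_eq_iff_nonneg)
  have "(\<lambda>n. norm (a n * of_nat n powr (- s))) summable_on UNIV" using a by (simp add: summable_on_UNIV_nonneg_real_iff)
  then have "(\<lambda>n. norm (a n * of_nat n powr (- s))) summable_on range (\<lambda>j. m * j\<^sup>2)"
    by (rule summable_on_subset_banach) simp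
  then have "(\<lambda>j. norm (a (m * j\<^sup>2) * of_nat (m * j\<^sup>2) powr (- s))) summable_on UNIV"
    unfolding summable_on_reindex[OF inj] by (simp only: o_def)
  then have "(\<lambda>j. (1 / norm ((of_nat m :: complex) powr (- s))) * norm (a (m * j\<^sup>2) * of_nat (m * j\<^sup>2) powr (- s))) summable_on UNIV"
    by (rule summable_on_cmult_right)
  moreover have "(1 / norm ((of_nat m :: complex) powr (- s))) * norm (a (m * j\<^sup>2) * of_nat (m * j\<^sup>2) powr (- s)) =
      norm ((of_nat j powr (- s))\<^sup>2 * a (m * j\<^sup>2))" for j
  proof -
    have "norm ((of_nat m :: complex) powr (- s)) \<noteq> 0" using m by simp
    then show ?thesis unfolding powr_of_nat_mult power2_eq_square by (simp add: norm_mult)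
  qed
  ultimately show ?thesis by simp
qed

text \<open>\<open>B\<close> is \<open>k\<close> because \<open>initial_coeffs_zero\<close> asks for
  as many vanishing coefficients as the weight; writing j^(-2s) as a square leaves one exponent
  \<open>- s\<close> throughout.\<close>

lemma hecke_space_cusp_forms:
  assumes k: "k \<ge> 4" "even k" and s: "Re s > (real k + 1) / 2"
  shows "hecke_space (cusp_form_coeffs k) k k (\<lambda>j. (of_nat j powr (- s))\<^sup>2)"
proof
  fix p :: nat and a assume p: "prime p" and a: "a \<in> cusp_form_coeffs k"
  obtain f where f: "f \<in> cusp_forms k" "has_q_expansion f a" by (rule cusp_form_coeffsE[OF a])
  have "hecke_op k p f \<in> cusp_forms k" by (rule hecke_op_cusp_forms) (use k f p in auto)
  moreover have "has_q_expansion (hecke_op k p f) (hecke_seq k p a)"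
    unfolding hecke_seq_def[abs_def] by (rule hecke_op_q_expansion[OF f(2) prime_gt_0_nat[OF p]])
  ultimately show "hecke_seq k p a \<in> cusp_form_coeffs k" by (auto simp: cusp_form_coeffs_def)
next
  fix Q a assume Q: "finite Q" "\<And>p. p \<in> Q \<Longrightarrow> prime p" and a: "a \<in> cusp_form_coeffs k"
    and zero: "\<And>n. (\<And>p. p \<in> Q \<Longrightarrow> \<not> p dvd n) \<Longrightarrow> a n = 0"
  obtain f where f: "modular_gamma0 k 1 f" "has_q_expansion f a" by (rule cusp_form_coeffsE[OF a])
  show "a = (\<lambda>_. 0)"
    by (rule coprime_coeffs_zero[OF Q _ f _ zero]) (use k Q(2) not_prime_unit in auto)
next
  fix a assume a: "a \<in> cusp_form_coeffs k" and zero: "\<And>n. n < k \<Longrightarrow> a n = 0"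
  obtain l where l: "k = 2 * l" using k(2) by (auto elim: evenE)
  obtain f where f: "modular_gamma0 k 1 f" "has_q_expansion f a" by (rule cusp_form_coeffsE[OF a])
  show "a = (\<lambda>_. 0)"
    by (rule initial_coeffs_zero[of l f]) (use f l k zero in auto)
next
  fix p :: nat assume p: "prime p"
  \<comment> \<open>Otherwise the second summand would have norm 1, but its norm is
    \<open>p powr (k - 1 - 2 * Re s)\<close> with exponent below -2.\<close>
  show "1 + of_nat p ^ (k - 1) * (of_nat p powr (- s))\<^sup>2 \<noteq> (0 :: complex)"
  proof
    assume "1 + of_nat p ^ (k - 1) * (of_nat p powr (- s))\<^sup>2 = (0 :: complex)"
    then have "of_nat p ^ (k - 1) * (of_nat p powr (- s))\<^sup>2 = (- 1 :: complex)" by (simp add: add_eq_0_iff)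
    then have "norm (of_nat p ^ (k - 1) * ((of_nat p :: complex) powr (- s))\<^sup>2) = 1" by simp
    then have "real p ^ (k - 1) * (real p powr (- Re s))\<^sup>2 = 1"
      by (simp add: norm_mult norm_power norm_powr_of_nat)
    moreover have "real p ^ (k - 1) * (real p powr (- Re s))\<^sup>2 = real p powr (real (k - 1) - 2 * Re s)"
      using prime_gt_0_nat[OF p] by (simp add: powr_realpow[symmetric] power2_eq_square powr_add[symmetric])
    moreover have "real p powr (real (k - 1) - 2 * Re s) < real p powr 0"
      using s k prime_gt_1_nat[OF p] by (intro powr_less_mono) (auto simp: field_simps)
    ultimately show False using prime_gt_0_nat[OF p] by simp
  qed
next
  fix a m assume "a \<in> cusp_form_coeffs k" "(m :: nat) > 0"
  then show "(\<lambda>j. norm ((of_nat j powr (- s))\<^sup>2 * a (m * j\<^sup>2))) summable_on UNIV"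
    using square_multiples_summable cusp_form_coeffs_summable[OF k _ s] by blast
next
  show "seq_subspace (cusp_form_coeffs k)" by (rule cusp_form_coeffs_subspace)
  show "a 0 = 0" if "a \<in> cusp_form_coeffs k" for a using cusp_form_coeffsE[OF that] by blast
\<comment> \<open>The value \<open>t 0 = 0\<close> comes from the convention that 0 raised by
  \<open>powr\<close> is 0.\<close>
qed (simp_all only: powr_of_nat_mult power_mult_distrib, simp_all)

theorem theorem3p2:
  fixes k b :: nat and f :: "complex \<Rightarrow> complex" and s :: complex
  assumes "k \<ge> 4" and "even k"
    and "b \<in> {1, 3}"
    and "f \<in> cusp_forms k"
    and "Re s > (real k + 1) / 2"
    and "\<And>p::nat. prime p \<Longrightarrow> [p = b] (mod 4) \<Longrightarrow> twisted_L f (legendre_char p) s = 0"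
  shows "\<forall>z\<in>upper_half_plane. f z = 0"
proof -
  obtain a where a: "has_q_expansion f a" "a 0 = 0" using assms(4) by (auto simp: cusp_forms_iff)
  have q: "q_coeff f = a" by (rule q_coeff_eqI[OF a(1)])
  have aS: "a \<in> cusp_form_coeffs k" using a assms(4) by (auto simp: cusp_form_coeffs_def)
  \<comment> \<open>\<open>twisted_L\<close> starts at index 1. Since \<open>powr\<close> is 0 at
    base 0, \<open>h 0 = 0\<close>, and the sums may start at 0.\<close>
  define h where "h = (\<lambda>n. a n * of_nat n powr (- s))"
  have h: "summable (\<lambda>n. norm (h n))" "h 0 = 0"
    using cusp_form_coeffs_summable[OF assms(1,2) aS assms(5)] by (simp_all add: h_def)
  have h_zero: "(\<Sum>n. h n * of_int (Legendre (int n) p)) = 0" if "prime p" "[p = b] (mod 4)" for p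
  proof -
    have "summable (\<lambda>n. h n * of_int (Legendre (int n) p))"
    proof (rule summable_norm_cancel, rule summable_comparison_test'[OF h(1), of 0])
      show "norm (norm (h n * of_int (Legendre (int n) p))) \<le> norm (h n)" for n
        using mult_left_mono[OF abs_Legendre_le[of "int n" "int p"], of "norm (h n)"] by (simp add: norm_mult)
    qed
    from suminf_split_head[OF this]
    have "(\<Sum>n. h n * of_int (Legendre (int n) p)) = (\<Sum>n. h (Suc n) * of_int (Legendre (int (Suc n)) p))"
      using h(2) by simp
    also have "\<dots> = twisted_L f (legendre_char p) s"
      unfolding twisted_L_def legendre_char_def h_def q by (simp add: mult_ac)
    finally show ?thesis using assms(6)[OF that] by simp
  qed
  interpret hecke_space "cusp_form_coeffs k" k k "\<lambda>j. (of_nat j powr (- s))\<^sup>2"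
    by (rule hecke_space_cusp_forms[OF assms(1,2,5)])
  have "square_sum m a = 0" if m: "squarefree m" for m
  proof -
    have m0: "m > 0" by (rule squarefree_nat_pos[OF m])
    have inj: "inj_on (\<lambda>j. m * j\<^sup>2) UNIV" using m0 by (auto intro!: inj_onI simp: power2_eq_iff_nonneg)
    let ?g = "\<lambda>n. if \<exists>r. n * m = r\<^sup>2 then h n else 0"
    have "0 = suminf ?g" using square_class_sum_zero[OF h assms(3) m0 h_zero] by simp
    also have "\<dots> = infsum ?g UNIV"
      by (rule suminf_eq_infsum_norm, rule summable_comparison_test'[OF h(1), of 0]) auto
    also have "\<dots> = infsum h (range (\<lambda>j. m * j\<^sup>2))"
      unfolding mult_square_iff[OF m] by (rule infsum_cong_neutral) auto
    also have "\<dots> = (\<Sum>\<^sub>\<infinity>j. h (m * j\<^sup>2))" by (subst infsum_reindex[OF inj]) (simp add: o_def)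
    \<comment> \<open>Multiplicativity of \<open>powr\<close> on natural numbers pulls out a nonzero
      factor depending on \<open>m\<close> alone.\<close>
    also have "\<dots> = (\<Sum>\<^sub>\<infinity>j. of_nat m powr (- s) * ((of_nat j powr (- s))\<^sup>2 * a (m * j\<^sup>2)))"
      unfolding h_def powr_of_nat_mult power2_eq_square by (simp only: mult_ac)
    also have "\<dots> = of_nat m powr (- s) * square_sum m a"
      unfolding square_sum_def by (rule infsum_cmult_right')
    finally show ?thesis using m0 by simp
  qed
  then have "a = (\<lambda>_. 0)" by (rule zero_if_square_sums_zero[OF aS])
  then have "(\<lambda>n. 0) sums f z" if "z \<in> upper_half_plane" for z
    using a(1) that by (simp add: has_q_expansion_def)
  then show ?thesis using sums_unique2 sums_zero by blast
qed

end
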